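(* For every integer $r\ge 1$ there exists a positive integer $T_r$ such that: if $\ell$ is a positive odd integer with at most $r$ distinct prime factors and $n$ is an integer with $n\ge T_r$, then $\Omega_\ell(n)=(1^\ell+1)(2^\ell+1)\cdots(n^\ell+1)$ is not a powerful number.
   Context: A positive integer $a$ is called a powerful number if for every prime $p$, $p\mid a$ implies $p^2\mid a$. For a positive integer $\ell$ and positive integer $n$, $\Omega_\ell(n)=\prod_{a=1}^{n}(a^\ell+1)$. *)

theory Defs
  imports "HOL-Computational_Algebra.Primes"
begin

definition powerful :: "nat \<Rightarrow> bool" where
  "powerful a \<longleftrightarrow> a > 0 \<and> (\<forall>p. prime p \<longrightarrow> p dvd a \<longrightarrow> p^2 dvd a)"

definition Omega :: "nat \<Rightarrow> nat \<Rightarrow> nat" where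
  "Omega l n = (\<Prod>a = 1..n. a ^ l + 1)"

end

theory Submission
  imports Defs "HOL-Complex_Analysis.Complex_Analysis" "HOL-Probability.Sinc_Integral"
    "HOL-Number_Theory.Number_Theory" "HOL-Computational_Algebra.Squarefree"
    "HOL-Real_Asymp.Real_Asymp"
begin

text \<open>
  Put \<open>N = n + 1\<close>. If \<open>q\<close> is a prime with \<open>N/2 < q \<le> N\<close> and \<open>q (q - 1)\<close> is coprime to \<open>l\<close>, then
  \<open>a^l \<equiv> -1\<close> mod \<open>q\<close> forces \<open>a \<equiv> -1\<close>, so \<open>a = q - 1\<close> is the only factor divisible by \<open>q\<close>, and it is
  divisible by \<open>q\<close> exactly once. So it suffices to find such a prime for large \<open>N\<close>, uniformly in \<open>l\<close>.

  Primes \<open>q \<equiv> 1\<close> modulo a large prime factor \<open>p\<close> of \<open>l\<close> are rare: their total logarithmic weight is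
  \<open>O(N log p / p)\<close>, by a Chebyshev-type divisibility argument. For the small prime factors one asks
  that \<open>q\<close> be a quadratic nonresidue modulo each of them. Expanding the product of the factors
  \<open>1 - (q/p)\<close> gives the main term \<open>\<psi>(N) - \<psi>(N/2) \<ge> N/10\<close> plus finitely many sums
  \<open>\<Sum> \<chi>(n) \<Lambda>(n)\<close> over nontrivial real characters \<open>\<chi>\<close>, which are \<open>o(N)\<close>: nonvanishing of \<open>L(s, \<chi>)\<close> on
  \<open>Re s = 1\<close> and a Fourier-analytic Tauberian theorem give \<open>\<Sum> \<mu>(n) \<chi>(n) = o(N)\<close>, and the hyperbola
  method passes from \<open>\<mu>\<close> to \<open>\<Lambda>\<close>.
\<close>

section \<open>A Tauberian theorem for Dirichlet series with bounded coefficients\<close>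

text \<open>The obstacle is uniformity in \<open>l\<close>: only the number of its prime factors is
  bounded, not their size. A cutoff \<open>K\<close> that depends on \<open>r\<close> alone removes
  it. The prime factors below \<open>K\<close> form one of finitely many sets, so finitely many
  asymptotic statements give one threshold; a prime factor above \<open>K\<close> spoils so little
  of the logarithmic weight that \<open>r\<close> of them cost at most half of what is available.
  Asking for nonresidues instead of all q not congruent to 1 loses a factor depending on
  \<open>r\<close> only, and keeps every character real. The Tauberian step is applied to \<mu>
  because its coefficients are bounded and its series 1/L(s, \<chi>) extends continuously to Re s =
  1 as soon as L has no zero there. The main term, which belongs to the trivial character, comes
  from factorials: a positive proportion of the mass of (N/2, N] is enough.\<close>

definition tent :: "real \<Rightarrow> real" where
  "tent y = max 0 (1 - \<bar>y\<bar>)"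

text \<open>The Fourier transform of \<open>tent\<close>, equal to (sin(z/2) / (z/2))^2, with its
  limit filled in at 0. It is nonnegative and integrable, and its transform has compact support, so
  smoothing with it tests the boundary function only on a bounded segment.\<close>

definition fejer :: "real \<Rightarrow> real" where
  "fejer z = (if z = 0 then 1 else 2 * (1 - cos z) / z\<^sup>2)"

lemma tent_nonneg: "tent y \<ge> 0"
  and tent_eq_0: "\<bar>y\<bar> \<ge> 1 \<Longrightarrow> tent y = 0"
  and tent_le_1: "tent y \<le> 1"
  by (auto simp: tent_def)

lemma continuous_on_tent [continuous_intros]:
  "continuous_on A f \<Longrightarrow> continuous_on A (\<lambda>x. tent (f x))"
  unfolding tent_def by (intro continuous_intros)

lemma borel_measurable_tent [measurable]: "tent \<in> borel_measurable borel"
  by (intro borel_measurable_continuous_onI continuous_intros)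

lemma borel_measurable_fejer [measurable]: "fejer \<in> borel_measurable borel"
  unfolding fejer_def by measurable

lemma fejer_nonneg: "fejer z \<ge> 0"
  by (auto simp: fejer_def)

lemma one_minus_cos_le: "1 - cos z \<le> z\<^sup>2 / 2" for z :: real
proof -
  have "1 - cos z = 2 * (sin (z / 2))\<^sup>2"
    using cos_double_sin[of "z / 2"] by simp
  also have "(sin (z / 2))\<^sup>2 \<le> (z / 2)\<^sup>2"
    using abs_sin_x_le_abs_x[of "z / 2"] by (simp only: abs_le_square_iff)
  finally show ?thesis by (simp add: power2_eq_square)
qed

text \<open>The constant is 1 + 4: one summand uses 1 - cos z \<le> z^2 / 2, the other 1 - cos z
  \<le> 2.\<close>

lemma fejer_le: "fejer z \<le> 5 * inverse (1 + z\<^sup>2)"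
proof (cases "z = 0")
  case False
  have "2 * (1 - cos z) * (1 + z\<^sup>2) = 2 * (1 - cos z) + 2 * (1 - cos z) * z\<^sup>2"
    by (simp add: algebra_simps)
  also have "\<dots> \<le> z\<^sup>2 + 4 * z\<^sup>2"
  proof (intro add_mono mult_right_mono)
    have "-1 \<le> cos z" by simp
    then show "2 * (1 - cos z) \<le> 4" by argo
  qed (use one_minus_cos_le[of z] in auto)
  finally have "2 * (1 - cos z) * (1 + z\<^sup>2) \<le> 5 * z\<^sup>2" by simp
  with False show ?thesis
    by (simp add: fejer_def field_simps add_pos_nonneg)
qed (simp add: fejer_def)

lemma integrable_fejer: "integrable lborel fejer"
proof (rule Bochner_Integration.integrable_bound)
  have "integrable lborel (\<lambda>x::real. inverse (1 + x\<^sup>2))"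
    using integrable_inverse_1_plus_square by (simp add: set_integrable_def)
  then show "integrable lborel (\<lambda>x::real. 5 * inverse (1 + x\<^sup>2))" by simp
  show "AE x in lborel. norm (fejer x) \<le> norm (5 * inverse (1 + x\<^sup>2))"
  proof (rule AE_I2)
    fix x :: real
    have "0 \<le> 5 * inverse (1 + x\<^sup>2)" by simp
    then show "norm (fejer x) \<le> norm (5 * inverse (1 + x\<^sup>2))"
      using fejer_le[of x] fejer_nonneg[of x] by simp
  qed
qed measurable

lemma integral_fejer_pos: "(\<integral>z. fejer z \<partial>lborel) > 0"
proof -
  have "(\<integral>z. fejer z \<partial>lborel) \<noteq> 0"
  proof
    assume "(\<integral>z. fejer z \<partial>lborel) = 0"
    then have "AE z in lborel. fejer z = 0"
      using integral_nonneg_eq_0_iff_AE[OF integrable_fejer] fejer_nonneg by auto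
    moreover have "fejer z \<noteq> 0" if "z \<in> {0..1}" for z
    proof -
      have "cos z \<noteq> 1" if "z \<noteq> 0"
        using cos_one_2pi_int[of z] \<open>z \<in> {0..1}\<close> that pi_gt3
          cos_monotone_0_pi[of 0 z] by auto
      then show ?thesis by (auto simp: fejer_def)
    qed
    ultimately have "AE z in lborel. z \<notin> {0..1::real}" by (auto elim!: eventually_mono)
    then have "emeasure lborel {0..1::real} = 0"
      by (subst (asm) AE_iff_measurable[of "{0..1}"]) auto
    then show False by simp
  qed
  moreover have "(\<integral>z. fejer z \<partial>lborel) \<ge> 0"
    by (intro integral_nonneg_AE) (simp add: fejer_nonneg)
  ultimately show ?thesis by simp
qed

lemma integrable_tent: "integrable lborel tent"
proof (rule Bochner_Integration.integrable_bound)
  show "integrable lborel (indicator {-1..1} :: real \<Rightarrow> real)" by simp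
  show "AE x in lborel. norm (tent x) \<le> norm (indicator {-1..1} x :: real)"
    by (rule AE_I2) (auto simp: tent_def indicator_def)
qed measurable

text \<open>Explicit antiderivatives on the two halves of the support. The halves share the point 0,
  so \<open>tent\<close> agrees with their sum only almost everywhere. The antiderivatives divide by
  z, hence the separate case z = 0.\<close>

lemma fourier_tent:
  "(\<integral>y. of_real (tent y) * exp (\<i> * of_real (z * y)) \<partial>lborel) = (of_real (fejer z) :: complex)"
proof (cases "z = 0")
  case True
  have *: "has_bochner_integral lborel (\<lambda>y. indicator {0..1} y *\<^sub>R (1 - y)) ((1 - 1\<^sup>2 / 2) - (0 - 0\<^sup>2 / 2 :: real))"
    by (rule has_bochner_integral_FTC_Icc)
       (auto intro!: derivative_eq_intros continuous_intros simp flip: has_real_derivative_iff_has_vector_derivative)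
  have **: "has_bochner_integral lborel (\<lambda>y. indicator {-1..0} y *\<^sub>R (1 + y)) ((0 + 0\<^sup>2 / 2) - ((-1) + (-1)\<^sup>2 / 2 :: real))"
    by (rule has_bochner_integral_FTC_Icc)
       (auto intro!: derivative_eq_intros continuous_intros simp flip: has_real_derivative_iff_has_vector_derivative)
  have "has_bochner_integral lborel tent 1"
  proof (subst has_bochner_integral_cong_AE)
    show "AE y in lborel. tent y = indicator {0..1} y *\<^sub>R (1 - y) + indicator {-1..0} y *\<^sub>R (1 + y)"
      using AE_lborel_singleton[of "0::real"] by eventually_elim (auto simp: tent_def indicator_def)
    show "has_bochner_integral lborel (\<lambda>y. indicator {0..1} y *\<^sub>R (1 - y) + indicator {-1..0} y *\<^sub>R (1 + y)) (1::real)"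
      using has_bochner_integral_add[OF * **] by simp
  qed auto
  then have "(\<integral>y. tent y \<partial>lborel) = 1" by (simp add: has_bochner_integral_integral_eq)
  with True show ?thesis by (simp add: fejer_def)
next
  case False
  define w where "w = \<i> * of_real z"
  have w: "w \<noteq> 0" using False by (simp add: w_def)
  have d1: "((\<lambda>y. exp (w * of_real y) * ((1 - of_real y) / w + 1 / w\<^sup>2)) has_vector_derivative
              (1 - of_real y) * exp (w * of_real y)) (at y within A)" for y A
  proof -
    have "((\<lambda>y. exp (w * y) * ((1 - y) / w + 1 / w\<^sup>2)) has_field_derivative
              (1 - of_real y) * exp (w * of_real y)) (at (of_real y))"
      using w by (auto intro!: derivative_eq_intros simp: field_simps power2_eq_square)
    from has_vector_derivative_real_field[OF this] show ?thesis .
  qed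
  have d2: "((\<lambda>y. exp (w * of_real y) * ((1 + of_real y) / w - 1 / w\<^sup>2)) has_vector_derivative
              (1 + of_real y) * exp (w * of_real y)) (at y within A)" for y A
  proof -
    have "((\<lambda>y. exp (w * y) * ((1 + y) / w - 1 / w\<^sup>2)) has_field_derivative
              (1 + of_real y) * exp (w * of_real y)) (at (of_real y))"
      using w by (auto intro!: derivative_eq_intros simp: field_simps power2_eq_square)
    from has_vector_derivative_real_field[OF this] show ?thesis .
  qed
  have *: "has_bochner_integral lborel (\<lambda>y. indicator {0..1} y *\<^sub>R ((1 - of_real y) * exp (w * of_real y)))
      (exp (w * of_real 1) * ((1 - of_real 1) / w + 1 / w\<^sup>2) - exp (w * of_real 0) * ((1 - of_real 0) / w + 1 / w\<^sup>2))"
    by (rule has_bochner_integral_FTC_Icc) (auto intro!: d1 continuous_intros)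
  have **: "has_bochner_integral lborel (\<lambda>y. indicator {-1..0} y *\<^sub>R ((1 + of_real y) * exp (w * of_real y)))
      (exp (w * of_real 0) * ((1 + of_real 0) / w - 1 / w\<^sup>2) - exp (w * of_real (-1)) * ((1 + of_real (-1)) / w - 1 / w\<^sup>2))"
    by (rule has_bochner_integral_FTC_Icc) (auto intro!: d2 continuous_intros)
  have "has_bochner_integral lborel (\<lambda>y. of_real (tent y) * exp (w * of_real y)) ((exp w + exp (-w) - 2) / w\<^sup>2)"
  proof (subst has_bochner_integral_cong_AE)
    show "AE y in lborel. of_real (tent y) * exp (w * of_real y) =
        indicator {0..1} y *\<^sub>R ((1 - of_real y) * exp (w * of_real y)) + indicator {-1..0} y *\<^sub>R ((1 + of_real y) * exp (w * of_real y))"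
      using AE_lborel_singleton[of "0::real"]
      by eventually_elim (auto simp: tent_def indicator_def)
    show "has_bochner_integral lborel (\<lambda>y. indicator {0..1} y *\<^sub>R ((1 - of_real y) * exp (w * of_real y)) + 
        indicator {-1..0} y *\<^sub>R ((1 + of_real y) * exp (w * of_real y))) ((exp w + exp (-w) - 2) / w\<^sup>2)"
      using has_bochner_integral_add[OF * **] w
      by (simp add: diff_divide_distrib add_divide_distrib add_diff_eq)
  qed auto
  then have "(\<integral>y. of_real (tent y) * exp (w * of_real y) \<partial>lborel) = (exp w + exp (-w) - 2) / w\<^sup>2"
    by (simp add: has_bochner_integral_integral_eq)
  also have "exp w + exp (-w) = 2 * of_real (cos z)"
    using cos_exp_eq[of "of_real z"] by (simp add: w_def cos_of_real field_simps)
  also have "(2 * of_real (cos z) - 2) / w\<^sup>2 = of_real (fejer z)"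
    using False by (simp add: fejer_def w_def power_mult_distrib field_simps)
  finally show ?thesis by (simp add: w_def mult.assoc)
qed

section \<open>The Riemann-Lebesgue lemma and a Tauberian theorem for Laplace transforms\<close>

text \<open>Shifting y by half a period pi / w flips the sign of the oscillating factor. Averaging
  the two forms of the integral leaves the difference g y - g (y + pi / w), which tends to 0 by
  continuity and dominated convergence.\<close>

lemma riemann_lebesgue:
  fixes g :: "real \<Rightarrow> complex"
  assumes cont: "continuous_on UNIV g" and supp: "\<And>y. \<bar>y\<bar> \<ge> 1 \<Longrightarrow> g y = 0"
  shows "((\<lambda>w. \<integral>y. g y * exp (\<i> * of_real (w * y)) \<partial>lborel) \<longlongrightarrow> 0) at_top"
proof -
  define I where "I = (\<lambda>w. \<integral>y. g y * exp (\<i> * of_real (w * y)) \<partial>lborel)"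
  have meas [measurable]: "g \<in> borel_measurable borel"
    using cont by (rule borel_measurable_continuous_onI)
  have "compact (g ` {-1..1})"
    using cont by (intro compact_continuous_image) (auto intro: continuous_on_subset)
  then obtain C where C: "\<And>y. y \<in> {-1..1} \<Longrightarrow> norm (g y) \<le> C"
    by (meson bounded_iff compact_imp_bounded image_eqI)
  then have "C \<ge> 0" using norm_ge_zero order_trans by (metis atLeastAtMost_iff neg_le_0_iff_le zero_le_one)
  have gC: "norm (g y) \<le> C * indicator {-1..1} y" for y
    using C[of y] supp[of y] by (auto simp: indicator_def abs_if split: if_splits)
  have gC': "norm (g y) \<le> C" for y
    using gC[of y] \<open>C \<ge> 0\<close> by (cases "y \<in> {-1..1}") auto
  have int_g: "integrable lborel (\<lambda>y. g y * exp (\<i> * of_real (w * y)))" for w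
  proof (rule Bochner_Integration.integrable_bound)
    show "integrable lborel (\<lambda>y::real. C * indicator {-1..1} y)"
      by (intro integrable_mult_right integrable_real_indicator) auto
    show "AE y in lborel. norm (g y * exp (\<i> * of_real (w * y))) \<le> norm (C * indicator {-1..1} y :: real)"
      using gC \<open>C \<ge> 0\<close> by (intro AE_I2) (auto simp: norm_mult abs_mult)
  qed measurable
  define J where "J = (\<lambda>w. \<integral>y. norm (g y - g (y + pi / w)) \<partial>lborel)"
  have bound: "norm (I w) \<le> J w" if "w > 0" for w
  proof -
    have shift: "w * (pi / w + 1 * y) = pi + w * y" for y
      using that by (simp add: field_simps)
    have "I w = (\<integral>y. g (pi / w + 1 * y) * exp (\<i> * of_real (w * (pi / w + 1 * y))) \<partial>lborel)"
      unfolding I_def by (subst lborel_integral_real_affine[where c=1 and t="pi / w"]) auto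
    also have "\<dots> = (\<integral>y. - (g (y + pi / w) * exp (\<i> * of_real (w * y))) \<partial>lborel)"
    proof (rule Bochner_Integration.integral_cong)
      fix y :: real
      have "exp (\<i> * of_real (w * (pi / w + 1 * y))) = exp (\<i> * of_real pi) * exp (\<i> * of_real (w * y))"
        unfolding shift unfolding of_real_add distrib_left exp_add ..
      then show "g (pi / w + 1 * y) * exp (\<i> * of_real (w * (pi / w + 1 * y))) =
                 - (g (y + pi / w) * exp (\<i> * of_real (w * y)))"
        by (simp add: add.commute)
    qed simp
    finally have I2: "I w = (\<integral>y. - (g (y + pi / w) * exp (\<i> * of_real (w * y))) \<partial>lborel)" .
    have int2: "integrable lborel (\<lambda>y. g (y + pi / w) * exp (\<i> * of_real (w * y)))"
    proof -
      have "integrable lborel (\<lambda>y. g (pi / w + 1 * y) * exp (\<i> * of_real (w * (pi / w + 1 * y))))"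
        by (rule lborel_integrable_real_affine[OF int_g]) simp
      moreover have "norm (exp (- (\<i> * of_real pi))) = 1" by simp
      ultimately have "integrable lborel (\<lambda>y. g (pi / w + 1 * y) * exp (\<i> * of_real (w * (pi / w + 1 * y))) * exp (- (\<i> * of_real pi)))"
        by (intro integrable_mult_left) auto
      also have "(\<lambda>y. g (pi / w + 1 * y) * exp (\<i> * of_real (w * (pi / w + 1 * y))) * exp (- (\<i> * of_real pi))) =
          (\<lambda>y. g (y + pi / w) * exp (\<i> * of_real (w * y)))"
        unfolding shift unfolding of_real_add distrib_left exp_add by (simp add: fun_eq_iff add.commute exp_minus)
      finally show ?thesis .
    qed
    have "2 * I w = I w + I w" by simp
    also have "\<dots> = (\<integral>y. g y * exp (\<i> * of_real (w * y)) + - (g (y + pi / w) * exp (\<i> * of_real (w * y))) \<partial>lborel)"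
      by (subst (2) I2, unfold I_def, subst Bochner_Integration.integral_add) (use int_g int2 in auto)
    also have "norm \<dots> \<le> (\<integral>y. norm (g y * exp (\<i> * of_real (w * y)) + - (g (y + pi / w) * exp (\<i> * of_real (w * y)))) \<partial>lborel)"
      by (rule integral_norm_bound)
    also have "\<dots> = J w"
      unfolding J_def
    proof (rule Bochner_Integration.integral_cong)
      fix y :: real
      have "g y * exp (\<i> * of_real (w * y)) + - (g (y + pi / w) * exp (\<i> * of_real (w * y))) = (g y - g (y + pi / w)) * exp (\<i> * of_real (w * y))"
        by (simp add: algebra_simps)
      then show "norm (g y * exp (\<i> * of_real (w * y)) + - (g (y + pi / w) * exp (\<i> * of_real (w * y)))) = norm (g y - g (y + pi / w))"
        by (simp add: norm_mult)
    qed simp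
    finally show ?thesis by (simp add: norm_mult) (use norm_ge_zero[of "I w"] in linarith)
  qed
  have "(J \<longlongrightarrow> (\<integral>y. 0 \<partial>(lborel :: real measure))) at_top"
    unfolding J_def
  \<comment> \<open>For w \<ge> 1 the shift pi / w is at most 4, so outside [-5, 5] both g y and its
    shift vanish.\<close>
  proof (rule integral_dominated_convergence_at_top[where w = "\<lambda>y. 2 * C * indicator {-5..5} y"])
    show "integrable lborel (\<lambda>y::real. 2 * C * indicator {-5..5} y)"
      by (intro integrable_mult_right integrable_real_indicator) auto
    have "\<forall>\<^sub>F w in at_top. w \<ge> (1::real)" by (rule eventually_ge_at_top)
    then show "\<forall>\<^sub>F w in at_top. AE y in lborel. norm (norm (g y - g (y + pi / w))) \<le> 2 * C * indicator {-5..5} y"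
    proof eventually_elim
      case (elim w)
      have pw: "pi / w \<le> 4" "pi / w \<ge> 0" using elim pi_less_4 by (auto simp: field_simps)
      have "norm (g y - g (y + pi / w)) \<le> 2 * C * indicator {-5..5} y" for y
      proof (cases "y \<in> {-5..5}")
        case True
        have "norm (g y - g (y + pi / w)) \<le> norm (g y) + norm (g (y + pi / w))" by (rule norm_triangle_ineq4)
        also have "\<dots> \<le> C + C"
          by (intro add_mono gC')
        finally show ?thesis using True by simp
      next
        case False
        then have "g y = 0" "g (y + pi / w) = 0" using pw by (auto intro!: supp)
        then show ?thesis using \<open>C \<ge> 0\<close> by simp
      qed
      then show ?case by (intro AE_I2) simp
    qed
    show "AE y in lborel. ((\<lambda>w. norm (g y - g (y + pi / w))) \<longlongrightarrow> 0) at_top"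
    proof (rule AE_I2)
      fix y :: real
      have "((\<lambda>w. y + pi / w) \<longlongrightarrow> y + 0) at_top"
        by (intro tendsto_intros tendsto_divide_0[OF tendsto_const] filterlim_at_top_imp_at_infinity filterlim_ident)
      moreover have "isCont g y" using cont by (simp add: continuous_on_eq_continuous_at)
      ultimately have "((\<lambda>w. g (y + pi / w)) \<longlongrightarrow> g y) at_top"
        by (auto intro: isCont_tendsto_compose)
      then have "((\<lambda>w. norm (g y - g (y + pi / w))) \<longlongrightarrow> norm (g y - g y)) at_top"
        by (intro tendsto_intros)
      then show "((\<lambda>w. norm (g y - g (y + pi / w))) \<longlongrightarrow> 0) at_top" by simp
    qed
  qed measurable
  then have "(J \<longlongrightarrow> 0) at_top" by simp
  moreover have "\<forall>\<^sub>F w in at_top. norm (I w) \<le> J w"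
    using eventually_gt_at_top[of "0::real"] by eventually_elim (rule bound)
  ultimately have "(I \<longlongrightarrow> 0) at_top" by (rule Lim_null_comparison[rotated])
  then show ?thesis by (simp add: I_def)
qed

text \<open>Smoothing \<open>m\<close> at scale 1 / L with the Fejer kernel gives a Fourier integral
  of G over the segment from -iL to iL, which tends to 0 by Riemann-Lebesgue. Slow oscillation keeps
  \<open>m\<close> close to its smoothing, with an error that vanishes as L grows. The exponential
  term in \<open>slow\<close> leaves room for the jumps of a step function.\<close>

lemma fourier_tauberian:
  fixes m :: "real \<Rightarrow> real" and G :: "complex \<Rightarrow> complex"
  assumes [measurable]: "m \<in> borel_measurable borel"
    and bdd: "\<And>t. \<bar>m t\<bar> \<le> 1"
    and neg: "\<And>t. t < 0 \<Longrightarrow> m t = 0"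
    and slow: "\<And>t u. \<bar>m u - m t\<bar> \<le> 2 * \<bar>u - t\<bar> + exp (- min u t)"
    and int: "\<And>e. e > 0 \<Longrightarrow> integrable lborel (\<lambda>t. m t * exp (- e * t))"
    and laplace: "\<And>s. Re s > 0 \<Longrightarrow> (\<integral>t. of_real (m t) * exp (- s * of_real t) \<partial>lborel) = G s"
    and cont: "continuous_on {s. Re s \<ge> 0} G"
  shows "(m \<longlongrightarrow> 0) at_top"
proof -
  \<comment> \<open>\<open>?W\<close> is the integrand on the frequency side; \<open>?w\<close>
    majorizes the smoothing error at z, including the kernel, whenever u \<ge> L.\<close>
  let ?W = "\<lambda>e L u y. of_real (tent y) * G (Complex e (L * y)) * exp (\<i> * of_real (L * u * y))"
  let ?w = "\<lambda>L z. min 2 (2 * (\<bar>z\<bar> / L) + exp (- L + \<bar>z\<bar> / L)) * fejer z"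
  \<comment> \<open>The damping e > 0 makes \<open>m\<close> integrable, so Fubini applies after the
    kernel is written as the transform of \<open>tent\<close>; the substitution t = u - z / L turns
    the inner integral into a value of G.\<close>
  have eq1: "(\<integral>z. of_real (m (u - z / L) * exp (- e * (u - z / L)) * fejer z) \<partial>lborel) =
      of_real L * (\<integral>y. ?W e L u y \<partial>lborel)"
    if L: "L > 0" and e: "e > 0" for L u e
  proof -
    define h where "h = (\<lambda>z. m (u - z / L) * exp (- e * (u - z / L)))"
    have int_h: "integrable lborel h"
      using lborel_integrable_real_affine[OF int[OF e], of "-1/L" u] L by (simp add: h_def)
    have [measurable]: "h \<in> borel_measurable borel" unfolding h_def by measurable
    define P :: "real \<times> real \<Rightarrow> complex"
      where "P = (\<lambda>(y, z). of_real (tent y) * (of_real (h z) * exp (\<i> * of_real (z * y))))"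
    have [measurable]: "P \<in> borel_measurable (lborel \<Otimes>\<^sub>M lborel)"
      unfolding P_def by measurable
    have int_P: "integrable (lborel \<Otimes>\<^sub>M lborel) P"
    proof (rule lborel_pair.Fubini_integrable)
      have "(\<lambda>y. \<integral>z. norm (P (y, z)) \<partial>lborel) = (\<lambda>y. tent y * (\<integral>z. \<bar>h z\<bar> \<partial>lborel))"
        by (simp add: P_def norm_mult tent_nonneg abs_of_nonneg)
      then show "integrable lborel (\<lambda>y. \<integral>z. norm (P (y, z)) \<partial>lborel)"
        using integrable_tent by simp
      show "AE y in lborel. integrable lborel (\<lambda>z. P (y, z))"
      proof (rule AE_I2)
        fix y :: real
        show "integrable lborel (\<lambda>z. P (y, z))"
          by (rule Bochner_Integration.integrable_bound[OF int_h])
             (auto simp: P_def norm_mult tent_nonneg tent_le_1 mult_left_le_one_le intro!: AE_I2)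
      qed
    qed measurable
    have "(\<integral>z. of_real (h z * fejer z) \<partial>lborel) = (\<integral>z. (\<integral>y. P (y, z) \<partial>lborel) \<partial>lborel)"
    proof (rule Bochner_Integration.integral_cong)
      fix z
      have "(\<integral>y. P (y, z) \<partial>lborel) = (\<integral>y. of_real (h z) * (of_real (tent y) * exp (\<i> * of_real (z * y))) \<partial>lborel)"
        by (simp add: P_def mult_ac)
      also have "\<dots> = of_real (h z) * of_real (fejer z)"
        by (subst integral_mult_right_zero) (simp only: fourier_tent)
      finally show "of_real (h z * fejer z) = (\<integral>y. P (y, z) \<partial>lborel)" by simp
    qed simp
    also have "\<dots> = (\<integral>y. (\<integral>z. P (y, z) \<partial>lborel) \<partial>lborel)"
      using lborel_pair.Fubini_integral[of "\<lambda>y z. P (y, z)"] int_P by simp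
    also have "\<dots> = (\<integral>y. of_real L * (?W e L u y) \<partial>lborel)"
    proof (rule Bochner_Integration.integral_cong)
      fix y :: real
      define E where "E = exp (\<i> * of_real (L * u * y))"
      have "(\<integral>z. of_real (h z) * exp (\<i> * of_real (z * y)) \<partial>lborel) =
          \<bar>- L\<bar> *\<^sub>R (\<integral>t. of_real (h (L * u + (- L) * t)) * exp (\<i> * of_real ((L * u + (- L) * t) * y)) \<partial>lborel)"
        using L by (intro lborel_integral_real_affine) auto
      also have "(\<lambda>t. of_real (h (L * u + (- L) * t)) * exp (\<i> * of_real ((L * u + (- L) * t) * y))) =
          (\<lambda>t. E * (of_real (m t) * exp (- Complex e (L * y) * of_real t)))"
      proof
        fix t
        have "h (L * u + (- L) * t) = m t * exp (- e * t)"
          using L by (simp add: h_def diff_divide_distrib)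
        moreover have "exp (\<i> * of_real ((L * u + (- L) * t) * y)) = E * exp (- \<i> * of_real (L * y * t))"
          unfolding E_def exp_add [symmetric] by (simp add: algebra_simps)
        moreover have "exp (- Complex e (L * y) * of_real t) = of_real (exp (- e * t)) * exp (- \<i> * of_real (L * y * t))"
          unfolding exp_of_real [symmetric] exp_add [symmetric]
          by (simp add: Complex_eq algebra_simps)
        ultimately show "of_real (h (L * u + (- L) * t)) * exp (\<i> * of_real ((L * u + (- L) * t) * y)) =
            E * (of_real (m t) * exp (- Complex e (L * y) * of_real t))" by simp
      qed
      also have "(\<integral>t. E * (of_real (m t) * exp (- Complex e (L * y) * of_real t)) \<partial>lborel) = E * G (Complex e (L * y))"
        by (subst integral_mult_right_zero, subst laplace) (use e in auto)
      finally have "(\<integral>z. of_real (h z) * exp (\<i> * of_real (z * y)) \<partial>lborel) = of_real L * (E * G (Complex e (L * y)))"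
        using L by (simp add: scaleR_conv_of_real)
      then show "(\<integral>z. P (y, z) \<partial>lborel) = of_real L * (?W e L u y)"
        by (simp add: P_def E_def)
    qed simp
    also have "\<dots> = of_real L * (\<integral>y. ?W e L u y \<partial>lborel)"
      by (rule integral_mult_right_zero)
    finally show ?thesis by (simp add: h_def)
  qed

  \<comment> \<open>The damping is removed. On the left \<open>fejer\<close> dominates; on the right
    G is bounded on the compact rectangle [0, 1] x [-L, L], which contains every argument that
    occurs on the support of \<open>tent\<close>.\<close>
  have eq2: "(\<integral>z. of_real (m (u - z / L) * fejer z) \<partial>lborel) =
      of_real L * (\<integral>y. ?W 0 L u y \<partial>lborel)"
    if L: "L > 0" for L u
  proof -
    define e :: "nat \<Rightarrow> real" where "e = (\<lambda>n. inverse (real (Suc n)))"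
    have e_pos: "e n > 0" and e_le: "e n \<le> 1" for n by (auto simp: e_def field_simps)
    have e_lim: "e \<longlonglongrightarrow> 0" unfolding e_def by (rule LIMSEQ_inverse_real_of_nat)
    have "(\<lambda>n. \<integral>z. of_real (m (u - z / L) * exp (- e n * (u - z / L)) * fejer z) \<partial>lborel)
        \<longlonglongrightarrow> (\<integral>z. (of_real (m (u - z / L) * fejer z) :: complex) \<partial>lborel)"
    proof (rule integral_dominated_convergence[where w = fejer])
      show "AE z in lborel. (\<lambda>n. of_real (m (u - z / L) * exp (- e n * (u - z / L)) * fejer z) :: complex)
              \<longlonglongrightarrow> of_real (m (u - z / L) * fejer z)"
      proof (rule AE_I2)
        fix z
        have "(\<lambda>n. of_real (m (u - z / L) * exp (- e n * (u - z / L)) * fejer z) :: complex)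
              \<longlonglongrightarrow> of_real (m (u - z / L) * exp (- 0 * (u - z / L)) * fejer z)"
          by (intro tendsto_intros e_lim)
        then show "(\<lambda>n. of_real (m (u - z / L) * exp (- e n * (u - z / L)) * fejer z) :: complex)
              \<longlonglongrightarrow> of_real (m (u - z / L) * fejer z)" by simp
      qed
      show "AE z in lborel. norm (of_real (m (u - z / L) * exp (- e n * (u - z / L)) * fejer z) :: complex) \<le> fejer z" for n
      proof (rule AE_I2)
        fix z
        \<comment> \<open>At negative arguments the exponential exceeds 1, but there
          \<open>m\<close> vanishes.\<close>
        have "\<bar>m (u - z / L) * exp (- e n * (u - z / L))\<bar> \<le> 1"
        proof (cases "u - z / L < 0")
          case False
          then have "exp (- e n * (u - z / L)) \<le> 1" using e_pos[of n] by simp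
          then show ?thesis using bdd[of "u - z / L"] by (simp add: abs_mult mult_le_one)
        qed (simp add: neg)
        then show "norm (of_real (m (u - z / L) * exp (- e n * (u - z / L)) * fejer z) :: complex) \<le> fejer z"
          using fejer_nonneg[of z] by (simp add: abs_mult norm_mult mult_left_le_one_le)
      qed
    qed (use integrable_fejer in auto)
    moreover have "(\<lambda>n. \<integral>y. ?W (e n) L u y \<partial>lborel)
        \<longlonglongrightarrow> (\<integral>y. ?W 0 L u y \<partial>lborel)"
    proof -
      have "compact (G ` cbox (Complex 0 (-L)) (Complex 1 L))"
        by (intro compact_continuous_image continuous_on_subset[OF cont]) (auto simp: in_cbox_complex_iff)
      then obtain C where C: "\<And>s. s \<in> cbox (Complex 0 (-L)) (Complex 1 L) \<Longrightarrow> norm (G s) \<le> C"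
        by (meson bounded_iff compact_imp_bounded image_eqI)
      have [measurable]: "(\<lambda>y. G (Complex a (L * y))) \<in> borel_measurable borel" if "a \<ge> 0" for a
      proof (rule borel_measurable_continuous_onI)
        show "continuous_on UNIV (\<lambda>y. G (Complex a (L * y)))"
          using that by (intro continuous_on_compose2[OF cont]) (auto simp: Complex_eq intro!: continuous_intros)
      qed
      show ?thesis
      proof (rule integral_dominated_convergence[where w = "\<lambda>y. C * tent y"])
        show "(\<lambda>y. ?W 0 L u y) \<in> borel_measurable lborel"
          by measurable
        show "(\<lambda>y. ?W (e n) L u y) \<in> borel_measurable lborel" for n
          using less_imp_le[OF e_pos[of n]] by measurable
        show "integrable lborel (\<lambda>y. C * tent y)" using integrable_tent by simp
        show "AE y in lborel. (\<lambda>n. ?W (e n) L u y)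
            \<longlonglongrightarrow> ?W 0 L u y"
        proof (rule AE_I2)
          fix y
          have "(\<lambda>n. Complex (e n) (L * y)) \<longlonglongrightarrow> Complex 0 (L * y)"
            by (intro tendsto_intros e_lim)
          then have "(\<lambda>n. G (Complex (e n) (L * y))) \<longlonglongrightarrow> G (Complex 0 (L * y))"
            using e_pos by (intro continuous_on_tendsto_compose[OF cont]) (auto simp: less_imp_le)
          then show "(\<lambda>n. ?W (e n) L u y)
            \<longlonglongrightarrow> ?W 0 L u y"
            by (intro tendsto_intros)
        qed
        show "AE y in lborel. norm (?W (e n) L u y) \<le> C * tent y" for n
        proof (rule AE_I2)
          fix y :: real
          show "norm (?W (e n) L u y) \<le> C * tent y"
          proof (cases "\<bar>y\<bar> \<ge> 1")
            case False
            then have "\<bar>L * y\<bar> \<le> L" using L by (simp add: abs_mult)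
            then have "norm (G (Complex (e n) (L * y))) \<le> C"
              using e_pos[of n] e_le[of n] by (intro C) (auto simp: in_cbox_complex_iff abs_le_iff)
            then have "tent y * norm (G (Complex (e n) (L * y))) \<le> tent y * C"
              by (intro mult_left_mono tent_nonneg)
            then show ?thesis
              by (simp add: norm_mult tent_nonneg mult.commute)
          qed (simp add: tent_eq_0)
        qed
      qed
    qed
    then have "(\<lambda>n. of_real L * (\<integral>y. ?W (e n) L u y \<partial>lborel))
        \<longlonglongrightarrow> of_real L * (\<integral>y. ?W 0 L u y \<partial>lborel)"
      by (intro tendsto_intros)
    ultimately show ?thesis
      using LIMSEQ_unique by (simp only: eq1[OF L e_pos])
  qed

  have lim1: "((\<lambda>u. \<integral>z. m (u - z / L) * fejer z \<partial>lborel) \<longlongrightarrow> 0) at_top" if L: "L > 0" for L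
  proof -
    have "((\<lambda>w. \<integral>y. (of_real (tent y) * G (Complex 0 (L * y))) * exp (\<i> * of_real (w * y)) \<partial>lborel) \<longlongrightarrow> 0) at_top"
      by (intro riemann_lebesgue continuous_intros continuous_on_compose2[OF cont])
         (auto simp: Complex_eq tent_eq_0 intro!: continuous_intros)
    moreover have "filterlim (\<lambda>u. L * u) at_top at_top"
      using L by (intro filterlim_tendsto_pos_mult_at_top[OF tendsto_const] filterlim_ident)
    ultimately have "((\<lambda>u. \<integral>y. (of_real (tent y) * G (Complex 0 (L * y))) * exp (\<i> * of_real (L * u * y)) \<partial>lborel) \<longlongrightarrow> 0) at_top"
      by (rule filterlim_compose)
    then have "((\<lambda>u. of_real L * (\<integral>y. (of_real (tent y) * G (Complex 0 (L * y))) * exp (\<i> * of_real (L * u * y)) \<partial>lborel)) \<longlongrightarrow> of_real L * 0) at_top"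
      by (intro tendsto_intros)
    then have "((\<lambda>u. \<integral>z. (of_real (m (u - z / L) * fejer z) :: complex) \<partial>lborel) \<longlongrightarrow> 0) at_top"
      by (simp only: eq2[OF L] mult_zero_right)
    then have "((\<lambda>u. (of_real (\<integral>z. m (u - z / L) * fejer z \<partial>lborel) :: complex)) \<longlongrightarrow> of_real 0) at_top"
      by (simp only: integral_complex_of_real of_real_0)
    then show ?thesis by (simp only: tendsto_of_real_iff)
  qed

  define D where "D = (\<lambda>L. \<integral>z. ?w L z \<partial>lborel)"
  have int_D: "integrable lborel (\<lambda>z. ?w L z)" if "L > 0" for L
  proof (rule Bochner_Integration.integrable_bound)
    show "integrable lborel (\<lambda>z. 2 * fejer z)" using integrable_fejer by simp
    show "AE z in lborel. norm (?w L z) \<le> norm (2 * fejer z)"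
      using that fejer_nonneg by (intro AE_I2) (auto simp: abs_mult intro!: mult_right_mono)
  qed measurable
  have "(D \<longlongrightarrow> (\<integral>z. 0 \<partial>(lborel :: real measure))) at_top"
    unfolding D_def
  proof (rule integral_dominated_convergence_at_top[where w = "\<lambda>z. 2 * fejer z"])
    show "integrable lborel (\<lambda>z. 2 * fejer z)" using integrable_fejer by simp
    show "\<forall>\<^sub>F L in at_top. AE z in lborel. norm (?w L z) \<le> 2 * fejer z"
      using eventually_gt_at_top[of "0::real"]
      by eventually_elim (use fejer_nonneg in \<open>auto simp: abs_mult intro!: mult_right_mono\<close>)
    show "AE z in lborel. ((\<lambda>L. ?w L z) \<longlongrightarrow> 0) at_top"
    proof (rule AE_I2)
      fix z :: real
      have *: "((\<lambda>L. \<bar>z\<bar> / L) \<longlongrightarrow> 0) at_top"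
        by (intro tendsto_divide_0[OF tendsto_const] filterlim_at_top_imp_at_infinity filterlim_ident)
      have "filterlim (\<lambda>L. - L + \<bar>z\<bar> / L) at_bot at_top"
        using filterlim_tendsto_add_at_top[OF tendsto_minus[OF *] filterlim_ident]
        by (simp add: filterlim_uminus_at_bot)
      then have "((\<lambda>L. exp (- L + \<bar>z\<bar> / L)) \<longlongrightarrow> 0) at_top"
        by (rule filterlim_compose[OF exp_at_bot])
      with * have "((\<lambda>L. ?w L z) \<longlongrightarrow> min 2 (2 * 0 + 0) * fejer z) at_top"
        by (intro tendsto_intros)
      then show "((\<lambda>L. ?w L z) \<longlongrightarrow> 0) at_top" by simp
    qed
  qed measurable
  then have D_lim: "(D \<longlongrightarrow> 0) at_top" by simp

  define k where "k = (\<integral>z. fejer z \<partial>lborel)"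
  have k: "k > 0" unfolding k_def by (rule integral_fejer_pos)
  have main: "k * \<bar>m u\<bar> \<le> \<bar>\<integral>z. m (u - z / L) * fejer z \<partial>lborel\<bar> + D L" if "L > 0" "u \<ge> L" for u L
  proof -
    have int_m: "integrable lborel (\<lambda>z. m (u - z / L) * fejer z)"
    proof (rule Bochner_Integration.integrable_bound[OF integrable_fejer])
      show "AE z in lborel. norm (m (u - z / L) * fejer z) \<le> norm (fejer z)"
        using bdd by (intro AE_I2) (simp add: abs_mult mult_left_le_one_le)
    qed measurable
    have int_d: "integrable lborel (\<lambda>z. (m u - m (u - z / L)) * fejer z)"
      using Bochner_Integration.integrable_diff[OF integrable_mult_right[OF integrable_fejer, of "m u"] int_m]
      by (simp add: algebra_simps)
    have "k * m u = (\<integral>z. m (u - z / L) * fejer z + (m u - m (u - z / L)) * fejer z \<partial>lborel)"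
      by (simp add: k_def algebra_simps)
    also have "\<dots> = (\<integral>z. m (u - z / L) * fejer z \<partial>lborel) + (\<integral>z. (m u - m (u - z / L)) * fejer z \<partial>lborel)"
      using int_m int_d by (rule Bochner_Integration.integral_add)
    finally have eq: "k * m u = (\<integral>z. m (u - z / L) * fejer z \<partial>lborel) + (\<integral>z. (m u - m (u - z / L)) * fejer z \<partial>lborel)" .
    have "\<bar>\<integral>z. (m u - m (u - z / L)) * fejer z \<partial>lborel\<bar> \<le> (\<integral>z. \<bar>(m u - m (u - z / L)) * fejer z\<bar> \<partial>lborel)"
      by (rule integral_abs_bound)
    also have "\<dots> \<le> D L"
      unfolding D_def
    proof (rule integral_mono)
      show "integrable lborel (\<lambda>z. \<bar>(m u - m (u - z / L)) * fejer z\<bar>)" using int_d by simp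
      show "integrable lborel (\<lambda>z. ?w L z)" using int_D that by simp
      fix z
      have "\<bar>m u - m (u - z / L)\<bar> \<le> 2"
        using bdd[of u] bdd[of "u - z / L"] by linarith
      moreover have "\<bar>m u - m (u - z / L)\<bar> \<le> 2 * (\<bar>z\<bar> / L) + exp (- L + \<bar>z\<bar> / L)"
      proof -
        have "\<bar>m u - m (u - z / L)\<bar> \<le> 2 * \<bar>u - (u - z / L)\<bar> + exp (- min u (u - z / L))"
          by (rule slow)
        also have "\<bar>u - (u - z / L)\<bar> = \<bar>z\<bar> / L" using that by simp
        also have "exp (- min u (u - z / L)) \<le> exp (- L + \<bar>z\<bar> / L)"
        proof -
          have "z / L \<le> \<bar>z\<bar> / L" "0 \<le> \<bar>z\<bar> / L" using that by (auto simp: divide_right_mono)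
          then have "L - \<bar>z\<bar> / L \<le> u" "L - \<bar>z\<bar> / L \<le> u - z / L" using that by linarith+
          then have "L - \<bar>z\<bar> / L \<le> min u (u - z / L)" by (rule min.boundedI)
          then have "- min u (u - z / L) \<le> - L + \<bar>z\<bar> / L" by linarith
          then show ?thesis by (simp only: exp_le_cancel_iff)
        qed
        finally show ?thesis by simp
      qed
      ultimately show "\<bar>(m u - m (u - z / L)) * fejer z\<bar> \<le> ?w L z"
        using fejer_nonneg[of z] by (simp add: abs_mult mult_right_mono)
    qed
    finally have "\<bar>k * m u\<bar> \<le> \<bar>\<integral>z. m (u - z / L) * fejer z \<partial>lborel\<bar> + D L"
      unfolding eq by (intro order.trans[OF abs_triangle_ineq] add_left_mono)
    then show ?thesis using k by (simp add: abs_mult)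
  qed

  show ?thesis
  proof (rule tendstoI)
    fix e :: real assume "e > 0"
    \<comment> \<open>The order of choices: L is fixed first so that the smoothing error is below d,
      and only then u grows until the smoothed value is below d. The mass k of the kernel is divided
      out at the end.\<close>
    define d where "d = e * k / 2"
    have d: "d > 0" using \<open>e > 0\<close> k by (simp add: d_def)
    have "\<forall>\<^sub>F L in at_top. dist (D L) 0 < d" using D_lim d by (rule tendstoD)
    then have "\<forall>\<^sub>F L in at_top. L > 0 \<and> D L < d"
      using eventually_gt_at_top[of "0::real"] by eventually_elim auto
    then obtain L where L: "L > 0" "D L < d"
      by (auto simp: eventually_at_top_linorder)
    have "\<forall>\<^sub>F u in at_top. dist (\<integral>z. m (u - z / L) * fejer z \<partial>lborel) 0 < d"
      using lim1[OF L(1)] d by (rule tendstoD)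
    then show "\<forall>\<^sub>F u in at_top. dist (m u) 0 < e"
      using eventually_ge_at_top[of L]
    proof eventually_elim
      case (elim u)
      have "k * \<bar>m u\<bar> < d + d" using main[OF L(1) elim(2)] elim(1) L(2) by simp
      also have "d + d = k * e" by (simp add: d_def)
      finally show ?case using k by simp
    qed
  qed
qed

section \<open>Laplace transforms of partial sums\<close>

text \<open>For c = ln n the value is n powr (-w) / w: in a partial sum up to exp t, the coefficient
  of index n contributes a step that begins at t = ln n.\<close>

lemma has_bochner_integral_exp_tail:
  fixes w :: complex and c :: real
  assumes "Re w > 0" "c \<ge> 0"
  shows "has_bochner_integral lborel (\<lambda>t. indicator {c<..} t *\<^sub>R exp (- w * of_real t)) (exp (- w * of_real c) / w)"
proof -
  have "integrable lborel (\<lambda>t. indicator {0<..} t *\<^sub>R exp (- (t * Re w)))"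
    using integrable_I0i_exp_mscale[OF assms(1)] by (simp add: set_integrable_def)
  then have int: "integrable lborel (\<lambda>t. indicator {c<..} t *\<^sub>R exp (- w * of_real t))"
    by (rule Bochner_Integration.integrable_bound)
       (use assms in \<open>auto simp: indicator_def mult.commute\<close>)
  have "(LBINT t=ereal c..\<infinity>. exp (- w * of_real t)) = 0 - (- exp (- w * of_real c) / w)"
  proof (rule interval_integral_FTC_integrable[where F = "\<lambda>t. - exp (- w * of_real t) / w"])
    have d: "((\<lambda>t. - exp (- w * of_real t) / w) has_vector_derivative exp (- w * of_real t)) (at t)" for t
    proof -
      have "((\<lambda>z. - exp (- w * z) / w) has_field_derivative exp (- w * of_real t)) (at (of_real t))"
        using assms(1) by (auto intro!: derivative_eq_intros)
      from has_vector_derivative_real_field[OF this] show ?thesis .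
    qed
    then show "((\<lambda>t. - exp (- w * of_real t) / w) has_vector_derivative exp (- w * of_real t)) (at t)" for t .
    show "set_integrable lborel (einterval (ereal c) \<infinity>) (\<lambda>t. exp (- w * of_real t))"
      using int by (simp add: set_integrable_def)
    show "(((\<lambda>t. - exp (- w * of_real t) / w) \<circ> real_of_ereal) \<longlongrightarrow> - exp (- w * of_real c) / w) (at_right (ereal c))"
      unfolding ereal_tendsto_simps
      by (intro tendsto_intros) (use assms in auto)
    have "filterlim (\<lambda>t::real. Re (- w * of_real t)) at_bot at_top"
      using assms(1) filterlim_tendsto_pos_mult_at_top[OF tendsto_const _ filterlim_ident, of "Re w"]
      by (simp add: filterlim_uminus_at_bot)
    then have "((\<lambda>t::real. norm (exp (- w * of_real t))) \<longlongrightarrow> 0) at_top"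
      unfolding norm_exp_eq_Re by (rule filterlim_compose[OF exp_at_bot])
    then have "((\<lambda>t::real. - exp (- w * of_real t) / w) \<longlongrightarrow> - 0 / w) at_top"
      unfolding tendsto_norm_zero_iff using assms(1) by (intro tendsto_intros) auto
    then show "(((\<lambda>t. - exp (- w * of_real t) / w) \<circ> real_of_ereal) \<longlongrightarrow> 0) (at_left \<infinity>)"
      unfolding ereal_tendsto_simps by simp
  qed auto
  then have "(\<integral>t. indicator {c<..} t *\<^sub>R exp (- w * of_real t) \<partial>lborel) = exp (- w * of_real c) / w"
    by (simp add: interval_lebesgue_integral_def set_lebesgue_integral_def)
  with int show ?thesis by (simp add: has_bochner_integral_iff)
qed

text \<open>Partial summation as an integral: the partial sum up to exp t is a superposition of
  steps starting at the points ln n, and Re w > 1 gives the absolute convergence for integrating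
  them term by term.\<close>

lemma laplace_of_partial_sums:
  fixes a :: "nat \<Rightarrow> real" and w :: complex
  assumes bdd: "\<And>n. \<bar>a n\<bar> \<le> 1" and w: "Re w > 1"
  shows "has_bochner_integral lborel (\<lambda>t. of_real (\<Sum>n=1..nat \<lfloor>exp t\<rfloor>. a n) * exp (- w * of_real t))
           ((\<Sum>n. of_real (a n) * of_nat n powr - w) / w)"
proof -
  have w0: "w \<noteq> 0" "Re w > 0" using w by auto
  \<comment> \<open>Index 0 is cut off since the partial sums start at 1; in the claimed series it
    drops out because \<open>0 powr - w\<close> is 0.\<close>
  define f :: "nat \<Rightarrow> real \<Rightarrow> complex"
    where "f = (\<lambda>n t. if n = 0 then 0 else of_real (a n) * (indicator {ln (real n)<..} t *\<^sub>R exp (- w * of_real t)))"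
  have hbi: "has_bochner_integral lborel (f n) (of_real (a n) * of_nat n powr - w / w)" for n
  proof (cases "n = 0")
    case False
    then have "has_bochner_integral lborel (f n) (of_real (a n) * (exp (- w * of_real (ln (real n))) / w))"
      unfolding f_def if_not_P[OF False] using has_bochner_integral_exp_tail[OF w0(2), of "ln (real n)"] False
      by (intro has_bochner_integral_mult_right) simp
    moreover have "exp (- w * of_real (ln (real n))) = of_nat n powr - w"
      using False by (simp add: powr_def Ln_of_nat)
    ultimately show ?thesis by simp
  qed (simp add: f_def has_bochner_integral_iff)
  have norm_int: "(\<integral>t. norm (f n t) \<partial>lborel) \<le> real n powr (- Re w) / Re w" for n
  proof (cases "n = 0")
    case False
    have "has_bochner_integral lborel (\<lambda>t. indicator {ln (real n)<..} t *\<^sub>R exp (- of_real (Re w) * of_real t))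
            (exp (- of_real (Re w) * of_real (ln (real n))) / of_real (Re w) :: complex)"
      by (rule has_bochner_integral_exp_tail) (use w0 False in auto)
    also have "exp (- of_real (Re w) * of_real (ln (real n))) = (of_real (real n powr - Re w) :: complex)"
      using False by (simp add: powr_def exp_of_real flip: of_real_mult of_real_minus)
    also have "(\<lambda>t. indicator {ln (real n)<..} t *\<^sub>R exp (- of_real (Re w) * of_real t)) =
        (\<lambda>t. of_real (indicator {ln (real n)<..} t * exp (- Re w * t)) :: complex)"
      by (auto simp: fun_eq_iff indicator_def exp_of_real simp flip: of_real_mult of_real_minus)
    finally have *: "has_bochner_integral lborel (\<lambda>t. of_real (indicator {ln (real n)<..} t * exp (- Re w * t)) :: complex)
        (of_real (real n powr - Re w / Re w))" by simp
    have int: "integrable lborel (\<lambda>t. indicator {ln (real n)<..} t * exp (- Re w * t))"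
      and val: "(\<integral>t. indicator {ln (real n)<..} t * exp (- Re w * t) \<partial>lborel) = real n powr - Re w / Re w"
      using * unfolding has_bochner_integral_iff complex_of_real_integrable_eq integral_complex_of_real of_real_eq_iff by blast+
    have "(\<integral>t. norm (f n t) \<partial>lborel) \<le> (\<integral>t. indicator {ln (real n)<..} t * exp (- Re w * t) \<partial>lborel)"
    proof (rule integral_mono)
      show "integrable lborel (\<lambda>t. norm (f n t))" using hbi[of n] by (simp add: has_bochner_integral_iff)
      show "norm (f n t) \<le> indicator {ln (real n)<..} t * exp (- Re w * t)" for t
        using bdd[of n] by (auto simp: f_def norm_mult indicator_def mult_left_le_one_le)
    qed (rule int)
    with val show ?thesis by simp
  qed (simp add: f_def)
  have fin: "{n. n \<noteq> 0 \<and> ln (real n) < t} \<subseteq> {1..nat \<lfloor>exp t\<rfloor>}" for t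
  proof safe
    fix n :: nat assume "n > 0" "ln (real n) < t"
    then have "real n < exp t" by (metis exp_less_cancel_iff exp_ln of_nat_0_less_iff)
    with \<open>n > 0\<close> show "n \<in> {1..nat \<lfloor>exp t\<rfloor>}" by (auto simp: le_nat_floor)
  qed
  have sums_f: "(\<lambda>n. f n t) sums (\<Sum>n=1..nat \<lfloor>exp t\<rfloor>. f n t)"
    and norm_f: "summable (\<lambda>n. norm (f n t))" for t
  proof -
    have *: "f n t = 0" if "n \<notin> {1..nat \<lfloor>exp t\<rfloor>}" for n
    proof -
      have "n = 0 \<or> \<not> ln (real n) < t" using fin[of t] that by blast
      then show ?thesis by (auto simp: f_def indicator_def)
    qed
    show "(\<lambda>n. f n t) sums (\<Sum>n=1..nat \<lfloor>exp t\<rfloor>. f n t)" using * by (intro sums_finite) auto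
    show "summable (\<lambda>n. norm (f n t))" using * by (intro summable_finite[of "{1..nat \<lfloor>exp t\<rfloor>}"]) auto
  qed
  have sum_norm: "summable (\<lambda>n. \<integral>t. norm (f n t) \<partial>lborel)"
  proof (rule summable_comparison_test')
    show "summable (\<lambda>n. real n powr (- Re w) / Re w)"
      using w by (intro summable_divide) (simp add: summable_real_powr_iff)
    show "norm (\<integral>t. norm (f n t) \<partial>lborel) \<le> real n powr (- Re w) / Re w" for n
      using norm_int[of n] by (subst real_norm_def, subst abs_of_nonneg) auto
  qed
  have int: "integrable lborel (\<lambda>t. \<Sum>n. f n t)"
    and "(\<lambda>n. \<integral>t. f n t \<partial>lborel) sums (\<integral>t. (\<Sum>n. f n t) \<partial>lborel)"
    using hbi norm_f sum_norm
    by (intro integrable_suminf sums_integral AE_I2; simp add: has_bochner_integral_iff)+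
  then have "(\<integral>t. (\<Sum>n. f n t) \<partial>lborel) = (\<Sum>n. of_real (a n) * of_nat n powr - w / w)"
    using hbi by (simp add: sums_iff has_bochner_integral_iff)
  also have "\<dots> = (\<Sum>n. of_real (a n) * of_nat n powr - w) / w"
  proof (rule suminf_divide)
    show "summable (\<lambda>n. of_real (a n) * of_nat n powr - w)"
    proof (rule summable_comparison_test')
      show "summable (\<lambda>n. real n powr (- Re w))" using w by (simp add: summable_real_powr_iff)
      show "norm (of_real (a n) * of_nat n powr - w) \<le> real n powr (- Re w)" if "n \<ge> 1" for n
        using bdd[of n] that by (simp add: norm_mult norm_powr_real_powr mult_left_le_one_le)
    qed
  qed
  finally have val: "(\<integral>t. (\<Sum>n. f n t) \<partial>lborel) = (\<Sum>n. of_real (a n) * of_nat n powr - w) / w" .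
  \<comment> \<open>The steps use a strict inequality whereas the partial sum includes n = exp t;
    the two differ only at the countably many points ln n.\<close>
  have "AE t in lborel. (\<Sum>n. f n t) = of_real (\<Sum>n=1..nat \<lfloor>exp t\<rfloor>. a n) * exp (- w * of_real t)"
  proof -
    have "countable (range (\<lambda>n::nat. ln (real n)))" by simp
    then have "AE t in lborel. t \<notin> range (\<lambda>n::nat. ln (real n))"
      by (intro AE_not_in countable_imp_null_set_lborel)
    then show ?thesis
    proof eventually_elim
      case (elim t)
      have "(\<Sum>n. f n t) = (\<Sum>n=1..nat \<lfloor>exp t\<rfloor>. f n t)" using sums_f by (simp add: sums_iff)
      also have "\<dots> = (\<Sum>n=1..nat \<lfloor>exp t\<rfloor>. of_real (a n) * exp (- w * of_real t))"
      proof (rule sum.cong)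
        fix n assume n: "n \<in> {1..nat \<lfloor>exp t\<rfloor>}"
        then have "real n \<le> exp t" by (simp add: le_nat_iff le_floor_iff)
        then have "ln (real n) \<le> t" using n ln_le_cancel_iff[of "real n" "exp t"] by simp
        moreover have "ln (real n) \<noteq> t" using elim by auto
        ultimately show "f n t = of_real (a n) * exp (- w * of_real t)"
          using n by (simp add: f_def)
      qed simp
      finally show ?case by (simp add: sum_distrib_right)
    qed
  qed
  moreover have "has_bochner_integral lborel (\<lambda>t. \<Sum>n. f n t) ((\<Sum>n. of_real (a n) * of_nat n powr - w) / w)"
    using int val by (simp add: has_bochner_integral_iff)
  ultimately show ?thesis
    by (subst (asm) has_bochner_integral_cong_AE) (auto simp: f_def)
qed

text \<open>With N = exp t, the mean value becomes a function \<open>m\<close> of t whose Laplace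
  transform is H (1 + s) / (1 + s). Continuity of H up to Re s = 1 says in particular that there is
  no pole at 1, the pole that a nonzero mean would cause.\<close>

theorem dirichlet_series_tauberian:
  fixes a :: "nat \<Rightarrow> real" and H :: "complex \<Rightarrow> complex"
  assumes bdd: "\<And>n. \<bar>a n\<bar> \<le> 1"
    and H: "\<And>s. Re s > 1 \<Longrightarrow> (\<Sum>n. of_real (a n) * of_nat n powr - s) = H s"
    and cont: "continuous_on {s. Re s \<ge> 1} H"
  shows "(\<lambda>N. (\<Sum>n=1..N. a n) / real N) \<longlonglongrightarrow> 0"
proof -
  define S where "S = (\<lambda>N. \<Sum>n=1..N. a n)"
  define m where "m = (\<lambda>t. exp (- t) * S (nat \<lfloor>exp t\<rfloor>))"
  have S_diff: "\<bar>S N - S M\<bar> \<le> real N - real M" if "M \<le> N" for M N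
    using that
  proof (induction N rule: dec_induct)
    case (step N)
    have "S (Suc N) = S N + a (Suc N)" by (simp add: S_def)
    then show ?case using step.IH bdd[of "Suc N"] by auto
  qed auto
  have S_le: "\<bar>S N\<bar> \<le> real N" for N
    using S_diff[of 0 N] by (simp add: S_def)
  have fl: "real (nat \<lfloor>exp t\<rfloor>) \<le> exp t" "exp t - 1 < real (nat \<lfloor>exp t\<rfloor>)" for t :: real
    by (auto simp: of_nat_nat)
  have "(m \<longlongrightarrow> 0) at_top"
  proof (rule fourier_tauberian[where G = "\<lambda>s. H (1 + s) / (1 + s)"])
    show "m \<in> borel_measurable borel" unfolding m_def by measurable
    show "\<bar>m t\<bar> \<le> 1" for t
    proof -
      have "\<bar>m t\<bar> \<le> exp (- t) * exp t"
        unfolding m_def abs_mult using order.trans[OF S_le[of "nat \<lfloor>exp t\<rfloor>"] fl(1)[of t]]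
        by (intro mult_mono) auto
      then show ?thesis by (simp flip: exp_add)
    qed
    show "m t = 0" if "t < 0" for t
    proof -
      have "\<lfloor>exp t\<rfloor> = 0" using that by (simp add: floor_eq_iff)
      then show ?thesis by (simp add: m_def S_def)
    qed
    show "\<bar>m u - m t\<bar> \<le> 2 * \<bar>u - t\<bar> + exp (- min u t)" for u t
    proof -
      \<comment> \<open>One u - t pays for the new terms of \<open>S\<close>, the other for the
        change of the normalizing factor; exp (- u) covers the rounding of exp t to an
        integer.\<close>
      have *: "\<bar>m u - m t\<bar> \<le> 2 * (u - t) + exp (- u)" if "t \<le> u" for u t
      proof -
        have e: "1 - exp (t - u) \<le> u - t"
          using exp_ge_add_one_self[of "t - u"] by linarith
        have E: "exp t * exp (- u) = exp (t - u)" "exp u * exp (- u) = 1" "exp t * exp (- t) = 1"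
          by (simp_all flip: exp_add)
        have fm: "nat \<lfloor>exp t\<rfloor> \<le> nat \<lfloor>exp u\<rfloor>" using that by (intro nat_mono floor_mono) simp
        have "m u - m t = exp (- u) * (S (nat \<lfloor>exp u\<rfloor>) - S (nat \<lfloor>exp t\<rfloor>)) - (exp (- t) - exp (- u)) * S (nat \<lfloor>exp t\<rfloor>)"
          by (simp add: m_def algebra_simps)
        also have "\<bar>\<dots>\<bar> \<le> exp (- u) * \<bar>S (nat \<lfloor>exp u\<rfloor>) - S (nat \<lfloor>exp t\<rfloor>)\<bar> + (exp (- t) - exp (- u)) * \<bar>S (nat \<lfloor>exp t\<rfloor>)\<bar>"
          using that by (intro order.trans[OF abs_triangle_ineq4]) (simp add: abs_mult)
        also have "\<dots> \<le> exp (- u) * (exp u - exp t + 1) + (exp (- t) - exp (- u)) * exp t"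
        proof (intro add_mono mult_left_mono)
          show "\<bar>S (nat \<lfloor>exp u\<rfloor>) - S (nat \<lfloor>exp t\<rfloor>)\<bar> \<le> exp u - exp t + 1"
            using S_diff[OF fm] fl(1)[of u] fl(2)[of t] by linarith
          show "\<bar>S (nat \<lfloor>exp t\<rfloor>)\<bar> \<le> exp t"
            using S_le[of "nat \<lfloor>exp t\<rfloor>"] fl(1)[of t] by (rule order.trans)
        qed (use that in auto)
        also have "\<dots> = 2 * (1 - exp (t - u)) + exp (- u)"
          by (simp add: algebra_simps E)
        finally show ?thesis using e by argo
      qed
      have le: "exp (- u) \<le> exp (- min u t)" "exp (- t) \<le> exp (- min u t)" by auto
      show ?thesis
      proof (cases "t \<le> u")
        case True
        then have abs_eq: "\<bar>u - t\<bar> = u - t" by simp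
        show ?thesis unfolding abs_eq
          by (rule order.trans[OF *[OF True]]) (use le(1) in simp)
      next
        case False
        then have "u \<le> t" by simp
        then have abs_eq: "\<bar>u - t\<bar> = t - u" by simp
        show ?thesis unfolding abs_eq abs_minus_commute[of "m u"]
          by (rule order.trans[OF *[OF \<open>u \<le> t\<close>]]) (use le(2) in simp)
      qed
    qed
    have hbi: "has_bochner_integral lborel (\<lambda>t. of_real (m t) * exp (- s * of_real t)) (H (1 + s) / (1 + s))"
      if "Re s > 0" for s
    proof -
      have "has_bochner_integral lborel (\<lambda>t. of_real (S (nat \<lfloor>exp t\<rfloor>)) * exp (- (1 + s) * of_real t))
          ((\<Sum>n. of_real (a n) * of_nat n powr - (1 + s)) / (1 + s))"
        unfolding S_def using that by (intro laplace_of_partial_sums bdd) auto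
      also have "(\<Sum>n. of_real (a n) * of_nat n powr - (1 + s)) = H (1 + s)"
        using that by (intro H) auto
      also have "(\<lambda>t. of_real (S (nat \<lfloor>exp t\<rfloor>)) * exp (- (1 + s) * of_real t)) =
          (\<lambda>t. of_real (m t) * exp (- s * of_real t))"
      proof
        fix t
        have "exp (- (1 + s) * of_real t) = of_real (exp (- t)) * exp (- s * of_real t)"
          unfolding exp_of_real [symmetric] exp_add [symmetric] by (simp add: algebra_simps)
        then show "of_real (S (nat \<lfloor>exp t\<rfloor>)) * exp (- (1 + s) * of_real t) = of_real (m t) * exp (- s * of_real t)"
          by (simp add: m_def)
      qed
      finally show ?thesis .
    qed
    show "(\<integral>t. of_real (m t) * exp (- s * of_real t) \<partial>lborel) = H (1 + s) / (1 + s)" if "Re s > 0" for s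
      using hbi[OF that] by (rule has_bochner_integral_integral_eq)
    show "integrable lborel (\<lambda>t. m t * exp (- e * t))" if "e > 0" for e
    proof -
      have "(\<lambda>t. of_real (m t) * exp (- of_real e * of_real t)) = (\<lambda>t. (of_real (m t * exp (- e * t)) :: complex))"
        unfolding of_real_mult exp_of_real [symmetric] by simp
      moreover have "integrable lborel (\<lambda>t. of_real (m t) * exp (- of_real e * of_real t) :: complex)"
        using hbi[of "of_real e"] that by (simp only: has_bochner_integral_iff Re_complex_of_real)
      ultimately have "integrable lborel (\<lambda>t. (of_real (m t * exp (- e * t)) :: complex))" by simp
      then show ?thesis by (simp only: complex_of_real_integrable_eq)
    qed
    show "continuous_on {s. Re s \<ge> 0} (\<lambda>s. H (1 + s) / (1 + s))"
      by (intro continuous_intros continuous_on_compose2[OF cont]) (auto simp: complex_eq_iff)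
  qed
  moreover have "filterlim (\<lambda>N. ln (real N)) at_top sequentially"
    by (rule filterlim_compose[OF ln_at_top filterlim_real_sequentially])
  ultimately have "(\<lambda>N. m (ln (real N))) \<longlonglongrightarrow> 0" by (rule filterlim_compose)
  moreover have "\<forall>\<^sub>F N in sequentially. m (ln (real N)) = S N / real N"
    using eventually_gt_at_top[of "0::nat"]
    by eventually_elim (simp add: m_def exp_minus field_simps)
  ultimately have "(\<lambda>N. S N / real N) \<longlonglongrightarrow> 0" by (rule Lim_transform_eventually)
  then show ?thesis by (simp add: S_def)
qed

section \<open>Euler products and the inequality 3-4-1\<close>

text \<open>The term at n = 0 is harmless: \<open>0 powr - s\<close> is 0.\<close>

definition dirichlet_series :: "(nat \<Rightarrow> real) \<Rightarrow> complex \<Rightarrow> complex" where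
  "dirichlet_series a s = (\<Sum>n. of_real (a n) * of_nat n powr - s)"

lemma norm_dirichlet_term_le:
  assumes "\<bar>a n\<bar> \<le> 1"
  shows "norm (of_real (a n) * of_nat n powr - s :: complex) \<le> real n powr - Re s"
  using assms by (cases "n = 0") (auto simp: norm_mult norm_powr_real_powr mult_left_le_one_le)

lemma summable_dirichlet_norm:
  assumes "\<And>n. \<bar>a n\<bar> \<le> 1" "Re s > 1"
  shows "summable (\<lambda>n. norm (of_real (a n) * of_nat n powr - s :: complex))"
proof (rule summable_comparison_test')
  show "summable (\<lambda>n. real n powr - Re s)" using assms(2) by (simp add: summable_real_powr_iff)
qed (use norm_dirichlet_term_le assms(1) in simp)

lemma abs_summable_dirichlet:
  assumes "\<And>n. \<bar>a n\<bar> \<le> 1" "Re s > 1"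
  shows "(\<lambda>n. norm (of_real (a n) * of_nat n powr - s :: complex)) summable_on UNIV"
proof (rule norm_summable_imp_summable_on)
  show "summable (\<lambda>n. norm (norm (of_real (a n) * of_nat n powr - s :: complex)))"
    unfolding real_norm_def abs_norm_cancel using assms by (rule summable_dirichlet_norm)
qed

lemma dirichlet_series_conv_infsum:
  assumes "\<And>n. \<bar>a n\<bar> \<le> 1" "Re s > 1"
  shows "dirichlet_series a s = (\<Sum>\<^sub>\<infinity>n. of_real (a n) * of_nat n powr - s)"
proof -
  have "(\<lambda>n. of_real (a n) * of_nat n powr - s) sums (\<Sum>\<^sub>\<infinity>n. of_real (a n) * of_nat n powr - s)"
    by (rule has_sum_imp_sums, rule has_sum_infsum, rule abs_summable_summable, rule abs_summable_dirichlet)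
       (use assms in auto)
  then show ?thesis by (simp add: dirichlet_series_def sums_iff)
qed

text \<open>The sieve of Eratosthenes: among the n free of primes in Q, the multiples of p are
  exactly p times that same set, so by complete multiplicativity they carry the fraction f p of the
  sum, and the factor 1 - f p removes them.\<close>

lemma euler_product_sieve:
  fixes f :: "nat \<Rightarrow> complex"
  assumes mult: "\<And>m n. f (m * n) = f m * f n" and "f 0 = 0"
    and summable: "(\<lambda>n. norm (f n)) summable_on UNIV" and "finite Q" "\<And>p. p \<in> Q \<Longrightarrow> prime p"
  shows "(\<Prod>p\<in>Q. 1 - f p) * (\<Sum>\<^sub>\<infinity>n. f n) = (\<Sum>\<^sub>\<infinity>n | n > 0 \<and> (\<forall>p\<in>Q. \<not> p dvd n). f n)"
  using assms(4,5)
proof (induction Q rule: finite_induct)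
  case empty
  have "(\<Sum>\<^sub>\<infinity>n. f n) = (\<Sum>\<^sub>\<infinity>n | n > 0. f n)"
    using \<open>f 0 = 0\<close> by (intro infsum_cong_neutral) auto
  then show ?case by simp
next
  case (insert p Q)
  define A where "A = {n. n > 0 \<and> (\<forall>p\<in>Q. \<not> p dvd n)}"
  define A' where "A' = {n. n > 0 \<and> (\<forall>p\<in>insert p Q. \<not> p dvd n)}"
  have p: "prime p" and Q: "\<And>q. q \<in> Q \<Longrightarrow> prime q" using insert.prems by auto
  have sm: "f summable_on S" for S
    by (rule abs_summable_summable, rule summable_on_subset_banach[OF summable]) simp
  have split: "A = A' \<union> (*) p ` A"
  proof (intro equalityI subsetI)
    fix n assume n: "n \<in> A"
    show "n \<in> A' \<union> (*) p ` A"
    proof (cases "p dvd n")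
      case True
      then obtain m where "n = p * m" by blast
      with n have "m \<in> A" by (auto simp: A_def)
      with \<open>n = p * m\<close> show ?thesis by auto
    qed (use n in \<open>auto simp: A_def A'_def\<close>)
  next
    fix n assume "n \<in> A' \<union> (*) p ` A"
    then show "n \<in> A"
    proof
      assume "n \<in> (*) p ` A"
      then obtain m where m: "n = p * m" "m \<in> A" by blast
      have "\<not> q dvd n" if "q \<in> Q" for q
        using m that insert.hyps(2) p Q[OF that] prime_dvd_mult_iff[of q p m] primes_dvd_imp_eq[of q p]
        by (auto simp: A_def)
      with m p show ?thesis by (auto simp: A_def prime_gt_0_nat)
    qed (auto simp: A_def A'_def)
  qed
  have "(\<Sum>\<^sub>\<infinity>n\<in>A. f n) = (\<Sum>\<^sub>\<infinity>n\<in>A' \<union> (*) p ` A. f n)" using split by simp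
  also have "\<dots> = (\<Sum>\<^sub>\<infinity>n\<in>A'. f n) + (\<Sum>\<^sub>\<infinity>n\<in>(*) p ` A. f n)"
    by (intro infsum_Un_disjoint sm) (auto simp: A'_def)
  also have "(\<Sum>\<^sub>\<infinity>n\<in>(*) p ` A. f n) = (\<Sum>\<^sub>\<infinity>n\<in>A. f (p * n))"
    using p prime_gt_0_nat[of p] by (subst infsum_reindex) (auto simp: inj_on_def o_def)
  also have "\<dots> = f p * (\<Sum>\<^sub>\<infinity>n\<in>A. f n)"
    by (simp add: mult infsum_cmult_right')
  finally have "(\<Sum>\<^sub>\<infinity>n\<in>A'. f n) = (1 - f p) * (\<Sum>\<^sub>\<infinity>n\<in>A. f n)" by (simp add: algebra_simps)
  also have "(\<Sum>\<^sub>\<infinity>n\<in>A. f n) = (\<Prod>p\<in>Q. 1 - f p) * (\<Sum>\<^sub>\<infinity>n. f n)"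
    unfolding A_def using insert.IH Q by simp
  finally show ?case using insert.hyps by (simp add: A'_def mult.assoc)
qed

text \<open>Apart from 1, every integer that survives the sieve exceeds N, so the error is at most a
  tail of the absolutely convergent sum. Stating the limit for product times sum avoids inverses and
  shows at once that the sum is nonzero.\<close>

lemma euler_product_tendsto:
  fixes f :: "nat \<Rightarrow> complex"
  assumes mult: "\<And>m n. f (m * n) = f m * f n" and "f 0 = 0" "f 1 = 1"
    and summable: "(\<lambda>n. norm (f n)) summable_on UNIV"
  shows "(\<lambda>N. (\<Prod>p | prime p \<and> p \<le> N. 1 - f p) * (\<Sum>\<^sub>\<infinity>n. f n)) \<longlonglongrightarrow> 1"
proof -
  define A where "A = (\<lambda>N::nat. {n::nat. n > 0 \<and> (\<forall>p\<in>{p. prime p \<and> p \<le> N}. \<not> p dvd n)})"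
  have eq: "(\<Prod>p | prime p \<and> p \<le> N. 1 - f p) * (\<Sum>\<^sub>\<infinity>n. f n) = (\<Sum>\<^sub>\<infinity>n\<in>A N. f n)" for N
    unfolding A_def by (intro euler_product_sieve assms) auto
  have sm': "(\<lambda>n. norm (f n)) summable_on S" for S
    by (rule summable_on_subset_banach[OF summable]) simp
  have sm: "f summable_on S" for S
    by (rule abs_summable_summable, rule sm')
  have sub: "A N - {1} \<subseteq> {N<..}" for N
  proof
    fix n assume n: "n \<in> A N - {1}"
    then obtain p where "prime p" "p dvd n" using prime_factor_nat[of n] by auto
    moreover from this n have "p \<le> n" "\<not> p \<le> N" by (auto simp: A_def dest: dvd_imp_le)
    ultimately show "n \<in> {N<..}" by simp
  qed
  have bound: "norm ((\<Sum>\<^sub>\<infinity>n\<in>A N. f n) - 1) \<le> (\<Sum>\<^sub>\<infinity>n. norm (f n)) - (\<Sum>n\<le>N. norm (f n))" for N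
  proof -
    have "1 \<in> A N" by (auto simp: A_def)
    then have "(\<Sum>\<^sub>\<infinity>n\<in>A N. f n) = (\<Sum>\<^sub>\<infinity>n\<in>insert 1 (A N - {1}). f n)" by (simp add: insert_absorb)
    also have "\<dots> = 1 + (\<Sum>\<^sub>\<infinity>n\<in>A N - {1}. f n)"
      using \<open>f 1 = 1\<close> by (subst infsum_insert) (auto intro: sm)
    finally have "norm ((\<Sum>\<^sub>\<infinity>n\<in>A N. f n) - 1) = norm (\<Sum>\<^sub>\<infinity>n\<in>A N - {1}. f n)" by simp
    also have "\<dots> \<le> (\<Sum>\<^sub>\<infinity>n\<in>A N - {1}. norm (f n))"
      by (rule norm_infsum_bound) (rule sm')
    also have "\<dots> \<le> (\<Sum>\<^sub>\<infinity>n\<in>{N<..}. norm (f n))"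
      using sub by (intro infsum_mono2 sm') auto
    also have "\<dots> = (\<Sum>\<^sub>\<infinity>n\<in>{..N} \<union> {N<..}. norm (f n)) - (\<Sum>n\<le>N. norm (f n))"
      by (subst infsum_Un_disjoint) (auto intro: sm')
    also have "{..N} \<union> {N<..} = UNIV" by auto
    finally show ?thesis .
  qed
  have lim: "(\<lambda>N. (\<Sum>\<^sub>\<infinity>n. norm (f n)) - (\<Sum>n\<le>N. norm (f n))) \<longlonglongrightarrow> 0"
  proof -
    have "(\<lambda>n. norm (f n)) sums (\<Sum>\<^sub>\<infinity>n. norm (f n))"
      by (intro has_sum_imp_sums has_sum_infsum sm')
    then have "(\<lambda>N. (\<Sum>\<^sub>\<infinity>n. norm (f n)) - (\<Sum>n\<le>N. norm (f n))) \<longlonglongrightarrow> (\<Sum>\<^sub>\<infinity>n. norm (f n)) - (\<Sum>\<^sub>\<infinity>n. norm (f n))"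
      unfolding sums_def_le by (intro tendsto_intros)
    then show ?thesis by simp
  qed
  have "(\<lambda>N. (\<Sum>\<^sub>\<infinity>n\<in>A N. f n) - 1) \<longlonglongrightarrow> 0"
    by (rule Lim_null_comparison[OF always_eventually lim]) (use bound in blast)
  then show ?thesis unfolding eq by (simp add: LIM_zero_iff)
qed

lemma dirichlet_series_euler_product:
  assumes mult: "\<And>m n. a (m * n) = a m * a n" and "a 1 = 1" "\<And>n. \<bar>a n\<bar> \<le> 1" "Re s > 1"
  shows "(\<lambda>N. (\<Prod>p | prime p \<and> p \<le> N. 1 - of_real (a p) * of_nat p powr - s) * dirichlet_series a s) \<longlonglongrightarrow> 1"
  unfolding dirichlet_series_conv_infsum[of a s, OF assms(3,4)]
  by (rule euler_product_tendsto)
     (use assms in \<open>auto simp: powr_times_real mult_ac intro: abs_summable_dirichlet\<close>)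

text \<open>A one-sided substitute for the logarithm of an Euler factor: |1 - z|^2 = 1 + (|z|^2 - 2
  Re z), and 1 + x \<le> exp x.\<close>

lemma norm_one_minus_le:
  fixes z :: complex
  shows "norm (1 - z) \<le> exp (- Re z + (norm z)\<^sup>2 / 2)"
proof -
  have "(norm (1 - z))\<^sup>2 = 1 + (- 2 * Re z + (norm z)\<^sup>2)"
    unfolding cmod_power2 by (simp add: power2_eq_square algebra_simps)
  also have "\<dots> \<le> exp (- 2 * Re z + (norm z)\<^sup>2)" by (rule exp_ge_add_one_self)
  also have "\<dots> = (exp (- Re z + (norm z)\<^sup>2 / 2))\<^sup>2"
    by (simp add: power2_eq_square flip: exp_add)
  finally show ?thesis by (rule power2_le_imp_le) simp
qed

text \<open>The linear terms add up to -2x (1 + 2cu + u^2) with u = Re w, and the bracket is a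
  square for c = 1 or -1 and positive for c = 0. For c = 1 this is the classical 3 + 4 cos \<theta>
  + cos 2\<theta> \<ge> 0. The quadratic terms are (3 + 4 + 1) x^2 / 2.\<close>

lemma three_four_one_factor:
  fixes x c :: real and w :: complex
  assumes "0 \<le> x" "norm w = 1" "c \<in> {-1, 0, 1}"
  shows "norm (1 - of_real x :: complex) ^ 3 * norm (1 - of_real c * (of_real x * w)) ^ 4 * norm (1 - of_real x * w\<^sup>2) \<le> exp (4 * x\<^sup>2)"
proof -
  define u where "u = Re w"
  have "u\<^sup>2 + (Im w)\<^sup>2 = 1" using assms(2) by (simp add: u_def cmod_def)
  then have re2: "Re (w\<^sup>2) = 2 * u\<^sup>2 - 1" by (simp add: u_def power2_eq_square)
  have 1: "norm (1 - of_real x :: complex) \<le> exp (- x + x\<^sup>2 / 2)"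
    using norm_one_minus_le[of "of_real x"] assms by simp
  have 2: "norm (1 - of_real c * (of_real x * w)) \<le> exp (- c * x * u + x\<^sup>2 / 2)"
  proof -
    have "(norm (of_real c * (of_real x * w)))\<^sup>2 \<le> x\<^sup>2"
      using assms by (auto simp: norm_mult)
    then have "exp (- (c * x * u) + (norm (of_real c * (of_real x * w)))\<^sup>2 / 2) \<le> exp (- (c * x * u) + x\<^sup>2 / 2)"
      by simp
    moreover have "Re (of_real c * (of_real x * w)) = c * x * u" by (simp add: u_def)
    ultimately have "exp (- Re (of_real c * (of_real x * w)) + (norm (of_real c * (of_real x * w)))\<^sup>2 / 2) \<le> exp (- c * x * u + x\<^sup>2 / 2)"
      by (simp only: minus_mult_left)
    with norm_one_minus_le show ?thesis by (rule order.trans)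
  qed
  have 3: "norm (1 - of_real x * w\<^sup>2) \<le> exp (- x * (2 * u\<^sup>2 - 1) + x\<^sup>2 / 2)"
  proof -
    have re: "Re (of_real x * w\<^sup>2) = x * (2 * u\<^sup>2 - 1)" by (simp only: re2 Re_complex_of_real Im_complex_of_real times_complex.sel mult_zero_left diff_zero)
    have nrm: "norm (of_real x * w\<^sup>2) = x" using assms by (simp add: norm_mult norm_power)
    show ?thesis using norm_one_minus_le[of "of_real x * w\<^sup>2"] unfolding re nrm by (simp only: minus_mult_left)
  qed
  have "norm (1 - of_real x :: complex) ^ 3 * norm (1 - of_real c * (of_real x * w)) ^ 4 * norm (1 - of_real x * w\<^sup>2)
      \<le> exp (- x + x\<^sup>2 / 2) ^ 3 * exp (- c * x * u + x\<^sup>2 / 2) ^ 4 * exp (- x * (2 * u\<^sup>2 - 1) + x\<^sup>2 / 2)"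
    by (intro mult_mono power_mono 1 2 3) auto
  also have "\<dots> = exp (4 * x\<^sup>2 - 2 * x * (1 + 2 * c * u + u\<^sup>2))"
    by (simp add: exp_add [symmetric] exp_of_nat_mult [symmetric] algebra_simps)
  also have "1 + 2 * c * u + u\<^sup>2 \<ge> 0"
    using assms(3) zero_le_power2[of "1 + u"] zero_le_power2[of "1 - u"]
    by (auto simp: power2_eq_square algebra_simps)
  then have "exp (4 * x\<^sup>2 - 2 * x * (1 + 2 * c * u + u\<^sup>2)) \<le> exp (4 * x\<^sup>2)"
    using assms(1) by simp
  finally show ?thesis .
qed

section \<open>Real characters\<close>

text \<open>The bound on the partial sums stands in for periodicity and nontriviality. It rules out
  the principal character and is exactly what Abel summation consumes.\<close>

locale real_char =
  fixes chi :: "nat \<Rightarrow> real" and B :: real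
  assumes char_values: "chi n \<in> {-1, 0, 1}"
    and char_1: "chi 1 = 1"
    and char_mult: "chi (m * n) = chi m * chi n"
    and char_partial_sums: "\<bar>\<Sum>n=1..N. chi n\<bar> \<le> B"
begin

lemma char_abs_le_1: "\<bar>chi n\<bar> \<le> 1"
  using char_values[of n] by auto

lemma B_ge_1: "B \<ge> 1"
  using char_partial_sums[of 1] char_1 by simp

lemma dirichlet_series_nonzero:
  assumes "Re s > 1"
  shows "dirichlet_series chi s \<noteq> 0"
proof
  assume "dirichlet_series chi s = 0"
  then have "(\<lambda>N::nat. 0 :: complex) \<longlonglongrightarrow> 1"
    using dirichlet_series_euler_product[of chi s] char_mult char_1 char_abs_le_1 assms by simp
  then show False by (simp add: LIMSEQ_const_iff)
qed

text \<open>The factors of \<open>three_four_one_factor\<close>, taken at x = p powr (- \<sigma>),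
  multiply to at most exp of four times the sum of p powr (-2), and the finite products tend to the
  inverses of the series. The square of \<chi> is replaced by 1 throughout, so the first and third
  series are both the zeta series.\<close>

lemma three_four_one:
  fixes \<sigma> t :: real
  assumes "\<sigma> > 1"
  shows "1 \<le> exp (4 * (\<Sum>n. real n powr - 2)) * norm (dirichlet_series (\<lambda>_. 1) \<sigma>) ^ 3 *
           norm (dirichlet_series chi (Complex \<sigma> t)) ^ 4 * norm (dirichlet_series (\<lambda>_. 1) (Complex \<sigma> (2 * t)))"
proof -
  define F1 where "F1 = dirichlet_series (\<lambda>_. 1) (of_real \<sigma>)"
  define F2 where "F2 = dirichlet_series chi (Complex \<sigma> t)"
  define F3 where "F3 = dirichlet_series (\<lambda>_. 1) (Complex \<sigma> (2 * t))"
  define P1 where "P1 = (\<lambda>N. \<Prod>p | prime p \<and> p \<le> N. 1 - of_real 1 * of_nat p powr - complex_of_real \<sigma>)"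
  define P2 where "P2 = (\<lambda>N. \<Prod>p | prime p \<and> p \<le> N. 1 - of_real (chi p) * of_nat p powr - Complex \<sigma> t)"
  define P3 where "P3 = (\<lambda>N. \<Prod>p | prime p \<and> p \<le> N. 1 - of_real 1 * of_nat p powr - Complex \<sigma> (2 * t))"
  define C where "C = exp (4 * (\<Sum>n. real n powr - 2))"
  have lims: "(\<lambda>N. P1 N * F1) \<longlonglongrightarrow> 1" "(\<lambda>N. P2 N * F2) \<longlonglongrightarrow> 1" "(\<lambda>N. P3 N * F3) \<longlonglongrightarrow> 1"
    unfolding P1_def P2_def P3_def F1_def F2_def F3_def using assms char_mult char_1 char_abs_le_1
    by (intro dirichlet_series_euler_product; simp)+
  have bound: "norm (P1 N) ^ 3 * norm (P2 N) ^ 4 * norm (P3 N) \<le> C" for N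
  proof -
    let ?t = "\<lambda>p. norm (1 - of_real 1 * of_nat p powr - complex_of_real \<sigma>) ^ 3 *
           norm (1 - of_real (chi p) * of_nat p powr - Complex \<sigma> t) ^ 4 *
           norm (1 - of_real 1 * of_nat p powr - Complex \<sigma> (2 * t))"
    define Q where "Q = {p. prime p \<and> p \<le> N}"
    have "norm (P1 N) ^ 3 * norm (P2 N) ^ 4 * norm (P3 N) =
        (\<Prod>p\<in>Q. ?t p)"
      by (simp only: P1_def P2_def P3_def prod_norm [symmetric] prod_power_distrib prod.distrib Q_def)
    also have "\<dots> \<le> (\<Prod>p\<in>Q. exp (4 * real p powr - 2))"
    proof (intro prod_mono conjI)
      fix p assume "p \<in> Q"
      then have p: "p \<ge> 2" by (auto simp: Q_def prime_ge_2_nat)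
      define x where "x = real p powr - \<sigma>"
      define w where "w = of_nat p powr - Complex 0 t"
      have w: "norm w = 1" unfolding w_def using p by (simp add: norm_powr_real_powr)
      have x1: "of_nat p powr - complex_of_real \<sigma> = of_real x"
        using powr_of_real[of "real p" "- \<sigma>"] by (simp add: x_def)
      have x2: "of_nat p powr - Complex \<sigma> t = of_real x * w"
      proof -
        have "- Complex \<sigma> t = - of_real \<sigma> + - Complex 0 t" by (simp add: complex_eq_iff)
        then show ?thesis unfolding x1 [symmetric] w_def by (simp only: powr_add)
      qed
      have x3: "of_nat p powr - Complex \<sigma> (2 * t) = of_real x * w\<^sup>2"
      proof -
        have "- Complex \<sigma> (2 * t) = - of_real \<sigma> + (- Complex 0 t + - Complex 0 t)" by (simp add: complex_eq_iff)
        then show ?thesis unfolding x1 [symmetric] w_def power2_eq_square by (simp only: powr_add)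
      qed
      have "?t p \<le> exp (4 * x\<^sup>2)"
        unfolding x1 x2 x3 using three_four_one_factor[of x w "chi p"] w char_values[of p]
        by (simp add: x_def)
      also have "x\<^sup>2 \<le> real p powr - 2"
        using p assms by (simp add: x_def power2_eq_square flip: powr_add)
      finally show "?t p \<le> exp (4 * real p powr - 2)"
        by simp
    qed auto
    also have "\<dots> = exp (4 * (\<Sum>p\<in>Q. real p powr - 2))"
      by (simp add: Q_def exp_sum sum_distrib_left)
    also have "\<dots> \<le> C"
      unfolding C_def by (simp, rule sum_le_suminf) (auto simp: Q_def summable_real_powr_iff)
    finally show ?thesis .
  qed
  have "(\<lambda>N. norm (P1 N * F1) ^ 3 * norm (P2 N * F2) ^ 4 * norm (P3 N * F3)) \<longlonglongrightarrow> norm (1::complex) ^ 3 * norm (1::complex) ^ 4 * norm (1::complex)"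
    by (intro tendsto_intros lims)
  moreover have "norm (P1 N * F1) ^ 3 * norm (P2 N * F2) ^ 4 * norm (P3 N * F3) \<le> C * (norm F1 ^ 3 * norm F2 ^ 4 * norm F3)" for N
  proof -
    have "norm (P1 N * F1) ^ 3 * norm (P2 N * F2) ^ 4 * norm (P3 N * F3) =
        (norm (P1 N) ^ 3 * norm (P2 N) ^ 4 * norm (P3 N)) * (norm F1 ^ 3 * norm F2 ^ 4 * norm F3)"
      by (simp add: norm_mult power_mult_distrib mult_ac)
    also have "\<dots> \<le> C * (norm F1 ^ 3 * norm F2 ^ 4 * norm F3)"
      by (intro mult_right_mono bound) auto
    finally show ?thesis .
  qed
  ultimately have "norm (1::complex) ^ 3 * norm (1::complex) ^ 4 * norm (1::complex) \<le> C * (norm F1 ^ 3 * norm F2 ^ 4 * norm F3)"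
    by (intro LIMSEQ_le_const2) auto
  then show ?thesis by (simp add: C_def F1_def F2_def F3_def mult.assoc)
qed

end

section \<open>Analytic continuation and nonvanishing on the line Re s = 1\<close>

lemma real_segment_bound:
  fixes f f' :: "complex \<Rightarrow> complex" and a b :: real
  assumes "\<And>r. a \<le> r \<Longrightarrow> r \<le> b \<Longrightarrow> (f has_field_derivative f' (of_real r)) (at (of_real r))"
    and "\<And>r. a \<le> r \<Longrightarrow> r \<le> b \<Longrightarrow> norm (f' (of_real r)) \<le> C" and "a \<le> b"
  shows "norm (f (of_real b) - f (of_real a)) \<le> C * (b - a)"
proof -
  have "norm (f (of_real b) - f (of_real a)) \<le> C * norm (of_real b - of_real a :: complex)"
  proof (rule field_differentiable_bound[where S = "of_real ` {a..b}" and f' = f'])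
    show "convex (complex_of_real ` {a..b})"
      by (intro convex_linear_image convex_real_interval) (simp add: linear_iff scaleR_conv_of_real)
  qed (use assms in \<open>auto intro: has_field_derivative_at_within\<close>)
  then show ?thesis using assms(3) by (simp flip: of_real_diff)
qed

lemma powr_diff_bound:
  fixes s :: complex and a x :: real
  assumes "a \<ge> 1" "a \<le> x" "x \<le> a + 1" "Re s > 0"
  shows "norm (of_real x powr - s - of_real a powr - s) \<le> norm s * a powr (- Re s - 1)"
proof -
  have "norm (of_real x powr - s - of_real a powr - s :: complex) \<le> (norm s * a powr (- Re s - 1)) * (x - a)"
  proof (rule real_segment_bound[where f = "\<lambda>z. z powr - s" and f' = "\<lambda>z. - s * z powr (- s - 1)"])
    fix r assume r: "a \<le> r" "r \<le> x"
    then have "of_real r \<notin> \<real>\<^sub>\<le>\<^sub>0" using assms(1) by auto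
    then show "((\<lambda>z. z powr - s) has_field_derivative - s * of_real r powr (- s - 1)) (at (of_real r))"
      by (auto intro!: derivative_eq_intros has_field_derivative_powr)
    have "norm (- s * of_real r powr (- s - 1)) = norm s * r powr (- Re s - 1)"
      using r assms(1) by (simp add: norm_mult norm_powr_real_powr)
    also have "\<dots> \<le> norm s * a powr (- Re s - 1)"
      using r assms by (intro mult_left_mono powr_mono2') auto
    finally show "norm (- s * of_real r powr (- s - 1)) \<le> norm s * a powr (- Re s - 1)" .
  qed (use assms in auto)
  also have "\<dots> \<le> (norm s * a powr (- Re s - 1)) * 1"
    using assms by (intro mult_left_mono) auto
  finally show ?thesis by simp
qed

text \<open>Compares each term with the integral of x powr (-s) over [n, n + 1]. The integrals
  telescope to 1 / (s - 1), and the differences are summable. This gives the growth at s = 1 and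
  boundedness near 1 + 2it that 3-4-1 calls for.\<close>

lemma norm_zeta_le:
  assumes "Re s > 1"
  shows "norm (dirichlet_series (\<lambda>_. 1) s) \<le> 1 / norm (s - 1) + norm s * (\<Sum>n. real n powr - 2)"
proof -
  define g where "g = (\<lambda>n. of_nat (Suc n) powr - s :: complex)"
  define G where "G = (\<lambda>n. of_nat (Suc n) powr (1 - s) / (1 - s) :: complex)"
  have s1: "s \<noteq> 1" using assms by auto
  have bound: "norm (g n - (G (Suc n) - G n)) \<le> norm s * real (Suc n) powr - 2" for n
  proof -
    define a where "a = real (Suc n)"
    have a: "a \<ge> 1" by (simp add: a_def)
    \<comment> \<open>The increment of H over [a, a + 1] is the integral of x powr (-s) minus a powr
      (-s), so a bound on its derivative does the comparison without integrating.\<close>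
    define H where "H = (\<lambda>z. z powr (1 - s) / (1 - s) - of_real a powr - s * z)"
    have "norm (H (of_real (a + 1)) - H (of_real a)) \<le> (norm s * a powr (- Re s - 1)) * (a + 1 - a)"
    proof (rule real_segment_bound[where f' = "\<lambda>z. z powr - s - of_real a powr - s"])
      fix r assume r: "a \<le> r" "r \<le> a + 1"
      then have "of_real r \<notin> \<real>\<^sub>\<le>\<^sub>0" using a by auto
      then show "(H has_field_derivative of_real r powr - s - of_real a powr - s) (at (of_real r))"
        unfolding H_def using s1 by (auto intro!: derivative_eq_intros has_field_derivative_powr)
      show "norm (of_real r powr - s - of_real a powr - s) \<le> norm s * a powr (- Re s - 1)"
        by (rule powr_diff_bound) (use r a assms in auto)
    qed simp
    also have "\<dots> = norm s * a powr (- Re s - 1)" by simp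
    also have "\<dots> \<le> norm s * a powr - 2"
      using a assms by (intro mult_left_mono powr_mono) auto
    also have "H (of_real (a + 1)) - H (of_real a) = - (g n - (G (Suc n) - G n))"
      by (simp add: H_def g_def G_def a_def algebra_simps)
    finally show ?thesis by (simp only: a_def norm_minus_cancel)
  qed
  have sum2: "summable (\<lambda>n. real (Suc n) powr - 2)"
    by (subst summable_Suc_iff) (simp add: summable_real_powr_iff)
  have "G \<longlonglongrightarrow> 0"
  proof (rule Lim_null_comparison[OF always_eventually])
    show "\<forall>n. norm (G n) \<le> real (Suc n) powr (1 - Re s) / norm (1 - s)"
      by (auto simp: G_def norm_divide norm_powr_real_powr simp del: of_nat_Suc)
    have "(\<lambda>n. real (Suc n) powr (1 - Re s)) \<longlonglongrightarrow> 0"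
      by (rule LIMSEQ_Suc, rule tendsto_neg_powr) (use assms filterlim_real_sequentially in auto)
    then show "(\<lambda>n. real (Suc n) powr (1 - Re s) / norm (1 - s)) \<longlonglongrightarrow> 0"
      by (rule tendsto_divide_zero)
  qed
  then have "(\<lambda>n. G (Suc n) - G n) sums (0 - G 0)" by (rule telescope_sums)
  moreover have "0 - G 0 = 1 / (s - 1)" using s1 by (simp add: G_def divide_simps)
  ultimately have tel: "(\<lambda>n. G (Suc n) - G n) sums (1 / (s - 1))" by (simp only:)
  have sum_d: "summable (\<lambda>n. g n - (G (Suc n) - G n))"
    by (rule summable_comparison_test'[OF summable_mult[OF sum2]]) (use bound in auto)
  have "summable (\<lambda>n. of_real 1 * of_nat n powr - s :: complex)"
    by (rule summable_norm_cancel, rule summable_dirichlet_norm[of "\<lambda>_. 1"]) (use assms in auto)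
  from suminf_split_head[OF this] have "dirichlet_series (\<lambda>_. 1) s = (\<Sum>n. g n)"
    by (simp add: dirichlet_series_def g_def)
  also have "(\<lambda>n. (g n - (G (Suc n) - G n)) + (G (Suc n) - G n)) sums ((\<Sum>n. g n - (G (Suc n) - G n)) + 1 / (s - 1))"
    by (intro sums_add summable_sums sum_d tel)
  then have "(\<Sum>n. g n) = (\<Sum>n. g n - (G (Suc n) - G n)) + 1 / (s - 1)" by (simp add: sums_iff)
  also have "norm \<dots> \<le> norm (\<Sum>n. g n - (G (Suc n) - G n)) + norm (1 / (s - 1))" by (rule norm_triangle_ineq)
  also have "norm (\<Sum>n. g n - (G (Suc n) - G n)) \<le> (\<Sum>n. norm s * real (Suc n) powr - 2)"
    by (rule norm_suminf_le) (use bound sum2 in \<open>auto intro: summable_mult\<close>)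
  also have "\<dots> = norm s * (\<Sum>n. real (Suc n) powr - 2)"
    using sum2 by (rule suminf_mult)
  also have "(\<Sum>n. real (Suc n) powr - 2) = (\<Sum>n. real n powr - 2)"
    by (subst suminf_split_head) (auto simp: summable_real_powr_iff)
  finally show ?thesis by (simp add: norm_divide)
qed

section \<open>The L-series of a real character\<close>

context real_char
begin

abbreviation L_term :: "complex \<Rightarrow> nat \<Rightarrow> complex" where
  "L_term s k \<equiv> of_real (\<Sum>n=1..Suc k. chi n) * (of_nat (Suc k) powr - s - of_nat (Suc (Suc k)) powr - s)"

text \<open>The Dirichlet series after Abel summation. In this form it converges absolutely for Re s
  > 0, and so continues the series across the line Re s = 1.\<close>

definition L :: "complex \<Rightarrow> complex" where
  "L s = (\<Sum>k. L_term s k)"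

lemma abel_summation:
  fixes g :: "nat \<Rightarrow> 'a :: real_algebra_1"
  shows "(\<Sum>n=1..N. of_real (chi n) * g n) =
    (\<Sum>k<N. of_real (\<Sum>n=1..Suc k. chi n) * (g (Suc k) - g (Suc (Suc k)))) + of_real (\<Sum>n=1..N. chi n) * g (Suc N)"
  by (induction N) (auto simp: algebra_simps)

lemma norm_L_term_le:
  assumes "Re s > 0"
  shows "norm (L_term s k)
           \<le> B * norm s * real (Suc k) powr (- Re s - 1)"
proof -
  have "norm (of_real (real (Suc (Suc k))) powr - s - of_real (real (Suc k)) powr - s :: complex) \<le> norm s * real (Suc k) powr (- Re s - 1)"
    by (rule powr_diff_bound) (use assms in auto)
  then have "norm (of_nat (Suc k) powr - s - of_nat (Suc (Suc k)) powr - s :: complex) \<le> norm s * real (Suc k) powr (- Re s - 1)"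
    by (simp only: of_real_of_nat_eq norm_minus_commute)
  moreover have "norm (of_real (\<Sum>n=1..Suc k. chi n) :: complex) \<le> B"
    using char_partial_sums[of "Suc k"] by (simp only: norm_of_real)
  ultimately have "norm (of_real (\<Sum>n=1..Suc k. chi n) :: complex) * norm (of_nat (Suc k) powr - s - of_nat (Suc (Suc k)) powr - s :: complex)
      \<le> B * (norm s * real (Suc k) powr (- Re s - 1))"
    using B_ge_1 by (intro mult_mono) auto
  then show ?thesis by (simp only: norm_mult mult.assoc)
qed

lemma partial_sums_tendsto_L:
  assumes "Re s > 0"
  shows "(\<lambda>N. \<Sum>n=1..N. of_real (chi n) * of_nat n powr - s) \<longlonglongrightarrow> L s"
proof -
  have "summable (\<lambda>k. B * norm s * real (Suc k) powr (- Re s - 1))"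
    using assms by (intro summable_mult, subst summable_Suc_iff) (simp add: summable_real_powr_iff)
  then have "summable (L_term s)"
    by (rule summable_comparison_test') (rule norm_L_term_le[OF assms])
  then have 1: "(\<lambda>N. \<Sum>k<N. L_term s k) \<longlonglongrightarrow> L s"
    unfolding L_def by (rule summable_LIMSEQ)
  have 2: "(\<lambda>N. of_real (\<Sum>n=1..N. chi n) * of_nat (Suc N) powr - s :: complex) \<longlonglongrightarrow> 0"
  proof (rule Lim_null_comparison[OF always_eventually])
    show "\<forall>N. norm (of_real (\<Sum>n=1..N. chi n) * of_nat (Suc N) powr - s :: complex) \<le> B * real (Suc N) powr - Re s"
    proof
      fix N
      have "norm (of_nat (Suc N) powr - s :: complex) = real (Suc N) powr - Re s"
        by (simp add: norm_powr_real_powr del: of_nat_Suc)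
      then show "norm (of_real (\<Sum>n=1..N. chi n) * of_nat (Suc N) powr - s :: complex) \<le> B * real (Suc N) powr - Re s"
        unfolding norm_mult norm_of_real using char_partial_sums[of N] by (simp add: mult_right_mono)
    qed
    have "(\<lambda>n. real (Suc n) powr - Re s) \<longlonglongrightarrow> 0"
      by (rule LIMSEQ_Suc, rule tendsto_neg_powr) (use assms filterlim_real_sequentially in auto)
    from tendsto_mult_right_zero[OF this]
    show "(\<lambda>N. B * real (Suc N) powr - Re s) \<longlonglongrightarrow> 0" .
  qed
  show ?thesis unfolding abel_summation using tendsto_add[OF 1 2] by simp
qed

lemma L_eq_dirichlet_series:
  assumes "Re s > 1"
  shows "dirichlet_series chi s = L s"
proof (rule LIMSEQ_unique)
  have "summable (\<lambda>n. of_real (chi n) * of_nat n powr - s :: complex)"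
    by (rule summable_norm_cancel, rule summable_dirichlet_norm) (use assms char_abs_le_1 in auto)
  then have "(\<lambda>N. \<Sum>n<N. of_real (chi n) * of_nat n powr - s) \<longlonglongrightarrow> dirichlet_series chi s"
    unfolding dirichlet_series_def by (rule summable_LIMSEQ)
  then have "(\<lambda>N. \<Sum>n<Suc N. of_real (chi n) * of_nat n powr - s) \<longlonglongrightarrow> dirichlet_series chi s"
    by (rule LIMSEQ_Suc)
  also have "(\<lambda>N. \<Sum>n<Suc N. of_real (chi n) * of_nat n powr - s :: complex) = (\<lambda>N. \<Sum>n=1..N. of_real (chi n) * of_nat n powr - s)"
  proof
    fix N
    show "(\<Sum>n<Suc N. of_real (chi n) * of_nat n powr - s :: complex) = (\<Sum>n=1..N. of_real (chi n) * of_nat n powr - s)"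
      by (rule sum.mono_neutral_right) auto
  qed
  finally show "(\<lambda>N. \<Sum>n=1..N. of_real (chi n) * of_nat n powr - s) \<longlonglongrightarrow> dirichlet_series chi s" .
  show "(\<lambda>N. \<Sum>n=1..N. of_real (chi n) * of_nat n powr - s) \<longlonglongrightarrow> L s"
    using assms by (intro partial_sums_tendsto_L) auto
qed

lemma L_holomorphic: "L holomorphic_on {s. Re s > 0}"
proof (rule holomorphic_uniform_sequence)
  show "open {s. Re s > 0}" by (rule open_halfspace_Re_gt)
  show "(\<lambda>s. \<Sum>k<N. L_term s k)
      holomorphic_on {s. Re s > 0}" for N
    by (intro holomorphic_intros)
  fix x assume "x \<in> {s. Re s > 0}"
  then have x: "Re x > 0" by simp
  \<comment> \<open>On the disc of this radius Re s stays at least d and |s| stays bounded, so one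
    majorant of order k powr (- d - 1) serves all its points.\<close>
  define d where "d = Re x / 2"
  have d: "d > 0" using x by (simp add: d_def)
  have Re_ge: "Re s \<ge> d" and norm_le: "norm s \<le> norm x + d" if "s \<in> cball x d" for s
  proof -
    have "norm (x - s) \<le> d" using that by (simp add: dist_norm)
    then show "Re s \<ge> d" using abs_Re_le_cmod[of "x - s"] by (simp add: d_def abs_if split: if_splits)
    show "norm s \<le> norm x + d" using \<open>norm (x - s) \<le> d\<close> norm_triangle_ineq2[of s x] by (simp add: norm_minus_commute)
  qed
  show "\<exists>d>0. cball x d \<subseteq> {s. Re s > 0} \<and>
      uniform_limit (cball x d) (\<lambda>N s. \<Sum>k<N. L_term s k) L sequentially"
  proof (intro exI conjI)
    show "cball x d \<subseteq> {s. Re s > 0}" using Re_ge d by force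
    show "uniform_limit (cball x d) (\<lambda>N s. \<Sum>k<N. L_term s k) L sequentially"
      unfolding L_def [abs_def]
    proof (rule Weierstrass_m_test)
      show "summable (\<lambda>k. B * (norm x + d) * real (Suc k) powr (- d - 1))"
        using d by (intro summable_mult, subst summable_Suc_iff) (simp add: summable_real_powr_iff)
      fix k s assume s: "s \<in> cball x d"
      have "norm (L_term s k)
           \<le> B * norm s * real (Suc k) powr (- Re s - 1)"
        using Re_ge[OF s] d by (intro norm_L_term_le) auto
      also have "\<dots> \<le> B * (norm x + d) * real (Suc k) powr (- d - 1)"
        using Re_ge[OF s] norm_le[OF s] d B_ge_1 by (intro mult_mono powr_mono) auto
      finally show "norm (L_term s k)
         \<le> B * (norm x + d) * real (Suc k) powr (- d - 1)" .
    qed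
  qed (rule d)
qed

text \<open>A zero at 1 + it makes L(1 + h + it) of order h, and its fourth power beats the cube of
  zeta(1 + h), of order 1 / h. The remaining factor near 1 + 2it is bounded because t is nonzero.
  The product in 3-4-1 would then be O(h), yet it is at least 1.\<close>

lemma L_nonzero_off_real_axis:
  assumes "t \<noteq> 0"
  shows "L (Complex 1 t) \<noteq> 0"
proof
  assume zero: "L (Complex 1 t) = 0"
  define Z where "Z = (\<Sum>n. real n powr - 2)"
  have Z: "Z \<ge> 0" unfolding Z_def by (intro suminf_nonneg) (auto simp: summable_real_powr_iff)
  have "L field_differentiable (at (Complex 1 t))"
    using L_holomorphic open_halfspace_Re_gt by (rule holomorphic_on_imp_differentiable_at) auto
  then obtain D where "(L has_field_derivative D) (at (Complex 1 t))"
    by (auto simp: field_differentiable_def)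
  then have "((\<lambda>h. (L (Complex 1 t + h) - L (Complex 1 t)) / h) \<longlongrightarrow> D) (at 0)"
    by (simp add: DERIV_def)
  then have "\<forall>\<^sub>F h in at 0. dist ((L (Complex 1 t + h) - L (Complex 1 t)) / h) D < 1"
    by (rule tendstoD) simp
  then obtain d where d: "d > 0" "\<And>h. h \<noteq> 0 \<Longrightarrow> norm h < d \<Longrightarrow> dist ((L (Complex 1 t + h) - L (Complex 1 t)) / h) D < 1"
    unfolding eventually_at by (auto simp: dist_norm)
  define E where "E = norm D + 1"
  have E: "E > 0" by (simp add: E_def add_nonneg_pos)
  have L_le: "norm (L (Complex (1 + h) t)) \<le> E * h" if "0 < h" "h < d" for h
  proof -
    have "dist (L (Complex 1 t + of_real h) / of_real h) D < 1"
      using d(2)[of "of_real h"] that zero by simp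
    then have "norm (L (Complex 1 t + of_real h) / of_real h) \<le> E"
      using norm_triangle_ineq2[of "L (Complex 1 t + of_real h) / of_real h" D] by (simp add: dist_norm E_def)
    moreover have "Complex 1 t + of_real h = Complex (1 + h) t" by (simp add: complex_eq_iff)
    ultimately show ?thesis using that by (simp add: norm_divide field_simps)
  qed
  define C where "C = exp (4 * Z)"
  define M where "M = C * (1 + 2 * Z) ^ 3 * E ^ 4 * (1 / \<bar>2 * t\<bar> + (2 + \<bar>2 * t\<bar>) * Z)"
  have M: "M \<ge> 0" unfolding M_def C_def using Z E by simp
  have key: "1 \<le> M * h" if h: "0 < h" "h < d" "h \<le> 1" for h
  proof -
    have "norm (dirichlet_series (\<lambda>_. 1) (of_real (1 + h))) \<le> 1 / norm (of_real (1 + h) - 1 :: complex) + norm (of_real (1 + h) :: complex) * Z"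
      unfolding Z_def by (rule norm_zeta_le) (use h in simp)
    also have "norm (of_real (1 + h) - 1 :: complex) = h" using h by simp
    also have "norm (of_real (1 + h) :: complex) = 1 + h" by (subst norm_of_real) (use h in simp)
    also have "1 / h + (1 + h) * Z \<le> 1 / h + 2 * Z / h"
    proof -
      have "(1 + h) * Z \<le> 2 * Z" using h Z by (intro mult_right_mono) auto
      also have "2 * Z \<le> 2 * Z / h" using h Z by (simp add: field_simps mult_left_le)
      finally show ?thesis by simp
    qed
    finally have z1: "norm (dirichlet_series (\<lambda>_. 1) (of_real (1 + h))) \<le> (1 + 2 * Z) / h"
      by (simp add: add_divide_distrib)
    have "norm (dirichlet_series (\<lambda>_. 1) (Complex (1 + h) (2 * t))) \<le> 1 / norm (Complex (1 + h) (2 * t) - 1) + norm (Complex (1 + h) (2 * t)) * Z"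
      unfolding Z_def by (rule norm_zeta_le) (use h in simp)
    also have "\<dots> \<le> 1 / \<bar>2 * t\<bar> + (2 + \<bar>2 * t\<bar>) * Z"
    proof (intro add_mono mult_right_mono divide_left_mono)
      show "\<bar>2 * t\<bar> \<le> norm (Complex (1 + h) (2 * t) - 1)"
        using abs_Im_le_cmod[of "Complex (1 + h) (2 * t) - 1"] by simp
      show "norm (Complex (1 + h) (2 * t)) \<le> 2 + \<bar>2 * t\<bar>"
        using cmod_le[of "Complex (1 + h) (2 * t)"] h by simp
      show "0 < norm (Complex (1 + h) (2 * t) - 1) * \<bar>2 * t\<bar>"
        using assms h by (simp add: complex_eq_iff)
    qed (use Z in auto)
    finally have z3: "norm (dirichlet_series (\<lambda>_. 1) (Complex (1 + h) (2 * t))) \<le> 1 / \<bar>2 * t\<bar> + (2 + \<bar>2 * t\<bar>) * Z" .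
    have z2: "norm (dirichlet_series chi (Complex (1 + h) t)) \<le> E * h"
      using L_le[OF h(1,2)] L_eq_dirichlet_series[of "Complex (1 + h) t"] h by simp
    have "1 \<le> C * norm (dirichlet_series (\<lambda>_. 1) (of_real (1 + h))) ^ 3 * norm (dirichlet_series chi (Complex (1 + h) t)) ^ 4 *
        norm (dirichlet_series (\<lambda>_. 1) (Complex (1 + h) (2 * t)))"
      unfolding C_def Z_def by (rule three_four_one) (use h in simp)
    also have "\<dots> \<le> C * ((1 + 2 * Z) / h) ^ 3 * (E * h) ^ 4 * (1 / \<bar>2 * t\<bar> + (2 + \<bar>2 * t\<bar>) * Z)"
      using Z E h by (intro mult_mono power_mono z1 z2 z3) (auto simp: C_def)
    also have "\<dots> = M * h"
      using h by (simp add: M_def power_divide power_mult_distrib field_simps eval_nat_numeral)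
    finally show ?thesis .
  qed
  \<comment> \<open>The last entry forces M * h < 1; M + 1 keeps the denominator positive when M =
    0.\<close>
  define h where "h = min 1 (min (d / 2) (1 / (2 * (M + 1))))"
  have h: "0 < h" "h < d" "h \<le> 1" "h \<le> 1 / (2 * (M + 1))"
    using d(1) M by (auto simp: h_def min_less_iff_disj min_le_iff_disj)
  have "M * h \<le> M * (1 / (2 * (M + 1)))" using h M by (intro mult_left_mono) auto
  also have "\<dots> < 1" using M by (simp add: field_simps)
  finally show False using key[OF h(1-3)] by simp
qed

end

section \<open>Divisor sums and the Moebius function\<close>

lemma sum_divisors_coprime:
  fixes a b :: nat and F :: "nat \<Rightarrow> 'a :: comm_monoid_add"
  assumes "coprime a b"
  shows "(\<Sum>d | d dvd a * b. F d) = (\<Sum>d | d dvd a. \<Sum>e | e dvd b. F (d * e))"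
proof -
  have gcds: "gcd (x * y) a = x" "gcd (x * y) b = y" if "x dvd a" "y dvd b" for x y
  proof -
    have "coprime y a" "coprime x b" using that assms
      by (meson coprime_commute coprime_divisors dvd_refl)+
    then have "gcd (x * y) a = gcd x a" "gcd (x * y) b = gcd y b"
      by (simp_all add: gcd_mult_left_left_cancel gcd_mult_left_right_cancel coprime_commute)
    then show "gcd (x * y) a = x" "gcd (x * y) b = y"
      using that by (simp_all add: gcd_nat.absorb1)
  qed
  have "(\<Sum>d | d dvd a * b. F d) = (\<Sum>(d, e)\<in>{d. d dvd a} \<times> {e. e dvd b}. F (d * e))"
  proof (rule sum.reindex_bij_witness[where j = "\<lambda>d. (gcd d a, gcd d b)" and i = "\<lambda>(x, y). x * y"])
    fix d assume "d \<in> {d. d dvd a * b}"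
    then obtain x y where "d = x * y" "x dvd a" "y dvd b"
      using division_decomp[of d a b] by auto
    then show "(case (gcd d a, gcd d b) of (x, y) \<Rightarrow> x * y) = d"
      and "(case (gcd d a, gcd d b) of (d, e) \<Rightarrow> F (d * e)) = F d"
      using gcds by auto
  qed (use gcds in \<open>auto intro: mult_dvd_mono\<close>)
  then show ?thesis by (simp add: sum.cartesian_product)
qed

text \<open>The induction step for multiplicative functions: the full power of one prime is split
  off, and the cofactor is strictly smaller.\<close>

lemma prime_power_cofactor:
  fixes n :: nat
  assumes "n > 1"
  obtains p k m where "prime p" "k > 0" "n = p ^ k * m" "\<not> p dvd m" "m > 0" "m < n" "k = multiplicity p n"
proof -
  obtain p where p: "prime p" "p dvd n" using assms prime_factor_nat[of n] by auto
  have np: "\<not> is_unit p" using p(1) not_prime_unit by blast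
  obtain m where m: "n = p ^ multiplicity p n * m" "\<not> p dvd m"
    using multiplicity_decompose'[of n p] assms np by auto
  have k: "multiplicity p n > 0" using p assms by (simp add: prime_multiplicity_gt_zero_iff)
  have m0: "m > 0" using m assms by (intro Nat.gr0I) auto
  have "1 < p ^ multiplicity p n" by (rule one_less_power[OF prime_gt_1_nat[OF p(1)] k])
  then have "m < p ^ multiplicity p n * m" using n_less_m_mult_n[OF m0] by (simp only: One_nat_def)
  then have "m < n" by (subst m(1))
  show thesis by (rule that[OF p(1) k m(1,2) m0 \<open>m < n\<close> refl])
qed

definition moebius_mu :: "nat \<Rightarrow> real" where
  "moebius_mu n = (if squarefree n then (-1) ^ card (prime_factors n) else 0)"

lemma moebius_1 [simp]: "moebius_mu 1 = 1" "moebius_mu (Suc 0) = 1"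
  by (simp_all add: moebius_mu_def)

lemma moebius_abs_le: "\<bar>moebius_mu n\<bar> \<le> 1"
  by (simp add: moebius_mu_def)

lemma moebius_prime_power_mult:
  assumes "prime p" "\<not> p dvd e"
  shows "moebius_mu (p ^ i * e) = (if i = 0 then moebius_mu e else if i = 1 then - moebius_mu e else 0)"
proof -
  have e: "e > 0" using assms(2) by (intro Nat.gr0I) auto
  have "moebius_mu (p * e) = - moebius_mu e"
  proof -
    have "coprime p e" using assms by (simp add: prime_imp_coprime)
    then have "squarefree (p * e) \<longleftrightarrow> squarefree e"
      using assms(1) by (auto simp: squarefree_mult_coprime squarefree_prime dest: squarefree_multD)
    moreover have "prime_factors (p * e) = insert p (prime_factors e)"
      using assms(1) e by (simp add: prime_factors_product prime_gt_0_nat prime_factorization_prime)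
    moreover have "p \<notin> prime_factors e" using assms by auto
    ultimately show ?thesis by (simp add: moebius_mu_def)
  qed
  moreover have "moebius_mu (p ^ i * e) = 0" if "i \<ge> 2"
  proof -
    have "p\<^sup>2 dvd p ^ i * e" using that by (intro dvd_mult2 le_imp_power_dvd)
    moreover have "\<not> is_unit p" using assms(1) not_prime_unit by blast
    ultimately have "\<not> squarefree (p ^ i * e)" unfolding squarefree_def by blast
    then show ?thesis by (simp add: moebius_mu_def)
  qed
  ultimately show ?thesis by (cases "i = 0"; cases "i = 1") auto
qed

lemma divisors_prime_power: "prime (p::nat) \<Longrightarrow> {d. d dvd p ^ k} = (\<lambda>i. p ^ i) ` {..k}"
  by (auto simp: divides_primepow_nat le_imp_power_dvd)

lemma inj_on_prime_power: "prime (p::nat) \<Longrightarrow> inj_on (\<lambda>i. p ^ i) A"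
  by (auto simp: inj_on_def prime_power_inj)

text \<open>For n > 1 a single prime p decides: divisors with p^2 contribute 0, and those with
  exactly one p cancel those without p.\<close>

lemma sum_moebius_divisors:
  assumes "n > 0"
  shows "(\<Sum>d | d dvd n. moebius_mu d) = (if n = 1 then 1 else 0)"
proof (cases "n = 1")
  case True
  then show ?thesis by simp
next
  case False
  with assms have "n > 1" by simp
  then obtain p k m where p: "prime p" "k > 0" "n = p ^ k * m" "\<not> p dvd m" "m > 0"
    by (rule prime_power_cofactor)
  have "coprime (p ^ k) m" using p by (simp add: prime_imp_coprime)
  then have "(\<Sum>d | d dvd n. moebius_mu d) = (\<Sum>d | d dvd p ^ k. \<Sum>e | e dvd m. moebius_mu (d * e))"
    unfolding p(3) by (rule sum_divisors_coprime)
  also have "\<dots> = (\<Sum>i\<le>k. \<Sum>e | e dvd m. moebius_mu (p ^ i * e))"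
    by (simp add: divisors_prime_power[OF p(1)] sum.reindex[OF inj_on_prime_power[OF p(1)]] o_def)
  also have "\<dots> = (\<Sum>i\<in>{0, 1}. \<Sum>e | e dvd m. moebius_mu (p ^ i * e))"
  proof (rule sum.mono_neutral_right)
    show "\<forall>i\<in>{..k} - {0, 1}. (\<Sum>e | e dvd m. moebius_mu (p ^ i * e)) = 0"
    proof
      fix i assume i: "i \<in> {..k} - {0, 1}"
      have "moebius_mu (p ^ i * e) = 0" if "e dvd m" for e
        using i p(4) that by (subst moebius_prime_power_mult[OF p(1)]) (auto dest: dvd_trans)
      then show "(\<Sum>e | e dvd m. moebius_mu (p ^ i * e)) = 0" by simp
    qed
  qed (use p in auto)
  also have "\<dots> = (\<Sum>e | e dvd m. moebius_mu e) + (\<Sum>e | e dvd m. moebius_mu (p ^ 1 * e))" by simp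
  also have "(\<Sum>e | e dvd m. moebius_mu (p ^ 1 * e)) = (\<Sum>e | e dvd m. - moebius_mu e)"
  proof (rule sum.cong)
    fix e assume "e \<in> {e. e dvd m}"
    then have "\<not> p dvd e" using p(4) by (auto dest: dvd_trans)
    from moebius_prime_power_mult[OF p(1) this, of 1]
    show "moebius_mu (p ^ 1 * e) = - moebius_mu e" by simp
  qed simp
  finally show ?thesis using False by (simp add: sum_negf)
qed

text \<open>Dirichlet convolution of absolutely summable families, stated for an arbitrary g of two
  variables so that it covers both products of Dirichlet series and Lambert series.\<close>

lemma infsum_regroup_divisors:
  fixes g :: "nat \<times> nat \<Rightarrow> 'a :: banach"
  assumes "g summable_on {0<..} \<times> {0<..}"
  shows "(\<Sum>\<^sub>\<infinity>a\<in>{0<..}. \<Sum>\<^sub>\<infinity>b\<in>{0<..}. g (a, b)) = (\<Sum>\<^sub>\<infinity>n\<in>{0<..}. \<Sum>d | d dvd n. g (d, n div d))"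
    and "(\<lambda>n. \<Sum>d | d dvd n. g (d, n div d)) summable_on {0<..}"
proof -
  have bij: "bij_betw (\<lambda>(n, d). (d, n div d)) (SIGMA n:{0::nat<..}. {d. d dvd n}) ({0<..} \<times> {0<..})"
    by (rule bij_betwI[where g = "\<lambda>(a, b). (a * b, a)"]) (auto simp: dvd_div_eq_0_iff elim!: dvdE)
  have sm: "(\<lambda>(n, d). g (d, n div d)) summable_on (SIGMA n:{0<..}. {d. d dvd n})"
    using summable_on_reindex_bij_betw[OF bij, of g] assms by (simp add: case_prod_unfold)
  have fin: "(\<Sum>\<^sub>\<infinity>d | d dvd n. g (d, n div d)) = (\<Sum>d | d dvd n. g (d, n div d))" if "n \<in> {0<..}" for n
    using that by (intro infsum_finite) auto
  have "(\<Sum>\<^sub>\<infinity>a\<in>{0<..}. \<Sum>\<^sub>\<infinity>b\<in>{0<..}. g (a, b)) = (\<Sum>\<^sub>\<infinity>(a, b)\<in>{0<..} \<times> {0<..}. g (a, b))"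
    using assms by (intro infsum_Sigma'_banach) simp
  also have "\<dots> = (\<Sum>\<^sub>\<infinity>(n, d)\<in>(SIGMA n:{0<..}. {d. d dvd n}). g (d, n div d))"
    using infsum_reindex_bij_betw[OF bij, of g] by (simp add: case_prod_unfold)
  also have "\<dots> = (\<Sum>\<^sub>\<infinity>n\<in>{0<..}. \<Sum>\<^sub>\<infinity>d | d dvd n. g (d, n div d))"
    using sm by (intro infsum_Sigma'_banach[symmetric])
  also have "\<dots> = (\<Sum>\<^sub>\<infinity>n\<in>{0<..}. \<Sum>d | d dvd n. g (d, n div d))"
    by (intro infsum_cong fin)
  finally show "(\<Sum>\<^sub>\<infinity>a\<in>{0<..}. \<Sum>\<^sub>\<infinity>b\<in>{0<..}. g (a, b)) = (\<Sum>\<^sub>\<infinity>n\<in>{0<..}. \<Sum>d | d dvd n. g (d, n div d))" .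
  have "(\<lambda>n. \<Sum>\<^sub>\<infinity>d | d dvd n. g (d, n div d)) summable_on {0<..}"
    using sm by (intro summable_on_Sigma_banach)
  then show "(\<lambda>n. \<Sum>d | d dvd n. g (d, n div d)) summable_on {0<..}"
    by (subst (asm) summable_on_cong[OF fin])
qed

context real_char
begin

lemma sum_divisors_char_prime_power_mult:
  assumes "prime p" "\<not> p dvd m"
  shows "(\<Sum>d | d dvd p ^ k * m. chi d) = (\<Sum>i\<le>k. chi p ^ i) * (\<Sum>d | d dvd m. chi d)"
proof -
  have pow: "chi (p ^ i) = chi p ^ i" for i
    using char_1 by (induction i) (auto simp: char_mult)
  have "coprime (p ^ k) m" using assms by (simp add: prime_imp_coprime)
  then have "(\<Sum>d | d dvd p ^ k * m. chi d) = (\<Sum>d | d dvd p ^ k. \<Sum>e | e dvd m. chi (d * e))"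
    by (rule sum_divisors_coprime)
  also have "\<dots> = (\<Sum>i\<le>k. \<Sum>e | e dvd m. chi (p ^ i * e))"
    by (simp add: divisors_prime_power[OF assms(1)] sum.reindex[OF inj_on_prime_power[OF assms(1)]] o_def)
  finally show ?thesis by (simp add: char_mult pow sum_product)
qed

text \<open>Parity matters only for chi p = -1, where the sum alternates between 1 and 0. For chi p
  = 0 the term i = 0 survives as 0^0 = 1.\<close>

lemma geometric_char_sum:
  shows "(\<Sum>i\<le>k. chi p ^ i) \<ge> 0" and "even k \<Longrightarrow> (\<Sum>i\<le>k. chi p ^ i) \<ge> 1"
proof -
  have "(\<Sum>i\<le>k. (-1 :: real) ^ i) = (if even k then 1 else 0)"
    by (induction k) auto
  moreover have "(\<Sum>i\<le>k. (0 :: real) ^ i) = 1"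
    by (induction k) auto
  ultimately show "(\<Sum>i\<le>k. chi p ^ i) \<ge> 0" and "even k \<Longrightarrow> (\<Sum>i\<le>k. chi p ^ i) \<ge> 1"
    using char_values[of p] by auto
qed

text \<open>The divisor sum is multiplicative, so prime powers decide. Squares are described by even
  multiplicities because that property passes to the cofactor in the induction.\<close>

lemma sum_divisors_char_nonneg:
  assumes "n > 0"
  shows "(\<Sum>d | d dvd n. chi d) \<ge> 0 \<and> ((\<forall>p. prime p \<longrightarrow> even (multiplicity p n)) \<longrightarrow> (\<Sum>d | d dvd n. chi d) \<ge> 1)"
  using assms
proof (induction n rule: less_induct)
  case (less n)
  show ?case
  proof (cases "n = 1")
    case True
    then show ?thesis using char_1 by simp
  next
    case False
    with less.prems have "n > 1" by simp
    then obtain p k m where p: "prime p" "k > 0" "n = p ^ k * m" "\<not> p dvd m" "m > 0" "m < n" "k = multiplicity p n"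
      by (rule prime_power_cofactor)
    have eq: "(\<Sum>d | d dvd n. chi d) = (\<Sum>i\<le>k. chi p ^ i) * (\<Sum>d | d dvd m. chi d)"
      unfolding p(3) using p(1,4) by (intro sum_divisors_char_prime_power_mult)
    have IH: "(\<Sum>d | d dvd m. chi d) \<ge> 0"
      "(\<forall>q. prime q \<longrightarrow> even (multiplicity q m)) \<Longrightarrow> (\<Sum>d | d dvd m. chi d) \<ge> 1"
      using less.IH[OF p(6) p(5)] by auto
    have "(\<Sum>d | d dvd n. chi d) \<ge> 1" if ev: "\<forall>q. prime q \<longrightarrow> even (multiplicity q n)"
    proof -
      have "even (multiplicity q m)" if "prime q" for q
      proof (cases "q = p")
        case True
        then show ?thesis using p(4) by (simp add: not_dvd_imp_multiplicity_0)
      next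
        case False
        then have "multiplicity q n = multiplicity q m"
          unfolding p(3) using p(1,2,4,5) that
          by (subst prime_elem_multiplicity_mult_distrib)
             (auto simp: multiplicity_distinct_prime_power prime_gt_0_nat)
        then show ?thesis using ev[rule_format, OF that] by simp
      qed
      then have "1 \<le> (\<Sum>d | d dvd m. chi d)" using IH(2) by blast
      moreover have "1 \<le> (\<Sum>i\<le>k. chi p ^ i)" using ev p(1,7) by (intro geometric_char_sum(2)) simp
      ultimately show ?thesis unfolding eq
        using mult_mono[of 1 "\<Sum>i\<le>k. chi p ^ i" 1 "\<Sum>d | d dvd m. chi d"] by simp
    qed
    then show ?thesis using eq IH(1) geometric_char_sum(1)[of p k] by simp
  qed
qed

lemma sum_divisors_char_square:
  assumes "j > 0"
  shows "(\<Sum>d | d dvd j\<^sup>2. chi d) \<ge> 1"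
  using sum_divisors_char_nonneg[of "j\<^sup>2"] assms by (simp add: prime_elem_multiplicity_power_distrib)

text \<open>By complete multiplicativity h d * f (n div d) = moebius_mu d * f n, so the coefficient
  at n of the product is f n times the Moebius divisor sum, which is 0 unless n = 1.\<close>

lemma dirichlet_series_moebius:
  assumes "Re s > 1"
  shows "dirichlet_series (\<lambda>n. moebius_mu n * chi n) s * dirichlet_series chi s = 1"
proof -
  define f where "f = (\<lambda>n. of_real (chi n) * of_nat n powr - s :: complex)"
  define h where "h = (\<lambda>n. of_real (moebius_mu n * chi n) * of_nat n powr - s :: complex)"
  have bdd: "\<bar>moebius_mu n * chi n\<bar> \<le> 1" for n
    using char_abs_le_1[of n] moebius_abs_le[of n] by (simp add: abs_mult mult_le_one)
  have sf: "(\<lambda>n. norm (f n)) summable_on UNIV"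
    unfolding f_def using char_abs_le_1 assms by (rule abs_summable_dirichlet)
  have sh: "(\<lambda>n. norm (h n)) summable_on UNIV"
    unfolding h_def using bdd assms by (rule abs_summable_dirichlet)
  have sf': "(\<lambda>n. norm (f n)) summable_on S" and sh': "(\<lambda>n. norm (h n)) summable_on S" for S
    by (rule summable_on_subset_banach[OF sf], simp) (rule summable_on_subset_banach[OF sh], simp)
  have f_mult: "f (m * n) = f m * f n" for m n
    by (simp add: f_def char_mult powr_times_real mult_ac)
  have h_eq: "h n = of_real (moebius_mu n) * f n" for n by (simp add: f_def h_def)
  have "(\<lambda>p. norm (h (fst p) * f (snd p))) summable_on {0<..} \<times> {0<..}"
  proof (rule summable_on_SigmaI)
    show "((\<lambda>y. norm (h (fst (x, y)) * f (snd (x, y)))) has_sum norm (h x) * (\<Sum>\<^sub>\<infinity>n\<in>{0<..}. norm (f n))) {0<..}" for x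
      unfolding fst_conv snd_conv norm_mult by (intro has_sum_cmult_right has_sum_infsum sf')
    show "(\<lambda>x. norm (h x) * (\<Sum>\<^sub>\<infinity>n\<in>{0<..}. norm (f n))) summable_on {0<..}"
      by (intro summable_on_cmult_left sh')
  qed auto
  then have sm: "(\<lambda>p. h (fst p) * f (snd p)) summable_on {0<..} \<times> {0<..}"
    by (rule abs_summable_summable)
  have zero: "f 0 = 0" "h 0 = 0" by (simp_all add: f_def h_def)
  have "dirichlet_series (\<lambda>n. moebius_mu n * chi n) s = (\<Sum>\<^sub>\<infinity>n. h n)"
    unfolding h_def using bdd assms by (rule dirichlet_series_conv_infsum)
  also have "\<dots> = (\<Sum>\<^sub>\<infinity>n\<in>{0<..}. h n)"
    by (rule infsum_cong_neutral) (use zero in auto)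
  finally have H: "dirichlet_series (\<lambda>n. moebius_mu n * chi n) s = (\<Sum>\<^sub>\<infinity>n\<in>{0<..}. h n)" .
  have "dirichlet_series chi s = (\<Sum>\<^sub>\<infinity>n. f n)"
    unfolding f_def using char_abs_le_1 assms by (rule dirichlet_series_conv_infsum)
  also have "\<dots> = (\<Sum>\<^sub>\<infinity>n\<in>{0<..}. f n)"
    by (rule infsum_cong_neutral) (use zero in auto)
  finally have F: "dirichlet_series chi s = (\<Sum>\<^sub>\<infinity>n\<in>{0<..}. f n)" .
  have "(\<Sum>\<^sub>\<infinity>n\<in>{0<..}. h n) * (\<Sum>\<^sub>\<infinity>n\<in>{0<..}. f n) = (\<Sum>\<^sub>\<infinity>a\<in>{0<..}. \<Sum>\<^sub>\<infinity>b\<in>{0<..}. h a * f b)"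
    by (simp add: infsum_cmult_right' infsum_cmult_left')
  also have "\<dots> = (\<Sum>\<^sub>\<infinity>n\<in>{0<..}. \<Sum>d | d dvd n. h d * f (n div d))"
    using infsum_regroup_divisors(1)[OF sm] by simp
  also have "\<dots> = (\<Sum>\<^sub>\<infinity>n\<in>{0::nat<..}. if n = 1 then 1 else 0)"
  proof (rule infsum_cong)
    fix n :: nat assume n: "n \<in> {0<..}"
    have "(\<Sum>d | d dvd n. h d * f (n div d)) = (\<Sum>d | d dvd n. of_real (moebius_mu d) * f n)"
      by (rule sum.cong) (auto simp: h_eq mult.assoc simp flip: f_mult)
    also have "\<dots> = of_real (\<Sum>d | d dvd n. moebius_mu d) * f n" by (simp add: sum_distrib_right)
    also have "\<dots> = (if n = 1 then 1 else 0)"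
      using n char_1 by (simp add: sum_moebius_divisors f_def)
    finally show "(\<Sum>d | d dvd n. h d * f (n div d)) = (if n = 1 then 1 else 0)" .
  qed
  also have "\<dots> = (\<Sum>\<^sub>\<infinity>n\<in>{1::nat}. 1 :: complex)" by (rule infsum_cong_neutral) auto
  finally show ?thesis using H F by simp
qed

end

section \<open>Lambert series and nonvanishing at s = 1\<close>

text \<open>Write 1 - x^n = (1 - x) A n. Pairing the powers i and n - 1 - i in A n, the inequality
  of arithmetic and geometric means gives A n \<ge> n y^(n - 1) with y = sqrt x. Consecutive Lambert
  terms then differ by x^n / ((1 - x) A n A (n + 1)), which is at most the decrement of 1 / (n (1 -
  x)).\<close>

lemma lambert_coefficient_decreasing:
  fixes x :: real and n :: nat
  assumes "0 < x" "x < 1" "n > 0"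
  shows "1 / (real n * (1 - x)) - x ^ n / (1 - x ^ n) \<ge> 0"
    and "1 / (real (Suc n) * (1 - x)) - x ^ Suc n / (1 - x ^ Suc n) \<le> 1 / (real n * (1 - x)) - x ^ n / (1 - x ^ n)"
proof -
  define y where "y = sqrt x"
  have y: "0 < y" "y < 1" "x = y\<^sup>2" using assms by (auto simp: y_def)
  define A where "A = (\<lambda>n. \<Sum>i<n. x ^ i)"
  have A: "1 - x ^ n = (1 - x) * A n" for n
    using geometric_sum[of x n] assms by (simp add: A_def field_simps)
  have A_ge: "A n \<ge> real n * y ^ (n - 1)" for n
  proof -
    have "(\<Sum>i<n. x ^ (n - Suc i)) = (\<Sum>i<n. x ^ i)" by (rule sum.nat_diff_reindex)
    then have "2 * A n = (\<Sum>i<n. x ^ i) + (\<Sum>i<n. x ^ (n - Suc i))" by (simp add: A_def)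
    also have "\<dots> = (\<Sum>i<n. x ^ i + x ^ (n - Suc i))" by (simp add: sum.distrib)
    also have "\<dots> \<ge> (\<Sum>i<n. 2 * y ^ (n - 1))"
    proof (rule sum_mono)
      fix i assume i: "i \<in> {..<n}"
      have "0 \<le> (y ^ i - y ^ (n - Suc i))\<^sup>2" by simp
      then have "2 * (y ^ i * y ^ (n - Suc i)) \<le> (y ^ i)\<^sup>2 + (y ^ (n - Suc i))\<^sup>2"
        by (simp add: power2_diff)
      also have "\<dots> = x ^ i + x ^ (n - Suc i)"
        unfolding y(3) by (simp only: power_mult [symmetric] mult.commute)
      finally show "2 * y ^ (n - 1) \<le> x ^ i + x ^ (n - Suc i)"
        using i by (simp flip: power_add)
    qed
    finally show ?thesis by simp
  qed
  have A_pos: "A n > 0" if "n > 0" for n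
    using A_ge[of n] that y by (intro less_le_trans[OF _ A_ge]) auto
  have xn: "x ^ n < 1" "x ^ Suc n < 1" using assms by (auto intro!: power_Suc_less_one simp del: power_Suc simp: power_less_one_iff)
  show "1 / (real n * (1 - x)) - x ^ n / (1 - x ^ n) \<ge> 0"
  proof -
    have "real n * x ^ n \<le> A n"
    proof -
      have "(\<Sum>i<n. x ^ n) \<le> A n" unfolding A_def
        by (intro sum_mono power_decreasing) (use assms in auto)
      then show ?thesis by simp
    qed
    then have "x ^ n / A n \<le> 1 / real n"
      using assms A_pos[of n] by (simp add: field_simps)
    then have "x ^ n / A n / (1 - x) \<le> 1 / real n / (1 - x)"
      using assms by (intro divide_right_mono) auto
    then show ?thesis by (simp add: A mult.commute)
  qed
  have "real n * real (Suc n) * x ^ n \<le> (real n * y ^ (n - 1)) * (real (Suc n) * y ^ n)"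
  proof -
    have "x ^ n = y ^ (2 * n)" by (simp add: y(3) power_mult)
    also have "\<dots> \<le> y ^ (n - 1 + n)" using y by (intro power_decreasing) auto
    finally show ?thesis by (simp add: power_add mult_left_mono mult_ac)
  qed
  also have "\<dots> \<le> A n * A (Suc n)"
    using A_ge[of n] A_ge[of "Suc n"] y by (intro mult_mono) (auto simp: A_def sum_nonneg assms less_imp_le)
  finally have AA: "real n * real (Suc n) * x ^ n \<le> A n * A (Suc n)" .
  have "x ^ n / (1 - x ^ n) - x ^ Suc n / (1 - x ^ Suc n) = x ^ n * (1 - x) / ((1 - x ^ n) * (1 - x ^ Suc n))"
    using xn by (simp add: field_simps)
  also have "\<dots> = x ^ n / ((1 - x) * (A n * A (Suc n)))"
  proof -
    define c where "c = 1 - x"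
    have "c \<noteq> 0" using assms by (simp add: c_def)
    then show ?thesis unfolding A c_def [symmetric] by (simp add: field_simps)
  qed
  also have "\<dots> \<le> 1 / ((1 - x) * (real n * real (Suc n)))"
  proof -
    have "x ^ n / (A n * A (Suc n)) \<le> 1 / (real n * real (Suc n))"
      using AA assms A_pos[of n] A_pos[of "Suc n"] by (simp add: divide_simps mult_ac)
    then have "x ^ n / (A n * A (Suc n)) / (1 - x) \<le> 1 / (real n * real (Suc n)) / (1 - x)"
      using assms by (intro divide_right_mono) auto
    then show ?thesis by (simp only: divide_divide_eq_left mult.commute[of "1 - x"])
  qed
  also have "\<dots> = 1 / (real n * (1 - x)) - 1 / (real (Suc n) * (1 - x))"
    using assms by (simp add: divide_simps)
  finally show "1 / (real (Suc n) * (1 - x)) - x ^ Suc n / (1 - x ^ Suc n) \<le> 1 / (real n * (1 - x)) - x ^ n / (1 - x ^ n)"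
    by linarith
qed

context real_char
begin

text \<open>For monotone weights the total variation telescopes. Decreasing weights occur for the
  Lambert series, increasing ones for the logarithm.\<close>

lemma abel_bound:
  fixes b :: "nat \<Rightarrow> real"
  assumes "(\<forall>n>0. b (Suc n) \<le> b n) \<or> (\<forall>n>0. b n \<le> b (Suc n))"
  shows "\<bar>\<Sum>n=1..N. chi n * b n\<bar> \<le> B * (\<bar>b 1 - b (Suc N)\<bar> + \<bar>b (Suc N)\<bar>)"
proof -
  let ?d = "\<lambda>k. b (Suc k) - b (Suc (Suc k))"
  have tel: "(\<Sum>k<N. ?d k) = b 1 - b (Suc N)"
    using sum_lessThan_telescope'[of "\<lambda>k. b (Suc k)" N] by simp
  have abs_tel: "(\<Sum>k<N. \<bar>?d k\<bar>) = \<bar>\<Sum>k<N. ?d k\<bar>"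
    using assms
  proof
    assume "\<forall>n>0. b (Suc n) \<le> b n"
    then show ?thesis by (simp add: sum_nonneg)
  next
    assume "\<forall>n>0. b n \<le> b (Suc n)"
    then show ?thesis by (simp add: sum_nonpos sum_negf[symmetric])
  qed
  have "\<bar>\<Sum>n=1..N. chi n * b n\<bar> \<le> \<bar>\<Sum>k<N. (\<Sum>n=1..Suc k. chi n) * ?d k\<bar> + \<bar>(\<Sum>n=1..N. chi n) * b (Suc N)\<bar>"
    using abel_summation[where g = b and N = N] by simp
  also have "\<dots> \<le> (\<Sum>k<N. B * \<bar>?d k\<bar>) + B * \<bar>b (Suc N)\<bar>"
    unfolding abs_mult
    by (intro add_mono order.trans[OF sum_abs] sum_mono mult_right_mono char_partial_sums)
       (auto simp: abs_mult intro!: mult_right_mono char_partial_sums[of "Suc _", simplified])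
  also have "(\<Sum>k<N. B * \<bar>?d k\<bar>) = B * \<bar>b 1 - b (Suc N)\<bar>"
    using abs_tel tel by (simp flip: sum_distrib_left)
  finally show ?thesis by (simp add: distrib_left)
qed

text \<open>Expanding each term geometrically and regrouping by n = d k gives the power series of
  the divisor sums of chi. Its coefficients are nonnegative, and only the squares are kept.\<close>

lemma lambert_series_ge:
  assumes x: "0 < x" "x < 1"
  shows "(\<lambda>n. chi n * (x ^ n / (1 - x ^ n))) summable_on {0<..}"
    and "(\<Sum>\<^sub>\<infinity>n\<in>{0<..}. chi n * (x ^ n / (1 - x ^ n))) \<ge> (\<Sum>j=1..M. x ^ j\<^sup>2)"
proof -
  define g where "g = (\<lambda>p. chi (fst p) * x ^ (fst p * snd p))"
  have geo: "((\<lambda>k. x ^ (n * k)) has_sum x ^ n / (1 - x ^ n)) {0<..}" if "n > 0" for n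
  proof -
    have "((\<lambda>k. (x ^ n) ^ k) has_sum x ^ n / (1 - x ^ n)) {1..}"
      by (rule has_sum_geometric_from_1) (use x that in \<open>simp add: power_less_one_iff\<close>)
    moreover have "{1..} = {0::nat<..}" by auto
    ultimately show ?thesis by (simp add: power_mult)
  qed
  have "summable (\<lambda>n. x ^ n / (1 - x))"
    using x by (intro summable_divide) simp
  then have "(\<lambda>n. x ^ n / (1 - x)) summable_on UNIV"
    by (subst summable_on_UNIV_nonneg_real_iff) (use x in auto)
  then have "(\<lambda>n. x ^ n / (1 - x)) summable_on {0<..}"
    by (rule summable_on_subset_banach) simp
  then have dom: "(\<lambda>n. x ^ n / (1 - x ^ n)) summable_on {0<..}"
  proof (rule summable_on_comparison_test)
    fix n :: nat assume "n \<in> {0<..}"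
    then have "x ^ n \<le> x" using x power_decreasing[of 1 n x] by simp
    then show "x ^ n / (1 - x ^ n) \<le> x ^ n / (1 - x)" "0 \<le> x ^ n / (1 - x ^ n)"
      using x by (auto intro!: divide_left_mono mult_pos_pos divide_nonneg_pos)
  qed
  have pow: "(\<lambda>p. x ^ (fst p * snd p)) summable_on {0<..} \<times> {0<..}"
    by (rule summable_on_SigmaI[where g = "\<lambda>n. x ^ n / (1 - x ^ n)"]) (use geo dom x in auto)
  have sm: "g summable_on {0<..} \<times> {0<..}"
  proof (rule abs_summable_summable, rule summable_on_comparison_test[OF pow])
    fix p :: "nat \<times> nat"
    show "norm (g p) \<le> x ^ (fst p * snd p)"
      using x char_abs_le_1[of "fst p"] by (simp add: g_def abs_mult mult_left_le_one_le)
  qed simp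
  show "(\<lambda>n. chi n * (x ^ n / (1 - x ^ n))) summable_on {0<..}"
  proof (rule abs_summable_summable, rule summable_on_comparison_test[OF dom])
    fix n :: nat assume "n \<in> {0<..}"
    have "x ^ n \<le> 1" using x by (simp add: power_le_one)
    then have "x ^ n / (1 - x ^ n) \<ge> 0" using x by simp
    then show "norm (chi n * (x ^ n / (1 - x ^ n))) \<le> x ^ n / (1 - x ^ n)"
      unfolding real_norm_def abs_mult using char_abs_le_1[of n]
      by (simp only: abs_of_nonneg mult_left_le_one_le abs_ge_zero)
  qed simp
  define r where "r = (\<lambda>n. \<Sum>d | d dvd n. chi d)"
  have grp: "(\<Sum>d | d dvd n. g (d, n div d)) = r n * x ^ n" for n
    unfolding r_def sum_distrib_right by (rule sum.cong) (auto simp: g_def)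
  have "(\<Sum>\<^sub>\<infinity>n\<in>{0<..}. chi n * (x ^ n / (1 - x ^ n))) = (\<Sum>\<^sub>\<infinity>a\<in>{0<..}. \<Sum>\<^sub>\<infinity>b\<in>{0<..}. g (a, b))"
  proof (rule infsum_cong)
    fix n :: nat assume "n \<in> {0<..}"
    then have "((\<lambda>k. chi n * x ^ (n * k)) has_sum chi n * (x ^ n / (1 - x ^ n))) {0<..}"
      by (intro has_sum_cmult_right geo) simp
    then show "chi n * (x ^ n / (1 - x ^ n)) = (\<Sum>\<^sub>\<infinity>b\<in>{0<..}. g (n, b))"
      by (simp add: g_def infsumI)
  qed
  also have "\<dots> = (\<Sum>\<^sub>\<infinity>n\<in>{0<..}. r n * x ^ n)"
    using infsum_regroup_divisors(1)[OF sm] by (simp add: grp)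
  also have "\<dots> \<ge> (\<Sum>n\<in>(\<lambda>j. j\<^sup>2) ` {1..M}. r n * x ^ n)"
  proof (rule finite_sum_le_infsum)
    show "(\<lambda>n. r n * x ^ n) summable_on {0<..}"
      using infsum_regroup_divisors(2)[OF sm] by (simp add: grp)
    show "0 \<le> r n * x ^ n" if "n \<in> {0<..} - (\<lambda>j. j\<^sup>2) ` {1..M}" for n
      using that sum_divisors_char_nonneg[of n] x by (auto simp: r_def)
  qed auto
  also have "(\<Sum>n\<in>(\<lambda>j. j\<^sup>2) ` {1..M}. r n * x ^ n) = (\<Sum>j=1..M. r (j\<^sup>2) * x ^ j\<^sup>2)"
    by (subst sum.reindex) (auto simp: inj_on_def)
  also have "\<dots> \<ge> (\<Sum>j=1..M. x ^ j\<^sup>2)"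
  proof (rule sum_mono)
    fix j assume "j \<in> {1..M}"
    then have "1 \<le> r (j\<^sup>2)" unfolding r_def by (intro sum_divisors_char_square) simp
    then show "x ^ j\<^sup>2 \<le> r (j\<^sup>2) * x ^ j\<^sup>2"
      using x mult_right_mono[of 1 "r (j\<^sup>2)" "x ^ j\<^sup>2"] by simp
  qed
  finally show "(\<Sum>\<^sub>\<infinity>n\<in>{0<..}. chi n * (x ^ n / (1 - x ^ n))) \<ge> (\<Sum>j=1..M. x ^ j\<^sup>2)" by simp
qed

text \<open>Monsky's argument: if \<open>L 1 = 0\<close>, the Lambert series \<open>\<Sum> chi n x^n / (1 - x^n)\<close> is bounded
  as \<open>x\<close> tends to 1; but its power series coefficients are nonnegative and at least 1 at squares.\<close>

lemma L_1_nonzero: "L 1 \<noteq> 0"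
proof
  assume "L 1 = 0"
  then have "(\<lambda>N. \<Sum>n=1..N. complex_of_real (chi n) * of_nat n powr - 1) \<longlonglongrightarrow> 0"
    using partial_sums_tendsto_L[of 1] by simp
  also have "(\<lambda>N. \<Sum>n=1..N. complex_of_real (chi n) * of_nat n powr - 1) = (\<lambda>N. of_real (\<Sum>n=1..N. chi n / real n))"
    by (simp add: powr_minus field_simps)
  finally have "(\<lambda>N. complex_of_real (\<Sum>n=1..N. chi n / real n)) \<longlonglongrightarrow> of_real 0" by simp
  then have L1: "(\<lambda>N. \<Sum>n=1..N. chi n / real n) \<longlonglongrightarrow> 0" by (simp only: tendsto_of_real_iff)
  have bound: "(\<Sum>j=1..M. x ^ j\<^sup>2) \<le> B" if x: "0 < x" "x < 1" for x :: real and M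
  proof -
    let ?f = "\<Sum>\<^sub>\<infinity>n\<in>{0<..}. chi n * (x ^ n / (1 - x ^ n))"
    \<comment> \<open>The first term contributes a multiple of the series for L 1, which is assumed
      to vanish. Including it makes the weights decrease from b 1 = 1 to nonnegative values, so
      \<open>abel_bound\<close> gives B independently of x.\<close>
    define b where "b = (\<lambda>n. 1 / (real n * (1 - x)) - x ^ n / (1 - x ^ n))"
    have "((\<lambda>n. chi n * (x ^ n / (1 - x ^ n))) has_sum ?f) {0<..}"
      by (intro has_sum_infsum lambert_series_ge x)
    then have "((\<lambda>n. chi n * (x ^ n / (1 - x ^ n))) has_sum ?f) UNIV"
      by (subst (asm) has_sum_cong_neutral[where T = UNIV]) auto
    then have "(\<lambda>N. \<Sum>n<Suc N. chi n * (x ^ n / (1 - x ^ n))) \<longlonglongrightarrow> ?f"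
      by (intro LIMSEQ_Suc has_sum_imp_sums[unfolded sums_def])
    also have "(\<lambda>N. \<Sum>n<Suc N. chi n * (x ^ n / (1 - x ^ n))) = (\<lambda>N. \<Sum>n=1..N. chi n * (x ^ n / (1 - x ^ n)))"
      by (intro ext sum.mono_neutral_right) (auto simp: Suc_le_eq)
    finally have "(\<lambda>N. (1 / (1 - x)) * (\<Sum>n=1..N. chi n / real n) - (\<Sum>n=1..N. chi n * (x ^ n / (1 - x ^ n))))
       \<longlonglongrightarrow> (1 / (1 - x)) * 0 - ?f"
      by (intro tendsto_intros L1)
    also have "(\<lambda>N. (1 / (1 - x)) * (\<Sum>n=1..N. chi n / real n) - (\<Sum>n=1..N. chi n * (x ^ n / (1 - x ^ n)))) = (\<lambda>N. \<Sum>n=1..N. chi n * b n)"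
      by (simp add: b_def sum_distrib_left right_diff_distrib sum_subtractf mult_ac)
    finally have "(\<lambda>N. \<bar>\<Sum>n=1..N. chi n * b n\<bar>) \<longlonglongrightarrow> \<bar>- ?f\<bar>"
      by (intro tendsto_rabs) simp
    moreover have "\<bar>\<Sum>n=1..N. chi n * b n\<bar> \<le> B" for N
    proof -
      have "b 1 = 1" using x by (simp add: b_def field_simps)
      moreover have "\<bar>\<Sum>n=1..N. chi n * b n\<bar> \<le> B * b 1"
      proof -
        have dec: "b (Suc n) \<le> b n" "b n \<ge> 0" if "n > 0" for n
          unfolding b_def by (intro lambert_coefficient_decreasing x that)+
        have "b (Suc N) \<le> b (Suc 0)"
          by (rule lift_Suc_antimono_le[of "\<lambda>n. b (Suc n)"]) (auto intro: dec)
        then show ?thesis using abel_bound[of b N] dec by simp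
      qed
      ultimately show ?thesis by simp
    qed
    ultimately have "\<bar>?f\<bar> \<le> B"
      by (intro LIMSEQ_le_const2[where a = B]) auto
    then show ?thesis using lambert_series_ge(2)[OF x, of M] by linarith
  qed
  \<comment> \<open>A finite sum of M powers tends to M as x tends to 1, while \<open>bound\<close>
    keeps it below B.\<close>
  obtain M :: nat where M: "real M > B" using reals_Archimedean2 by blast
  have "((\<lambda>x. \<Sum>j=1..M. x ^ j\<^sup>2) \<longlongrightarrow> (\<Sum>j=1..M. 1 ^ j\<^sup>2)) (at_left (1::real))"
    by (intro tendsto_intros)
  then have "((\<lambda>x::real. \<Sum>j=1..M. x ^ j\<^sup>2) \<longlongrightarrow> real M) (at_left 1)" by simp
  moreover have "\<forall>\<^sub>F x in at_left (1::real). (\<Sum>j=1..M. x ^ j\<^sup>2) \<le> B"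
    by (rule eventually_mono[OF eventually_at_left_real[of 0 "1::real"]]) (simp_all only: greaterThanLessThan_iff bound zero_less_one)
  ultimately have "real M \<le> B" by (intro tendsto_upperbound) auto
  then show False using M by simp
qed

lemma L_nonzero:
  assumes "Re s \<ge> 1"
  shows "L s \<noteq> 0"
proof (cases "Re s > 1")
  case True
  then show ?thesis using dirichlet_series_nonzero L_eq_dirichlet_series by auto
next
  case False
  with assms have "s = Complex 1 (Im s)" by (simp add: complex_eq_iff)
  then show ?thesis
    using L_nonzero_off_real_axis[of "Im s"] L_1_nonzero one_complex.code by (cases "Im s = 0") metis+
qed

theorem moebius_char_mean_zero:
  "(\<lambda>N. (\<Sum>n=1..N. moebius_mu n * chi n) / real N) \<longlonglongrightarrow> 0"
proof (rule dirichlet_series_tauberian[where H = "\<lambda>s. 1 / L s"])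
  show "\<bar>moebius_mu n * chi n\<bar> \<le> 1" for n
    using char_abs_le_1[of n] moebius_abs_le[of n] by (simp add: abs_mult mult_le_one)
  show "(\<Sum>n. of_real (moebius_mu n * chi n) * of_nat n powr - s) = 1 / L s" if "Re s > 1" for s
  proof -
    have "dirichlet_series (\<lambda>n. moebius_mu n * chi n) s = 1 / L s"
      using dirichlet_series_moebius[OF that] L_nonzero[of s] that
      by (simp add: L_eq_dirichlet_series field_simps)
    then show ?thesis by (simp only: dirichlet_series_def)
  qed
  have "continuous_on {s. Re s \<ge> 1} L"
    by (rule continuous_on_subset[OF holomorphic_on_imp_continuous_on[OF L_holomorphic]]) auto
  then show "continuous_on {s. Re s \<ge> 1} (\<lambda>s. 1 / L s)"
    by (intro continuous_intros) (auto simp: L_nonzero)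
qed

end

section \<open>From the Moebius function to the von Mangoldt function\<close>

lemma sum_divisors_swap:
  fixes F :: "nat \<Rightarrow> nat \<Rightarrow> 'a :: comm_monoid_add"
  assumes "n > 0"
  shows "(\<Sum>d | d dvd n. \<Sum>e | e dvd n div d. F d e) = (\<Sum>e | e dvd n. \<Sum>d | d dvd n div e. F d e)"
proof -
  have iff: "d dvd n \<and> e dvd n div d \<longleftrightarrow> e dvd n \<and> d dvd n div e" for d e
    using assms by (metis dvd_div_iff_mult dvd_mult_left dvd_mult_right mult.commute not_gr_zero dvd_0_left)
  have fin: "finite {d. d dvd n}" using assms by simp
  have fin': "finite {e. e dvd n div d}" if "d \<in> {d. d dvd n}" for d
    using that assms by (auto simp: dvd_div_eq_0_iff)
  have "(\<Sum>d | d dvd n. \<Sum>e | e dvd n div d. F d e) = (\<Sum>(d, e)\<in>(SIGMA d:{d. d dvd n}. {e. e dvd n div d}). F d e)"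
    using fin fin' by (intro sum.Sigma) auto
  also have "\<dots> = (\<Sum>(e, d)\<in>(SIGMA e:{e. e dvd n}. {d. d dvd n div e}). F d e)"
    by (rule sum.reindex_bij_witness[where i = "\<lambda>(e, d). (d, e)" and j = "\<lambda>(d, e). (e, d)"]) (use iff in auto)
  also have "\<dots> = (\<Sum>e | e dvd n. \<Sum>d | d dvd n div e. F d e)"
    using fin fin' by (intro sum.Sigma[symmetric]) auto
  finally show ?thesis .
qed

text \<open>As convolutions: ln = \<Lambda> * 1, hence \<mu> * ln = \<Lambda> * (\<mu> * 1) =
  \<Lambda>.\<close>

lemma moebius_inversion_mangoldt:
  assumes "n > 0"
  shows "(\<Sum>d | d dvd n. moebius_mu d * ln (real (n div d))) = mangoldt n"
proof -
  have "(\<Sum>d | d dvd n. moebius_mu d * ln (real (n div d))) = (\<Sum>d | d dvd n. \<Sum>e | e dvd n div d. moebius_mu d * mangoldt e)"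
  proof (rule sum.cong)
    fix d assume "d \<in> {d. d dvd n}"
    then have "n div d \<noteq> 0" using assms by (auto simp: dvd_div_eq_0_iff)
    then show "moebius_mu d * ln (real (n div d)) = (\<Sum>e | e dvd n div d. moebius_mu d * mangoldt e)"
      using mangoldt_sum[of "n div d", where ?'a = real] by (simp flip: sum_distrib_left)
  qed simp
  also have "\<dots> = (\<Sum>e | e dvd n. \<Sum>d | d dvd n div e. moebius_mu d * mangoldt e)"
    using assms by (rule sum_divisors_swap)
  also have "\<dots> = (\<Sum>e | e dvd n. if e = n then mangoldt n else 0)"
  proof (rule sum.cong)
    fix e assume e: "e \<in> {e. e dvd n}"
    then have "n div e > 0" using assms by (auto intro: Nat.gr0I simp: dvd_div_eq_0_iff)
    moreover have "n div e = 1 \<longleftrightarrow> e = n" using e assms by (auto elim!: dvdE)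
    ultimately show "(\<Sum>d | d dvd n div e. moebius_mu d * mangoldt e) = (if e = n then mangoldt n else 0)"
      by (simp add: sum_moebius_divisors flip: sum_distrib_right)
  qed simp
  also have "\<dots> = mangoldt n" using assms by (subst sum.delta) auto
  finally show ?thesis .
qed

text \<open>Both sides run over the lattice points d e \<le> N under the hyperbola.\<close>

lemma sum_divisors_upto:
  fixes F :: "nat \<Rightarrow> nat \<Rightarrow> 'a :: comm_monoid_add"
  shows "(\<Sum>n=1..N. \<Sum>d | d dvd n. F d (n div d)) = (\<Sum>d=1..N. \<Sum>e=1..N div d. F d e)"
proof -
  have "(\<Sum>n=1..N. \<Sum>d | d dvd n. F d (n div d)) = (\<Sum>(n, d)\<in>(SIGMA n:{1..N}. {d. d dvd n}). F d (n div d))"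
    by (intro sum.Sigma) auto
  also have "\<dots> = (\<Sum>(d, e)\<in>(SIGMA d:{1..N}. {1..N div d}). F d e)"
  proof (rule sum.reindex_bij_witness[where i = "\<lambda>(d, e). (d * e, d)" and j = "\<lambda>(n, d). (d, n div d)"])
    fix p assume "p \<in> (SIGMA n:{1..N}. {d. d dvd n})"
    then obtain d e where p: "p = (d * e, d)" "1 \<le> d * e" "d * e \<le> N" by (auto elim!: dvdE)
    then have de: "d > 0" "e > 0" by auto
    have "d \<le> d * e" using de by simp
    then have "d \<le> N" using p(3) by linarith
    moreover have "e \<le> N div d" using p(3) de by (simp add: less_eq_div_iff_mult_less_eq mult.commute)
    ultimately show "(case p of (n, d) \<Rightarrow> (d, n div d)) \<in> (SIGMA d:{1..N}. {1..N div d})" using p de by simp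
    show "(case case p of (n, d) \<Rightarrow> (d, n div d) of (d, e) \<Rightarrow> (d * e, d)) = p" using p de by simp
    show "(case case p of (n, d) \<Rightarrow> (d, n div d) of (d, e) \<Rightarrow> F d e) = (case p of (n, d) \<Rightarrow> F d (n div d))"
      by (simp add: case_prod_unfold)
  next
    fix p assume "p \<in> (SIGMA d:{1..N}. {1..N div d})"
    then obtain d e where p: "p = (d, e)" "d > 0" "e > 0" "e \<le> N div d" by auto
    then have "d * e \<le> N" by (simp add: less_eq_div_iff_mult_less_eq mult.commute)
    then show "(case p of (d, e) \<Rightarrow> (d * e, d)) \<in> (SIGMA n:{1..N}. {d. d dvd n})" using p by simp
    show "(case case p of (d, e) \<Rightarrow> (d * e, d) of (n, d) \<Rightarrow> (d, n div d)) = p" using p by simp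
  qed
  also have "\<dots> = (\<Sum>d=1..N. \<Sum>e=1..N div d. F d e)" by (intro sum.Sigma[symmetric]) auto
  finally show ?thesis .
qed

text \<open>From 1 + x \<le> (1 + sqrt x)^2. Trading logarithms for square roots turns later error
  sums into sums of 1 / sqrt a.\<close>

lemma ln_le_2_sqrt: "ln (1 + x) \<le> 2 * sqrt x" if "x \<ge> 0"
proof -
  have "ln (1 + x) \<le> ln ((1 + sqrt x)\<^sup>2)"
    using that by (subst ln_le_cancel_iff) (auto simp: power2_eq_square algebra_simps add_pos_nonneg add_nonneg_pos)
  also have "\<dots> = 2 * ln (1 + sqrt x)" using that by (simp add: ln_realpow add_pos_nonneg)
  also have "\<dots> \<le> 2 * sqrt x" using that ln_add_one_self_le_self[of "sqrt x"] by simp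
  finally show ?thesis .
qed

lemma mean_zero_div:
  fixes f :: "nat \<Rightarrow> real"
  assumes "(\<lambda>N. f N / real N) \<longlonglongrightarrow> 0" "b > 0"
  shows "(\<lambda>N. f (N div b) / real N) \<longlonglongrightarrow> 0"
proof -
  have "(\<lambda>N. f (N div b) / real (N div b)) \<longlonglongrightarrow> 0"
    using assms(1) by (rule filterlim_compose) (intro filterlim_at_top_div_const_nat assms(2))
  then show ?thesis
  proof (rule Lim_null_comparison[rotated, OF tendsto_norm_zero])
    have "\<forall>\<^sub>F N in sequentially. N \<ge> b" by (rule eventually_ge_at_top)
    then show "\<forall>\<^sub>F N in sequentially. norm (f (N div b) / real N) \<le> norm (f (N div b) / real (N div b))"
    proof eventually_elim
      case (elim N)
      then have "N div b > 0" "N > 0" "real (N div b) \<le> real N" using assms(2) by (auto simp: div_greater_zero_iff)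
      then show ?case unfolding norm_divide norm_of_nat
        by (intro divide_left_mono mult_pos_pos norm_ge_zero) (simp_all only: of_nat_0_less_iff)
    qed
  qed
qed

lemma sum_atLeastAtMost_split:
  fixes f :: "nat \<Rightarrow> 'a :: comm_monoid_add"
  assumes "M \<le> N"
  shows "(\<Sum>n=1..N. f n) = (\<Sum>n=1..M. f n) + (\<Sum>n\<in>{M<..N}. f n)"
proof -
  have "{1..N} = {1..M} \<union> {M<..N}" using assms by auto
  then show ?thesis by (simp only:) (rule sum.union_disjoint; auto)
qed

lemma sum_inverse_sqrt_le: "(\<Sum>a=1..A. 1 / sqrt (real a)) \<le> 2 * sqrt (real A)"
proof (induction A)
  case (Suc A)
  have "1 / sqrt (real (Suc A)) \<le> 2 * (sqrt (real (Suc A)) - sqrt (real A))"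
  proof -
    have "1 = (sqrt (real (Suc A)) - sqrt (real A)) * (sqrt (real (Suc A)) + sqrt (real A))"
      by (simp add: algebra_simps)
    also have "\<dots> \<le> (sqrt (real (Suc A)) - sqrt (real A)) * (2 * sqrt (real (Suc A)))"
      by (intro mult_left_mono) auto
    finally show ?thesis by (simp add: field_simps)
  qed
  then show ?case using Suc by simp
qed simp

section \<open>The hyperbola method for a real character\<close>

context real_char
begin

lemma char_ln_sum_bound: "\<bar>\<Sum>b=1..y. chi b * ln (real b)\<bar> \<le> 2 * B * ln (1 + real y)"
  using abel_bound[of "\<lambda>n. ln (real n)" y] by simp

text \<open>Dirichlet's hyperbola method for \<open>\<Lambda> = \<mu> * ln\<close>, cut at \<open>b = K\<close>.\<close>

lemma psi_char_hyperbola: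
  fixes K N :: nat
  assumes K: "K > 0"
  shows "\<bar>\<Sum>n=1..N. chi n * mangoldt n\<bar> \<le>
    (\<Sum>b=1..K. ln (real b) * \<bar>\<Sum>a=1..N div b. moebius_mu a * chi a\<bar>) + 16 * B * real N / sqrt (real K)"
proof -
  define U where "U = (\<lambda>y::nat. \<Sum>b=1..y. chi b * ln (real b))"
  define m where "m = (\<lambda>a. moebius_mu a * chi a)"
  have m: "\<bar>m a\<bar> \<le> 1" for a
    using char_abs_le_1[of a] moebius_abs_le[of a] by (simp add: m_def abs_mult mult_le_one)
  have "(\<Sum>n=1..N. chi n * mangoldt n) = (\<Sum>n=1..N. \<Sum>d | d dvd n. m d * (chi (n div d) * ln (real (n div d))))"
  proof (rule sum.cong)
    fix n assume n: "n \<in> {1..N}"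
    then have "chi n * mangoldt n = (\<Sum>d | d dvd n. chi n * (moebius_mu d * ln (real (n div d))))"
      using moebius_inversion_mangoldt[of n] by (simp flip: sum_distrib_left)
    also have "\<dots> = (\<Sum>d | d dvd n. m d * (chi (n div d) * ln (real (n div d))))"
    proof (rule sum.cong)
      fix d assume "d \<in> {d. d dvd n}"
      then have "chi n = chi d * chi (n div d)" by (simp flip: char_mult)
      then show "chi n * (moebius_mu d * ln (real (n div d))) = m d * (chi (n div d) * ln (real (n div d)))"
        by (simp add: m_def)
    qed simp
    finally show "chi n * mangoldt n = (\<Sum>d | d dvd n. m d * (chi (n div d) * ln (real (n div d))))" .
  qed simp
  also have "\<dots> = (\<Sum>a=1..N. \<Sum>b=1..N div a. m a * (chi b * ln (real b)))"
    by (rule sum_divisors_upto)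
  also have "\<dots> = (\<Sum>a=1..N. m a * U (N div a))" by (simp add: U_def sum_distrib_left)
  \<comment> \<open>Truncating \<open>U\<close> at K isolates the pairs with b \<le> K. There the
    order of summation is swapped, so that \<open>m\<close> is summed over a long range; the
    remainder involves only a \<le> N div K.\<close>
  also have "\<dots> = (\<Sum>a=1..N. m a * U (min (N div a) K)) + (\<Sum>a=1..N. m a * (U (N div a) - U (min (N div a) K)))"
    by (simp add: algebra_simps flip: sum.distrib)
  finally have eq: "(\<Sum>n=1..N. chi n * mangoldt n) = (\<Sum>a=1..N. m a * U (min (N div a) K)) + (\<Sum>a=1..N. m a * (U (N div a) - U (min (N div a) K)))" .
  have "(\<Sum>a=1..N. m a * U (min (N div a) K)) = (\<Sum>a=1..N. \<Sum>b=1..K. if b \<le> N div a then m a * (chi b * ln (real b)) else 0)"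
  proof (rule sum.cong)
    fix a
    have "m a * U (min (N div a) K) = (\<Sum>b\<in>{b\<in>{1..K}. b \<le> N div a}. m a * (chi b * ln (real b)))"
      unfolding U_def sum_distrib_left by (rule sum.cong) auto
    then show "m a * U (min (N div a) K) = (\<Sum>b=1..K. if b \<le> N div a then m a * (chi b * ln (real b)) else 0)"
      by (subst (asm) sum.inter_filter) auto
  qed simp
  also have "\<dots> = (\<Sum>b=1..K. \<Sum>a=1..N. if b \<le> N div a then m a * (chi b * ln (real b)) else 0)"
    by (rule sum.swap)
  also have "\<dots> = (\<Sum>b=1..K. (chi b * ln (real b)) * (\<Sum>a=1..N div b. m a))"
  proof (rule sum.cong)
    fix b assume b: "b \<in> {1..K}"
    have "{a\<in>{1..N}. b \<le> N div a} = {1..N div b}"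
    proof (rule subset_antisym; rule subsetI)
      fix a assume "a \<in> {a\<in>{1..N}. b \<le> N div a}"
      then show "a \<in> {1..N div b}" using b by (auto simp: less_eq_div_iff_mult_less_eq mult.commute)
    next
      fix a assume a: "a \<in> {1..N div b}"
      then have "a * b \<le> N" using b by (simp add: less_eq_div_iff_mult_less_eq)
      moreover have "a \<le> a * b" using b by simp
      ultimately have "a \<le> N" by linarith
      with a \<open>a * b \<le> N\<close> show "a \<in> {a\<in>{1..N}. b \<le> N div a}"
        by (auto simp: less_eq_div_iff_mult_less_eq mult.commute)
    qed
    then have "(\<Sum>a=1..N div b. m a * (chi b * ln (real b))) = (\<Sum>a=1..N. if b \<le> N div a then m a * (chi b * ln (real b)) else 0)"
      by (simp only: sum.inter_filter [symmetric] finite_atLeastAtMost)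
    then show "(\<Sum>a=1..N. if b \<le> N div a then m a * (chi b * ln (real b)) else 0) = (chi b * ln (real b)) * (\<Sum>a=1..N div b. m a)"
      by (simp add: sum_distrib_left mult_ac)
  qed simp
  also have "\<bar>\<dots>\<bar> \<le> (\<Sum>b=1..K. ln (real b) * \<bar>\<Sum>a=1..N div b. m a\<bar>)"
  proof (rule order.trans[OF sum_abs sum_mono])
    fix b assume "b \<in> {1..K}"
    then have "ln (real b) \<ge> 0" by simp
    then have "\<bar>chi b * ln (real b)\<bar> \<le> ln (real b)"
      using char_abs_le_1[of b] by (simp add: abs_mult mult_left_le_one_le)
    then show "\<bar>chi b * ln (real b) * (\<Sum>a=1..N div b. m a)\<bar> \<le> ln (real b) * \<bar>\<Sum>a=1..N div b. m a\<bar>"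
      unfolding abs_mult[of "chi b * ln (real b)"] by (rule mult_right_mono) simp
  qed
  finally have part1: "\<bar>\<Sum>a=1..N. m a * U (min (N div a) K)\<bar> \<le> (\<Sum>b=1..K. ln (real b) * \<bar>\<Sum>a=1..N div b. m a\<bar>)" .
  \<comment> \<open>Here cancellation comes from chi, not from \<open>m\<close>: each of two values
    of \<open>U\<close> is at most 2 B ln (1 + N div a), and \<open>ln_le_2_sqrt\<close> doubles the
    total 4 B to 8 B.\<close>
  have term2: "\<bar>m a * (U (N div a) - U (min (N div a) K))\<bar> \<le> (if a \<le> N div K then 8 * B * sqrt (real N) * (1 / sqrt (real a)) else 0)"
    if a: "a \<in> {1..N}" for a
  proof (cases "N div a \<le> K")
    case True
    then show ?thesis using B_ge_1 by (auto simp: min_def intro!: mult_nonneg_nonneg divide_nonneg_nonneg)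
  next
    case False
    then have "K \<le> N div a" by simp
    then have "K * a \<le> N" using a by (simp add: less_eq_div_iff_mult_less_eq)
    then have le: "a \<le> N div K" using K by (simp add: less_eq_div_iff_mult_less_eq mult.commute)
    have "\<bar>U (N div a) - U K\<bar> \<le> 2 * B * ln (1 + real (N div a)) + 2 * B * ln (1 + real K)"
      using char_ln_sum_bound[of "N div a"] char_ln_sum_bound[of K] by (simp add: U_def)
    also have "2 * B * ln (1 + real K) \<le> 2 * B * ln (1 + real (N div a))"
      using False B_ge_1 by (intro mult_left_mono) auto
    also have "2 * B * ln (1 + real (N div a)) + 2 * B * ln (1 + real (N div a)) = 4 * B * ln (1 + real (N div a))" by simp
    also have "\<dots> \<le> 4 * B * (2 * sqrt (real (N div a)))"
      using B_ge_1 by (intro mult_left_mono ln_le_2_sqrt) auto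
    also have "sqrt (real (N div a)) \<le> sqrt (real N / real a)"
      by (simp add: of_nat_div_le_of_nat)
    then have "4 * B * (2 * sqrt (real (N div a))) \<le> 4 * B * (2 * (sqrt (real N / real a)))"
      using B_ge_1 by (intro mult_left_mono) auto
    also have "\<dots> = 8 * B * sqrt (real N) * (1 / sqrt (real a))"
      by (simp add: real_sqrt_divide)
    finally have "\<bar>U (N div a) - U K\<bar> \<le> 8 * B * sqrt (real N) * (1 / sqrt (real a))" by simp
    moreover have "\<bar>m a * (U (N div a) - U K)\<bar> \<le> \<bar>U (N div a) - U K\<bar>"
      using m[of a] by (simp add: abs_mult mult_left_le_one_le)
    ultimately show ?thesis using False le by (simp add: min_def)
  qed
  have "\<bar>\<Sum>a=1..N. m a * (U (N div a) - U (min (N div a) K))\<bar> \<le> (\<Sum>a=1..N. if a \<le> N div K then 8 * B * sqrt (real N) * (1 / sqrt (real a)) else 0)"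
    by (rule order.trans[OF sum_abs sum_mono]) (rule term2)
  also have "\<dots> = (\<Sum>a\<in>{a\<in>{1..N}. a \<le> N div K}. 8 * B * sqrt (real N) * (1 / sqrt (real a)))"
    by (rule sum.inter_filter[symmetric]) simp
  also have "{a\<in>{1..N}. a \<le> N div K} = {1..N div K}"
    using order.trans[OF _ div_le_dividend[of N K]] by auto
  also have "(\<Sum>a=1..N div K. 8 * B * sqrt (real N) * (1 / sqrt (real a))) = 8 * B * sqrt (real N) * (\<Sum>a=1..N div K. 1 / sqrt (real a))"
    by (rule sum_distrib_left[symmetric])
  also have "\<dots> \<le> 8 * B * sqrt (real N) * (2 * sqrt (real N / real K))"
  proof (rule mult_left_mono)
    have "sqrt (real (N div K)) \<le> sqrt (real N / real K)" by (simp add: of_nat_div_le_of_nat)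
    then show "(\<Sum>a=1..N div K. 1 / sqrt (real a)) \<le> 2 * sqrt (real N / real K)"
      using sum_inverse_sqrt_le[of "N div K"] by linarith
  qed (use B_ge_1 in auto)
  also have "\<dots> = 16 * B * real N / sqrt (real K)"
    by (simp add: real_sqrt_divide flip: real_sqrt_mult)
  finally have part2: "\<bar>\<Sum>a=1..N. m a * (U (N div a) - U (min (N div a) K))\<bar> \<le> 16 * B * real N / sqrt (real K)" .
  show ?thesis unfolding eq using part1 part2 by (simp add: m_def)
qed

text \<open>K is fixed first, large enough that the error 16 B / sqrt K is below e / 2. The other
  term then consists of finitely many Moebius sums, each o(N).\<close>

theorem psi_char_mean_zero:
  "(\<lambda>N. (\<Sum>n=1..N. chi n * mangoldt n) / real N) \<longlonglongrightarrow> 0"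
proof (rule tendstoI)
  fix e :: real assume e: "e > 0"
  obtain K :: nat where K: "real K > (32 * B / e)\<^sup>2" using reals_Archimedean2 by blast
  then have K0: "K > 0" by (intro Nat.gr0I) auto
  have "32 * B / e < sqrt (real K)" using K by (intro real_less_rsqrt)
  then have K': "16 * B / sqrt (real K) < e / 2" using e K0 by (simp add: field_simps)
  define g where "g = (\<lambda>N. \<Sum>b=1..K. ln (real b) * (\<bar>\<Sum>a=1..N div b. moebius_mu a * chi a\<bar> / real N))"
  have "g \<longlonglongrightarrow> (\<Sum>b=1..K. ln (real b) * 0)"
    unfolding g_def
  proof (intro tendsto_sum tendsto_mult tendsto_const)
    fix b assume b: "b \<in> {1..K}"
    then have "(\<lambda>N. (\<Sum>a=1..N div b. moebius_mu a * chi a) / real N) \<longlonglongrightarrow> 0"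
      by (intro mean_zero_div[OF moebius_char_mean_zero]) auto
    from tendsto_rabs[OF this] show "(\<lambda>N. \<bar>\<Sum>a=1..N div b. moebius_mu a * chi a\<bar> / real N) \<longlonglongrightarrow> 0"
      by simp
  qed
  then have "g \<longlonglongrightarrow> 0" by simp
  then have "\<forall>\<^sub>F N in sequentially. dist (g N) 0 < e / 2" using e by (intro tendstoD) auto
  then show "\<forall>\<^sub>F N in sequentially. dist ((\<Sum>n=1..N. chi n * mangoldt n) / real N) 0 < e"
    using eventually_gt_at_top[of 0]
  proof eventually_elim
    case (elim N)
    have "\<bar>\<Sum>n=1..N. chi n * mangoldt n\<bar> / real N \<le> ((\<Sum>b=1..K. ln (real b) * \<bar>\<Sum>a=1..N div b. moebius_mu a * chi a\<bar>) + 16 * B * real N / sqrt (real K)) / real N"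
      by (intro divide_right_mono psi_char_hyperbola K0) auto
    also have "\<dots> = g N + 16 * B / sqrt (real K)"
      using elim by (simp add: g_def add_divide_distrib sum_divide_distrib)
    also have "\<dots> < e" using elim K' by simp
    finally show ?case by simp
  qed
qed

end

section \<open>Chebyshev estimates\<close>

definition chebyshev_psi :: "nat \<Rightarrow> real" where
  "chebyshev_psi N = (\<Sum>n=1..N. mangoldt n)"

lemma ln_fact_eq_sum_mangoldt: "ln (fact N) = (\<Sum>d=1..N. mangoldt d * real (N div d))"
proof -
  have "ln (fact N :: real) = (\<Sum>n=1..N. ln (real n))"
    unfolding fact_prod of_nat_prod by (subst ln_prod) auto
  also have "\<dots> = (\<Sum>n=1..N. \<Sum>d | d dvd n. mangoldt d)"
    by (intro sum.cong refl) (simp add: mangoldt_sum)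
  also have "\<dots> = (\<Sum>d=1..N. \<Sum>e=1..N div d. mangoldt d)"
    by (rule sum_divisors_upto)
  finally show ?thesis by (simp add: mult.commute)
qed

text \<open>With q = N div d the coefficient is q - 2 (q div 2), the parity of q.\<close>

lemma ln_central_fact_eq_sum_mangoldt:
  "ln (fact N) - 2 * ln (fact (N div 2)) = (\<Sum>d=1..N. mangoldt d * real (N div d mod 2))"
proof -
  have "(\<Sum>d=1..N div 2. mangoldt d * real (N div 2 div d)) = (\<Sum>d=1..N. mangoldt d * real (N div 2 div d) :: real)"
    by (rule sum.mono_neutral_left) (auto simp: div_less not_le)
  then have "ln (fact N) - 2 * ln (fact (N div 2)) = (\<Sum>d=1..N. mangoldt d * (real (N div d) - 2 * real (N div 2 div d)))"
    by (simp add: ln_fact_eq_sum_mangoldt algebra_simps sum_subtractf sum_distrib_left)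
  also have "\<dots> = (\<Sum>d=1..N. mangoldt d * real (N div d mod 2))"
  proof (rule sum.cong)
    fix d
    have "N div 2 div d = N div d div 2" by (simp add: div_mult2_eq[symmetric] mult.commute)
    moreover have "real (N div d) = 2 * real (N div d div 2) + real (N div d mod 2)"
      using mult_div_mod_eq[of 2 "N div d"] by (metis of_nat_add of_nat_mult of_nat_numeral)
    ultimately show "mangoldt d * (real (N div d) - 2 * real (N div 2 div d)) = mangoldt d * real (N div d mod 2)"
      by simp
  qed simp
  finally show ?thesis .
qed

lemma chebyshev_psi_diff: "M \<le> N \<Longrightarrow> chebyshev_psi N - chebyshev_psi M = (\<Sum>d\<in>{M<..N}. mangoldt d)"
  unfolding chebyshev_psi_def by (subst sum_atLeastAtMost_split) auto

text \<open>For N/2 < d \<le> N the quotient N div d is 1, so these d occur with full weight in the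
  parity sum, whose other terms are nonnegative.\<close>

lemma chebyshev_psi_half_le: "chebyshev_psi N - chebyshev_psi (N div 2) \<le> ln (fact N) - 2 * ln (fact (N div 2))"
proof -
  have "(\<Sum>d\<in>{N div 2<..N}. mangoldt d) = (\<Sum>d\<in>{N div 2<..N}. mangoldt d * real (N div d mod 2))"
  proof (rule sum.cong)
    fix d assume d: "d \<in> {N div 2<..N}"
    then have "N div d = 1" by (intro div_nat_eqI) auto
    then show "mangoldt d = mangoldt d * real (N div d mod 2)" by simp
  qed simp
  also have "\<dots> \<le> (\<Sum>d=1..N. mangoldt d * real (N div d mod 2))"
    by (rule sum_mono2) (auto simp: mangoldt_nonneg)
  finally show ?thesis by (simp add: ln_central_fact_eq_sum_mangoldt chebyshev_psi_diff)
qed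

text \<open>For N/3 < d \<le> N/2 the quotient N div d is 2, so these d drop out of the parity sum;
  all others count at most once.\<close>

lemma chebyshev_psi_half_ge: "ln (fact N) - 2 * ln (fact (N div 2)) \<le> chebyshev_psi N - chebyshev_psi (N div 2) + chebyshev_psi (N div 3)"
proof -
  have "(\<Sum>d=1..N. mangoldt d * real (N div d mod 2)) \<le> (\<Sum>d\<in>{N div 2<..N} \<union> {1..N div 3}. mangoldt d)"
  proof -
    have "(\<Sum>d=1..N. mangoldt d * real (N div d mod 2)) = (\<Sum>d\<in>{N div 2<..N} \<union> {1..N div 3}. mangoldt d * real (N div d mod 2))"
    proof (rule sum.mono_neutral_right)
      show "\<forall>d\<in>{1..N} - ({N div 2<..N} \<union> {1..N div 3}). mangoldt d * real (N div d mod 2) = 0"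
      proof
        fix d assume "d \<in> {1..N} - ({N div 2<..N} \<union> {1..N div 3})"
        then have "N div d = 2" by (intro div_nat_eqI) auto
        then show "mangoldt d * real (N div d mod 2) = 0" by simp
      qed
    qed auto
    also have "\<dots> \<le> (\<Sum>d\<in>{N div 2<..N} \<union> {1..N div 3}. mangoldt d)"
    proof (rule sum_mono)
      fix d
      have "real (N div d mod 2) \<le> 1" by simp
      then show "mangoldt d * real (N div d mod 2) \<le> mangoldt d"
        using mangoldt_nonneg[of d] by (simp only: mult_left_le)
    qed
    finally show ?thesis .
  qed
  also have "\<dots> = (\<Sum>d\<in>{N div 2<..N}. mangoldt d) + (\<Sum>d=1..N div 3. mangoldt d)"
    by (rule sum.union_disjoint) auto
  also have "(\<Sum>d\<in>{N div 2<..N}. mangoldt d) = chebyshev_psi N - chebyshev_psi (N div 2)"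
    by (rule chebyshev_psi_diff[symmetric]) simp
  also have "(\<Sum>d=1..N div 3. mangoldt d) = chebyshev_psi (N div 3)" by (simp add: chebyshev_psi_def)
  finally show ?thesis by (simp only: ln_central_fact_eq_sum_mangoldt)
qed

lemma ln_central_fact_bounds:
  assumes "N \<ge> 2"
  shows "ln (fact N) - 2 * ln (fact (N div 2)) \<le> real N * ln 2 + ln (real N)"
    and "ln (fact N) - 2 * ln (fact (N div 2)) \<ge> (real N - 1) * ln 2 - ln (real N)"
proof -
  define m where "m = N div 2"
  have m: "m > 0" using assms by (simp add: m_def)
  \<comment> \<open>For odd N = 2m + 1 the factorial has one more factor N beyond (2m)!. Its
    logarithm is the error term.\<close>
  define c where "c = (if even N then 1 else real N)"
  have c: "1 \<le> c" "c \<le> real N" using assms by (auto simp: c_def)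
  have N: "real N = 2 * real m + (if even N then 0 else 1)"
    unfolding m_def by (auto simp: real_of_nat_div elim: oddE)
  have "fact m * fact (2 * m - m) * (2 * m choose m) = (fact (2 * m) :: nat)"
    by (rule binomial_fact_lemma) simp
  then have "real (fact m * fact m * (2 * m choose m)) = real (fact (2 * m))" by simp
  then have fact_2m: "fact (2 * m) = real (2 * m choose m) * fact m * fact m"
    by (simp only: of_nat_mult of_nat_fact mult_ac)
  have "fact N = real (2 * m choose m) * fact m * fact m * c"
  proof (cases "even N")
    case True
    then have "N = 2 * m" by (simp add: m_def)
    then show ?thesis unfolding c_def using True fact_2m by simp
  next
    case False
    then have *: "N = Suc (2 * m)" by (simp add: m_def)
    have "fact N = real N * fact (2 * m)" unfolding * by (simp only: fact_Suc)
    then show ?thesis unfolding c_def using False fact_2m by simp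
  qed
  then have eq: "ln (fact N) - 2 * ln (fact m) = ln (real (2 * m choose m)) + ln c"
    using c by (simp add: ln_mult)
  have "real (2 * m choose m) \<le> 4 ^ m"
  proof -
    have "real (2 * m choose m) \<le> real (2 ^ (2 * m))"
      by (subst of_nat_le_iff) (rule binomial_le_pow2)
    then show ?thesis by (simp add: power_mult)
  qed
  then have "ln (real (2 * m choose m)) \<le> ln (4 ^ m)" by (subst ln_le_cancel_iff) auto
  also have ln4: "ln (4 ^ m) = 2 * real m * ln 2"
  proof -
    have "(4 :: real) ^ m = 2 ^ (2 * m)" by (simp add: power_mult)
    then have "ln ((4 :: real) ^ m) = real (2 * m) * ln 2" by (simp only: ln_realpow zero_less_numeral)
    then show ?thesis by simp
  qed
  also have "2 * real m * ln 2 \<le> real N * ln 2" using N by (intro mult_right_mono) auto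
  finally have up: "ln (real (2 * m choose m)) \<le> real N * ln 2" .
  have "ln c \<le> ln (real N)" using c by (subst ln_le_cancel_iff) auto
  with up eq show "ln (fact N) - 2 * ln (fact (N div 2)) \<le> real N * ln 2 + ln (real N)"
    by (simp add: m_def)
  have "(real N - 1) * ln 2 \<le> 2 * real m * ln 2" using N by (intro mult_right_mono) auto
  then have "(real N - 1) * ln 2 - ln (real N) \<le> ln (4 ^ m) - ln (2 * real m)"
    using N m ln4 by (intro diff_mono) (auto simp del: ln_le_cancel_iff intro!: ln_mono)
  also have "\<dots> = ln (4 ^ m / (2 * real m))" using m by (simp add: ln_div)
  also have "\<dots> \<le> ln (real (2 * m choose m))"
    using central_binomial_lower_bound[OF m] m by (intro ln_mono) auto
  also have "\<dots> \<le> ln (real (2 * m choose m)) + ln c" using c by simp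
  finally show "ln (fact N) - 2 * ln (fact (N div 2)) \<ge> (real N - 1) * ln 2 - ln (real N)"
    using eq by (simp add: m_def)
qed

lemma ln_nat_le:
  assumes "N > 0"
  shows "ln (real N) \<le> 2 * sqrt (real N)"
proof -
  have "ln (real N) \<le> ln (1 + real N)" using assms by (intro ln_mono) auto
  also have "\<dots> \<le> 2 * sqrt (real N)" by (rule ln_le_2_sqrt) simp
  finally show ?thesis .
qed

text \<open>Halving N: the linear terms add up to N ln 2 + N ln 2. The constant 7 closes the
  recursion because 1 / sqrt 2 \<le> 5 / 7, and 5 sqrt N + ln N \<le> 7 sqrt N.\<close>

lemma chebyshev_psi_le: "chebyshev_psi N \<le> 2 * real N * ln 2 + 7 * sqrt (real N)"
proof (induction N rule: less_induct)
  case (less N)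
  show ?case
  proof (cases "N \<ge> 2")
    case False
    then have "N = 0 \<or> N = 1" by auto
    then show ?thesis by (auto simp: chebyshev_psi_def)
  next
    case True
    have "chebyshev_psi (N div 2) \<le> 2 * real (N div 2) * ln 2 + 7 * sqrt (real (N div 2))"
      using True by (intro less.IH) simp
    also have "\<dots> \<le> real N * ln 2 + 7 * sqrt (real N / 2)"
      by (intro add_mono mult_right_mono mult_left_mono real_sqrt_le_mono) (use of_nat_div_le_of_nat[of N 2, where ?'a = real] in auto)
    also have "sqrt (real N / 2) \<le> (5 / 7) * sqrt (real N)"
    proof (rule power2_le_imp_le)
      show "(sqrt (real N / 2))\<^sup>2 \<le> (5 / 7 * sqrt (real N))\<^sup>2" by (simp add: power_mult_distrib power2_eq_square)
    qed simp
    finally have "chebyshev_psi (N div 2) \<le> real N * ln 2 + 5 * sqrt (real N)" by simp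
    moreover have "chebyshev_psi N - chebyshev_psi (N div 2) \<le> real N * ln 2 + ln (real N)"
      using chebyshev_psi_half_le[of N] ln_central_fact_bounds(1)[OF True] by linarith
    moreover have "ln (real N) \<le> 2 * sqrt (real N)" using True by (intro ln_nat_le) simp
    ultimately show ?thesis by (simp add: algebra_simps)
  qed
qed

text \<open>Subtracting the upper bound for N div 3 leaves (1/3) N ln 2 \<ge> 2N/9 minus 9 sqrt N,
  where 9 = 7 + 2, and minus a constant. From N \<ge> 10000 on, 9 sqrt N is at most 9N/100.\<close>

lemma chebyshev_psi_dyadic_ge:
  "\<forall>\<^sub>F N in sequentially. chebyshev_psi N - chebyshev_psi (N div 2) \<ge> real N / 10"
proof -
  have "\<forall>\<^sub>F N in sequentially. N \<ge> (10000::nat)" by (rule eventually_ge_at_top)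
  then show ?thesis
  proof eventually_elim
    case (elim N)
    have "chebyshev_psi (N div 3) \<le> 2 * real (N div 3) * ln 2 + 7 * sqrt (real (N div 3))"
      by (rule chebyshev_psi_le)
    also have "\<dots> \<le> 2 * (real N / 3) * ln 2 + 7 * sqrt (real N)"
      using of_nat_div_le_of_nat[of N 3, where ?'a = real] div_le_dividend[of N 3]
      by (intro add_mono mult_right_mono mult_left_mono real_sqrt_le_mono) auto
    finally have 1: "chebyshev_psi (N div 3) \<le> 2 / 3 * (real N * ln 2) + 7 * sqrt (real N)" by simp
    have 2: "(real N - 1) * ln 2 - ln (real N) \<le> chebyshev_psi N - chebyshev_psi (N div 2) + chebyshev_psi (N div 3)"
      using ln_central_fact_bounds(2)[of N] chebyshev_psi_half_ge[of N] elim by linarith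
    have 3: "ln (real N) \<le> 2 * sqrt (real N)" using elim by (intro ln_nat_le) simp
    have 4: "real N * ln 2 \<ge> real N * (2 / 3)" using ln2_ge_two_thirds by (intro mult_left_mono) auto
    have "100 = sqrt (10000 :: real)" using real_sqrt_abs[of 100] by simp
    also have "\<dots> \<le> sqrt (real N)" using elim by (intro real_sqrt_le_mono) simp
    finally have "100 * sqrt (real N) \<le> sqrt (real N) * sqrt (real N)" by (intro mult_right_mono) auto
    then have 5: "100 * sqrt (real N) \<le> real N" by simp
    have 6: "ln 2 \<le> (1::real)" using ln_2_less_1 by simp
    have "real N / 10 \<le> (1 / 3) * (real N * (2 / 3)) - 1 - 9 * (real N / 100)" using elim by simp
    also have "\<dots> \<le> (1 / 3) * (real N * ln 2) - ln 2 - 9 * sqrt (real N)" using 4 5 6 by linarith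
    also have "\<dots> \<le> chebyshev_psi N - chebyshev_psi (N div 2)" using 1 2 3 by (simp add: algebra_simps)
    finally show ?case .
  qed
qed

section \<open>Primes congruent to 1 modulo a given prime\<close>

text \<open>Only the n div p multiples of p matter; dividing each of them by p leaves the factorial
  of n div p.\<close>

lemma multiplicity_fact_div:
  assumes "prime (p::nat)"
  shows "multiplicity p (fact n) = n div p + multiplicity p (fact (n div p))"
proof (induction n)
  case (Suc n)
  have Suc_mult: "multiplicity p (fact (Suc k)) = multiplicity p (Suc k) + multiplicity p (fact k)" for k
    unfolding fact_Suc of_nat_id using assms by (intro prime_elem_multiplicity_mult_distrib) auto
  show ?case
  proof (cases "p dvd Suc n")
    case True
    then obtain k where k: "Suc n = p * Suc k"
      using assms by (metis dvdE mult_0_right nat.distinct(1) not0_implies_Suc)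
    have p: "p > 0" using assms by (rule prime_gt_0_nat)
    have "n div p = k" using k p by (intro div_nat_eqI) auto
    moreover have "Suc n div p = Suc k" unfolding k using p by simp
    moreover have "multiplicity p (Suc n) = 1 + multiplicity p (Suc k)"
      unfolding k using assms p by (subst multiplicity_times_same) auto
    ultimately show ?thesis using Suc Suc_mult[of n] Suc_mult[of k] by simp
  next
    case False
    then have "Suc n div p = n div p" by (simp add: div_Suc dvd_eq_mod_eq_0)
    then show ?thesis using Suc Suc_mult[of n] False by (simp add: not_dvd_imp_multiplicity_0)
  qed
qed simp

lemma multiplicity_fact_le:
  assumes "prime (p::nat)"
  shows "multiplicity p (fact n) \<le> n"
proof (induction n rule: less_induct)
  case (less n)
  show ?case
  proof (cases "n = 0")
    case False
    have p: "p \<ge> 2" using assms by (rule prime_ge_2_nat)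
    have "multiplicity p (fact n) \<le> n div p + n div p"
      using multiplicity_fact_div[OF assms, of n] less.IH[of "n div p"] False p by simp
    also have "\<dots> \<le> n div 2 + n div 2" using p by (intro add_mono div_le_mono2) auto
    finally show ?thesis by linarith
  qed simp
qed

lemma fact_dvd_prod_shift: "fact n dvd (\<Prod>k=1..n. c + k :: nat)"
proof -
  have "(\<Prod>k=1..n. c + k) * fact c = (fact (c + n) :: nat)"
    by (induction n) (auto simp: algebra_simps)
  also have "\<dots> = fact n * fact (c + n - n) * (c + n choose n)"
    by (rule binomial_fact_lemma[symmetric]) simp
  finally have "fact c * (\<Prod>k=1..n. c + k) = fact c * (fact n * (c + n choose n))" by (simp add: mult_ac)
  then have "(\<Prod>k=1..n. c + k) = fact n * (c + n choose n)"
    by (subst (asm) mult_cancel1) simp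
  then show ?thesis by simp
qed

text \<open>Multiplying by an inverse c of p modulo u turns 1 + p k into c + k. The progression
  becomes n consecutive integers, whose product is divisible by n!.\<close>

lemma dvd_prod_progression:
  fixes u p n :: nat
  assumes "u dvd fact n" "coprime p u"
  shows "u dvd (\<Prod>k=1..n. 1 + p * k)"
proof -
  obtain c where c: "[p * c = 1] (mod u)"
    using cong_solve_coprime_nat[OF assms(2)] by auto
  have "[c * (1 + p * k) = c + k] (mod u)" for k
  proof -
    have "[c + (p * c) * k = c + 1 * k] (mod u)"
      by (intro cong_add cong_mult c cong_refl)
    then show ?thesis by (simp add: algebra_simps)
  qed
  then have "[(\<Prod>k=1..n. c * (1 + p * k)) = (\<Prod>k=1..n. c + k)] (mod u)"
    by (intro cong_prod)
  moreover have "u dvd (\<Prod>k=1..n. c + k)"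
    using assms(1) fact_dvd_prod_shift by (rule dvd_trans)
  ultimately have "u dvd (\<Prod>k=1..n. c * (1 + p * k))"
    by (simp add: cong_dvd_iff)
  then have "u dvd c ^ n * (\<Prod>k=1..n. 1 + p * k)"
    by (simp only: prod.distrib prod_constant card_atLeastAtMost diff_Suc_1)
  moreover have "coprime u c"
  proof -
    have "coprime (p * c) u" using c cong_imp_coprime[OF cong_sym[OF c]] by simp
    then show ?thesis by (simp add: coprime_commute)
  qed
  ultimately show ?thesis by (simp add: coprime_dvd_mult_right_iff coprime_commute)
qed

lemma prod_primes_dvd:
  fixes m :: nat
  assumes "finite Q" "\<And>q. q \<in> Q \<Longrightarrow> prime q" "\<And>q. q \<in> Q \<Longrightarrow> q dvd m"
  shows "\<Prod>Q dvd m"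
  using assms
proof (induction Q rule: finite_induct)
  case (insert q Q)
  have "coprime q (\<Prod>Q)"
  proof (rule prod_coprime_right)
    fix q' assume "q' \<in> Q"
    then show "coprime q q'" using insert.hyps(2) insert.prems(1) by (metis insertCI primes_coprime)
  qed
  then have "q * \<Prod>Q dvd m" using insert.IH insert.prems by (intro divides_mult) auto
  then show ?case using insert.hyps by simp
qed simp

text \<open>A Chebyshev-type bound: the part of \<open>Y!\<close> prime to \<open>p\<close> divides \<open>\<Prod>k\<le>Y. 1 + p k\<close>,
  so the primes \<open>q \<equiv> 1\<close> mod \<open>p\<close> must be squeezed into the quotient.\<close>

lemma sum_ln_primes_cong_1_le:
  fixes p N :: nat
  assumes p: "prime p" "p \<ge> 3"
  shows "(\<Sum>q | prime q \<and> N div 2 < q \<and> q \<le> N \<and> p dvd q - 1. ln (real q)) \<le> 2 * real N * (ln (real p + 1) / real p)"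
proof -
  \<comment> \<open>The largest k for which 1 + p k can still be at most N.\<close>
  define Y where "Y = (N - 1) div p"
  define Q where "Q = {q. prime q \<and> N div 2 < q \<and> q \<le> N \<and> p dvd q - 1}"
  define P where "P = (\<Prod>k=1..Y. 1 + p * k)"
  have finQ: "finite Q" by (rule finite_subset[of _ "{..N}"]) (auto simp: Q_def)
  have Q: "prime q" "q > Y" "q dvd P" if "q \<in> Q" for q
  proof -
    show "prime q" using that by (simp add: Q_def)
    have "Y \<le> (N - 1) div 3" unfolding Y_def using p by (intro div_le_mono2) auto
    then show "q > Y" using that by (auto simp: Q_def)
    have "p dvd q - 1" using that by (simp add: Q_def)
    then obtain k where k: "q - 1 = p * k" by (rule dvdE)
    have "q > 1" using \<open>prime q\<close> prime_gt_1_nat by blast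
    with k have q: "q = 1 + p * k" "k > 0" by (auto intro: Nat.gr0I)
    moreover have "k \<le> Y"
    proof -
      have "q - 1 \<le> N - 1" using that by (auto simp: Q_def)
      then have "k * p \<le> N - 1" unfolding k by (simp add: mult.commute)
      then show ?thesis unfolding Y_def using p by (simp add: less_eq_div_iff_mult_less_eq)
    qed
    ultimately show "q dvd P" unfolding P_def by (intro dvd_prodI[of _ k, THEN dvd_trans[rotated]]) auto
  qed
  obtain u where u: "fact Y = p ^ multiplicity p (fact Y) * u" "\<not> p dvd u"
    using multiplicity_decompose'[of "fact Y" p] not_prime_unit[of p] p(1) fact_nonzero by blast
  define v where "v = multiplicity p (fact Y)"
  have fact_Y: "fact Y = p ^ v * u" using u(1) by (simp add: v_def)
  have "coprime p u" using p(1) u(2) by (simp add: prime_imp_coprime)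
  then have "u dvd P" unfolding P_def by (intro dvd_prod_progression) (simp add: fact_Y)
  moreover have "\<Prod>Q dvd P" by (rule prod_primes_dvd) (use finQ Q in auto)
  \<comment> \<open>Since p \<ge> 3, Y is at most N div 3 and so below every q in \<open>Q\<close>;
    hence q does not divide Y!.\<close>
  moreover have "coprime u (\<Prod>Q)"
  proof (rule prod_coprime_right)
    fix q assume q: "q \<in> Q"
    have "\<not> q dvd fact Y" using Q(1,2)[OF q] by (simp add: prime_dvd_fact_iff)
    then have "\<not> q dvd u" unfolding fact_Y by auto
    then show "coprime u q" using Q(1)[OF q] by (simp add: prime_imp_coprime coprime_commute)
  qed
  ultimately have "u * \<Prod>Q dvd P" by (intro divides_mult)
  moreover have "P > 0" by (simp add: P_def)
  ultimately have "u * \<Prod>Q \<le> P" by (intro dvd_imp_le)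
  \<comment> \<open>P is at most (p + 1)^Y Y!, and Y! exceeds u only by a power of p with exponent
    at most Y. Cancelling u leaves (p + 1)^(2Y) for the product of \<open>Q\<close>.\<close>
  also have "P \<le> (\<Prod>k=1..Y. (p + 1) * k)" unfolding P_def by (intro prod_mono) auto
  also have "\<dots> = (p + 1) ^ Y * fact Y" unfolding prod.distrib prod_constant fact_prod by simp
  also have "\<dots> = u * ((p + 1) ^ Y * p ^ v)" by (simp add: fact_Y)
  also have "\<dots> \<le> u * ((p + 1) ^ Y * (p + 1) ^ Y)"
  proof (intro mult_le_mono le_refl)
    have "p ^ v \<le> (p + 1) ^ v" by (intro power_mono) auto
    also have "\<dots> \<le> (p + 1) ^ Y"
      using multiplicity_fact_le[OF p(1), of Y] by (intro power_increasing) (auto simp: v_def)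
    finally show "p ^ v \<le> (p + 1) ^ Y" .
  qed
  finally have "\<Prod>Q \<le> (p + 1) ^ (2 * Y)"
    using u(2) by (auto simp: mult_2 power_add intro: Nat.gr0I)
  then have "real (\<Prod>Q) \<le> real ((p + 1) ^ (2 * Y))" by (rule of_nat_mono)
  then have le: "real (\<Prod>Q) \<le> (real p + 1) ^ (2 * Y)" by (simp add: add.commute)
  have "(\<Sum>q\<in>Q. ln (real q)) = ln (\<Prod>q\<in>Q. real q)"
    using Q(1) finQ by (intro ln_prod[symmetric]) (auto simp: prime_gt_0_nat)
  also have "\<dots> = ln (real (\<Prod>Q))" by simp
  also have "\<dots> \<le> ln ((real p + 1) ^ (2 * Y))"
    using le Q(1) finQ by (intro ln_mono) (auto intro!: prod_pos simp: prime_gt_0_nat)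
  also have "\<dots> = 2 * real Y * ln (real p + 1)" by (subst ln_realpow) auto
  also have "\<dots> \<le> 2 * (real N / real p) * ln (real p + 1)"
  proof -
    have "real Y \<le> real (N - 1) / real p" unfolding Y_def by (rule of_nat_div_le_of_nat)
    also have "\<dots> \<le> real N / real p" by (intro divide_right_mono) auto
    finally show ?thesis by (intro mult_right_mono mult_left_mono) auto
  qed
  finally show ?thesis by (simp add: Q_def)
qed

section \<open>Legendre symbols as real characters\<close>

lemma Legendre_values: "Legendre a p \<in> {-1, 0, 1}"
  by (simp add: Legendre_def)

lemma Legendre_cong:
  assumes "[a = b] (mod p)"
  shows "Legendre a p = Legendre b p"
proof -
  have "[a = 0] (mod p) \<longleftrightarrow> [b = 0] (mod p)" "QuadRes p a \<longleftrightarrow> QuadRes p b"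
    using assms unfolding QuadRes_def by (meson cong_sym cong_trans)+
  then show ?thesis by (simp add: Legendre_def)
qed

lemma Legendre_1: "p > 1 \<Longrightarrow> Legendre 1 p = 1"
proof -
  assume "p > 1"
  then have "\<not> [1 = 0] (mod p)" by (simp add: cong_def)
  moreover have "QuadRes p 1" unfolding QuadRes_def by (rule exI[of _ 1]) simp
  ultimately show ?thesis by (simp add: Legendre_def)
qed

text \<open>Euler's criterion gives the identity modulo p. The two sides differ by at most 2 < p, so
  they are equal.\<close>

lemma Legendre_mult:
  assumes "prime p" "2 < p"
  shows "Legendre (a * b) p = Legendre a p * Legendre b p"
proof -
  define k where "k = nat ((p - 1) div 2)"
  have eul: "[Legendre a p = a ^ ((nat p - 1) div 2)] (mod p)" for a
    using euler_criterion[of "nat p" a] assms by simp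
  have "[Legendre (a * b) p = (a * b) ^ ((nat p - 1) div 2)] (mod p)" by (rule eul)
  also have "(a * b) ^ ((nat p - 1) div 2) = a ^ ((nat p - 1) div 2) * b ^ ((nat p - 1) div 2)"
    by (rule power_mult_distrib)
  also have "[\<dots> = Legendre a p * Legendre b p] (mod p)"
    by (intro cong_mult cong_sym[OF eul])
  finally have "p dvd Legendre (a * b) p - Legendre a p * Legendre b p"
    by (simp add: cong_iff_dvd_diff)
  moreover have "\<bar>Legendre (a * b) p - Legendre a p * Legendre b p\<bar> \<le> 2"
    using Legendre_values[of "a * b" p] Legendre_values[of a p] Legendre_values[of b p] by auto
  ultimately have "Legendre (a * b) p - Legendre a p * Legendre b p = 0"
    using assms(2) dvd_imp_le_int[of "Legendre (a * b) p - Legendre a p * Legendre b p" p] by auto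
  then show ?thesis by simp
qed

text \<open>Squaring maps the nonzero residues to themselves and identifies 1 with p - 1, so it is
  not injective, hence not surjective.\<close>

lemma exists_Legendre_minus_1:
  assumes "prime (p::nat)" "2 < p"
  shows "\<exists>g. Legendre (int g) (int p) = -1"
proof -
  define f where "f = (\<lambda>x::nat. x\<^sup>2 mod p)"
  have f_in: "f x \<in> {1..<p}" if "x \<in> {1..<p}" for x
  proof -
    have "\<not> p dvd x" using that by (auto dest: dvd_imp_le)
    then have "\<not> p dvd x\<^sup>2" using assms(1) by (simp add: prime_dvd_power_iff)
    then show ?thesis using assms by (auto simp: f_def dvd_eq_mod_eq_0 Suc_le_eq)
  qed
  have "f 1 = f (p - 1)"
  proof -
    have "[int (p - 1) = - 1] (mod int p)"
      using assms by (simp add: of_nat_diff cong_iff_dvd_diff)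
    then have "[(int (p - 1))\<^sup>2 = (- 1)\<^sup>2] (mod int p)" by (rule cong_pow)
    then have "[(p - 1)\<^sup>2 = 1\<^sup>2] (mod p)" by (simp flip: cong_int_iff)
    then show ?thesis by (simp add: f_def cong_def)
  qed
  have "\<not> inj_on f {1..<p}"
  proof
    assume inj: "inj_on f {1..<p}"
    have "1 = p - 1"
      by (rule inj_onD[OF inj \<open>f 1 = f (p - 1)\<close>]) (use assms in auto)
    then show False using assms by simp
  qed
  then have "f ` {1..<p} \<noteq> {1..<p}"
    using endo_inj_surj eq_card_imp_inj_on[of "{1..<p}" f] by auto
  then obtain g where g: "g \<in> {1..<p}" "g \<notin> f ` {1..<p}" using f_in by blast
  have "\<not> [int g = 0] (mod int p)" using g(1) by (auto simp: cong_0_iff dest: dvd_imp_le)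
  moreover have "\<not> QuadRes (int p) (int g)"
  proof
    assume "QuadRes (int p) (int g)"
    then obtain y where y: "[y\<^sup>2 = int g] (mod int p)" by (auto simp: QuadRes_def)
    define x where "x = nat (y mod int p)"
    have x: "int x = y mod int p" using assms by (simp add: x_def)
    have "[(int x)\<^sup>2 = y\<^sup>2] (mod int p)" unfolding x by (intro cong_pow) (simp add: cong_def)
    then have "[(int x)\<^sup>2 = int g] (mod int p)" using y by (rule cong_trans)
    then have "[x\<^sup>2 = g] (mod p)" by (simp flip: cong_int_iff)
    then have fx: "f x = g" using g(1) by (simp add: f_def cong_def)
    moreover have "x < p" using assms x by (metis of_nat_less_iff of_nat_0_less_iff pos_mod_bound prime_gt_0_nat)
    moreover have "x \<noteq> 0"
    proof
      assume "x = 0"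
      then show False using fx g(1) by (simp add: f_def)
    qed
    ultimately show False using g(2) by auto
  qed
  ultimately show ?thesis by (auto simp: Legendre_def)
qed

text \<open>For a finite set of odd primes this is the Jacobi symbol modulo their product. The empty
  set gives the constant 1.\<close>

definition legendre_prod :: "nat set \<Rightarrow> nat \<Rightarrow> real" where
  "legendre_prod S n = (\<Prod>p\<in>S. of_int (Legendre (int n) (int p)))"

lemma legendre_prod_values: "legendre_prod S n \<in> {-1, 0, 1}"
proof (induction S rule: infinite_finite_induct)
  case (insert p S)
  then show ?case using Legendre_values[of "int n" "int p"] by (auto simp: legendre_prod_def)
qed (auto simp: legendre_prod_def)

lemma legendre_prod_mult:
  assumes "\<And>p. p \<in> S \<Longrightarrow> prime p \<and> 2 < p"
  shows "legendre_prod S (m * n) = legendre_prod S m * legendre_prod S n"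
  unfolding legendre_prod_def prod.distrib [symmetric]
  by (rule prod.cong) (use assms in \<open>auto simp: Legendre_mult\<close>)

lemma legendre_prod_cong:
  assumes "[m = n] (mod \<Prod>S)" "finite S"
  shows "legendre_prod S m = legendre_prod S n"
  unfolding legendre_prod_def
proof (rule prod.cong)
  fix p assume "p \<in> S"
  then have "p dvd \<Prod>S" using assms(2) dvd_prodI[of S p "\<lambda>x. x"] by simp
  then have "[m = n] (mod p)" by (rule cong_dvd_modulus_nat[OF assms(1)])
  then have "[int m = int n] (mod int p)" by (simp add: cong_int_iff)
  then show "of_int (Legendre (int m) (int p)) = (of_int (Legendre (int n) (int p)) :: real)"
    by (simp add: Legendre_cong)
qed simp

text \<open>By the Chinese remainder theorem, a nonresidue at one prime and 1 at all others.\<close>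

lemma exists_legendre_prod_minus_1:
  assumes "finite S" "S \<noteq> {}" and S: "\<And>p. p \<in> S \<Longrightarrow> prime p \<and> 2 < p"
  shows "\<exists>c. legendre_prod S c = -1"
proof -
  obtain p where p: "p \<in> S" using assms(2) by auto
  obtain g where g: "Legendre (int g) (int p) = -1"
    using exists_Legendre_minus_1 S[OF p] by blast
  have "coprime p (\<Prod>(S - {p}))"
  proof (rule prod_coprime_right)
    fix q assume "q \<in> S - {p}"
    then show "coprime p q" using S p by (intro primes_coprime) auto
  qed
  then obtain c where c: "[c = g] (mod p)" "[c = 1] (mod \<Prod>(S - {p}))"
    using binary_chinese_remainder_nat by blast
  have "[int c = int g] (mod int p)" using c(1) by (simp add: cong_int_iff)
  then have "Legendre (int c) (int p) = -1" using g Legendre_cong[of "int c" "int g" "int p"] by simp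
  moreover have "legendre_prod (S - {p}) c = 1"
  proof -
    have "legendre_prod (S - {p}) c = legendre_prod (S - {p}) 1"
      using c(2) assms(1) by (intro legendre_prod_cong) auto
    also have "\<dots> = 1" unfolding legendre_prod_def
      by (rule prod.neutral) (use S in \<open>force simp: Legendre_1\<close>)
    finally show ?thesis .
  qed
  moreover have "legendre_prod S c = of_int (Legendre (int c) (int p)) * legendre_prod (S - {p}) c"
    unfolding legendre_prod_def using assms(1) p by (rule prod.remove)
  ultimately show ?thesis by auto
qed

text \<open>Multiplication by c with character value -1 permutes the residues and negates the
  sum.\<close>

lemma legendre_prod_period_sum:
  assumes "finite S" "S \<noteq> {}" and S: "\<And>p. p \<in> S \<Longrightarrow> prime p \<and> 2 < p"
  shows "(\<Sum>n<\<Prod>S. legendre_prod S n) = 0"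
proof -
  define D where "D = \<Prod>S"
  have D: "D > 0" unfolding D_def using S by (intro prod_pos) (auto simp: prime_gt_0_nat)
  obtain c where c: "legendre_prod S c = -1"
    using exists_legendre_prod_minus_1[OF assms] by blast
  have "coprime c D"
    unfolding D_def
  proof (rule prod_coprime_right)
    fix p assume p: "p \<in> S"
    have "Legendre (int c) (int p) \<noteq> 0"
    proof
      assume "Legendre (int c) (int p) = 0"
      then have "legendre_prod S c = 0" unfolding legendre_prod_def using assms(1) p by (auto intro!: prod_zero)
      then show False using c by simp
    qed
    then have "\<not> p dvd c" by (auto simp: Legendre_def cong_0_iff)
    then have "coprime p c" using S[OF p] by (simp add: prime_imp_coprime)
    then show "coprime c p" by (simp only: coprime_commute)
  qed
  have inj: "inj_on (\<lambda>n. c * n mod D) {..<D}"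
  proof (rule inj_onI)
    fix x y assume xy: "x \<in> {..<D}" "y \<in> {..<D}" "c * x mod D = c * y mod D"
    then have "[c * x = c * y] (mod D)" by (simp add: cong_def)
    then have "[x = y] (mod D)" using \<open>coprime c D\<close> by (simp add: cong_mult_lcancel_nat)
    then show "x = y" using xy by (simp add: cong_def)
  qed
  have "(\<lambda>n. c * n mod D) ` {..<D} = {..<D}"
    using D by (intro endo_inj_surj inj) auto
  then have "(\<Sum>n<D. legendre_prod S n) = (\<Sum>n\<in>(\<lambda>n. c * n mod D) ` {..<D}. legendre_prod S n)" by simp
  also have "\<dots> = (\<Sum>n<D. legendre_prod S (c * n mod D))"
    by (simp add: sum.reindex[OF inj] o_def)
  also have "\<dots> = (\<Sum>n<D. - legendre_prod S n)"
  proof (rule sum.cong)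
    fix n
    have "legendre_prod S (c * n mod D) = legendre_prod S (c * n)"
      by (intro legendre_prod_cong assms(1)) (simp add: D_def cong_def)
    then show "legendre_prod S (c * n mod D) = - legendre_prod S n"
      using S c by (simp add: legendre_prod_mult)
  qed simp
  finally show ?thesis by (simp add: D_def sum_negf)
qed

text \<open>Full periods sum to 0, so a partial sum equals one over less than a period. The periods
  are counted from index 0, which adds nothing since S is nonempty and the symbol vanishes at
  0.\<close>

lemma real_char_legendre_prod:
  assumes "finite S" "S \<noteq> {}" and S: "\<And>p. p \<in> S \<Longrightarrow> prime p \<and> 2 < p"
  shows "real_char (legendre_prod S) (real (\<Prod>S))"
proof
  define D where "D = \<Prod>S"
  show "legendre_prod S n \<in> {-1, 0, 1}" for n by (rule legendre_prod_values)
  show "legendre_prod S 1 = 1"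
    unfolding legendre_prod_def by (rule prod.neutral) (use S in \<open>force simp: Legendre_1\<close>)
  show "legendre_prod S (m * n) = legendre_prod S m * legendre_prod S n" for m n
    using S by (rule legendre_prod_mult)
  have bound: "\<bar>\<Sum>n<N. legendre_prod S n\<bar> \<le> real D" for N
  proof (induction N rule: less_induct)
    case (less N)
    show ?case
    proof (cases "N < D")
      case True
      have "\<bar>\<Sum>n<N. legendre_prod S n\<bar> \<le> (\<Sum>n<N. \<bar>legendre_prod S n\<bar>)" by (rule sum_abs)
      also have "\<dots> \<le> (\<Sum>n<N. 1)"
      proof (rule sum_mono)
        fix n show "\<bar>legendre_prod S n\<bar> \<le> 1" using legendre_prod_values[of S n] by auto
      qed
      finally show ?thesis using True by simp
    next
      case False
      have D: "D > 0" unfolding D_def using S by (intro prod_pos) (auto simp: prime_gt_0_nat)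
      have N: "N = D + (N - D)" using False by simp
      have "(\<Sum>n<D + M. legendre_prod S n) = (\<Sum>n<D. legendre_prod S n) + (\<Sum>n<M. legendre_prod S (D + n))" for M
        by (induction M) simp_all
      then have "(\<Sum>n<N. legendre_prod S n) = (\<Sum>n<D. legendre_prod S n) + (\<Sum>n<N - D. legendre_prod S (D + n))"
        by (subst N)
      also have "(\<Sum>n<N - D. legendre_prod S (D + n)) = (\<Sum>n<N - D. legendre_prod S n)"
        by (intro sum.cong refl legendre_prod_cong assms(1)) (simp add: D_def cong_def)
      also have "(\<Sum>n<D. legendre_prod S n) = 0"
        unfolding D_def using assms by (rule legendre_prod_period_sum)
      finally show ?thesis using less.IH[of "N - D"] False D by simp
    qed
  qed
  show "\<bar>\<Sum>n=1..N. legendre_prod S n\<bar> \<le> real (\<Prod>S)" for N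
  proof -
    obtain p where "p \<in> S" using assms(2) by auto
    then have "legendre_prod S 0 = 0"
      unfolding legendre_prod_def using assms(1) by (intro prod_zero) (auto simp: Legendre_def)
    then have "(\<Sum>n=1..N. legendre_prod S n) = (\<Sum>n<Suc N. legendre_prod S n)"
      by (intro sum.mono_neutral_left) (auto simp: Suc_le_eq)
    then show ?thesis using bound[of "Suc N"] by (simp only: D_def)
  qed
qed

section \<open>Primes avoiding residue classes, and the products\<close>

text \<open>A proper prime power p^k \<le> N has p \<le> sqrt N and, as ln 2 \<ge> 1/2, k \<le> 2 ln
  N. There are thus at most 2 sqrt N ln N of them, each of weight at most ln N.\<close>

lemma sum_mangoldt_nonprime_le:
  assumes "N > 0"
  shows "(\<Sum>n | n \<in> {1..N} \<and> \<not> prime n. mangoldt n) \<le> 2 * sqrt (real N) * (ln (real N))\<^sup>2"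
proof -
  define s where "s = nat \<lfloor>sqrt (real N)\<rfloor>"
  define l where "l = nat \<lfloor>2 * ln (real N)\<rfloor>"
  define A where "A = {n \<in> {1..N}. primepow n \<and> \<not> prime n}"
  have lnN: "ln (real N) \<ge> 0" using assms by simp
  have "A \<subseteq> (\<lambda>(p, k). p ^ k) ` ({1..s} \<times> {1..l})"
  proof
    fix n assume "n \<in> A"
    then obtain p k where n: "prime p" "k > 0" "n = p ^ k" "n \<le> N" "\<not> prime n"
      by (auto simp: A_def primepow_def)
    have "k \<noteq> 1" using n by auto
    with n(2) have k: "k \<ge> 2" by simp
    have p: "p \<ge> 2" using n(1) by (rule prime_ge_2_nat)
    have "p\<^sup>2 \<le> p ^ k" using k p by (intro power_increasing) auto
    then have "(real p)\<^sup>2 \<le> real N" using n(3,4) by (simp flip: of_nat_power)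
    then have "real p \<le> sqrt (real N)" by (rule real_le_rsqrt)
    then have "p \<le> s" unfolding s_def by (simp add: le_nat_floor)
    moreover have "k \<le> l"
    proof -
      have "real k * (1 / 2) \<le> real k * ln 2"
        using ln2_ge_two_thirds by (intro mult_left_mono) auto
      also have "\<dots> \<le> real k * ln (real p)" using p by (intro mult_left_mono ln_mono) auto
      also have "\<dots> = ln (real n)" using p n(3) by (simp add: ln_realpow)
      also have "\<dots> \<le> ln (real N)" using n p by (intro ln_mono) auto
      finally show ?thesis unfolding l_def by (simp add: le_nat_floor)
    qed
    ultimately show "n \<in> (\<lambda>(p, k). p ^ k) ` ({1..s} \<times> {1..l})"
      using n p k by (intro image_eqI[of _ _ "(p, k)"]) auto
  qed
  then have "card A \<le> card ({1..s} \<times> {1..l})" by (intro surj_card_le) auto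
  then have "card A \<le> s * l" by simp
  then have "real (card A) \<le> real (s * l)" by (rule of_nat_mono)
  also have "\<dots> \<le> sqrt (real N) * (2 * ln (real N))"
    unfolding of_nat_mult using lnN by (intro mult_mono) (auto simp: s_def l_def)
  finally have card: "real (card A) \<le> sqrt (real N) * (2 * ln (real N))" .
  have "(\<Sum>n | n \<in> {1..N} \<and> \<not> prime n. mangoldt n) = (\<Sum>n\<in>A. mangoldt n :: real)"
    by (rule sum.mono_neutral_right) (auto simp: A_def mangoldt_def)
  also have "\<dots> \<le> (\<Sum>n\<in>A. ln (real N))"
  proof (rule sum_mono)
    fix n assume "n \<in> A"
    then have "n > 0" "n \<le> N" by (auto simp: A_def)
    then have "mangoldt n \<le> ln (real n)" by (intro mangoldt_le)
    also have "\<dots> \<le> ln (real N)" using \<open>n > 0\<close> \<open>n \<le> N\<close> by (intro ln_mono) auto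
    finally show "mangoldt n \<le> ln (real N)" .
  qed
  also have "\<dots> = real (card A) * ln (real N)" by simp
  also have "\<dots> \<le> sqrt (real N) * (2 * ln (real N)) * ln (real N)"
    using card lnN by (rule mult_right_mono)
  finally show ?thesis by (simp add: power2_eq_square mult_ac)
qed

lemma (in real_char) psi_char_dyadic_small:
  "(\<lambda>N. (\<Sum>n\<in>{N div 2<..N}. chi n * mangoldt n) / real N) \<longlonglongrightarrow> 0"
proof -
  define f where "f = (\<lambda>N. \<Sum>n=1..N. chi n * mangoldt n)"
  have eq: "(\<Sum>n\<in>{N div 2<..N}. chi n * mangoldt n) = f N - f (N div 2)" for N
    unfolding f_def by (subst sum_atLeastAtMost_split[of "N div 2" N]) auto
  have 1: "(\<lambda>N. f N / real N) \<longlonglongrightarrow> 0" unfolding f_def by (rule psi_char_mean_zero)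
  then have 2: "(\<lambda>N. f (N div 2) / real N) \<longlonglongrightarrow> 0" by (rule mean_zero_div) simp
  show ?thesis unfolding eq diff_divide_distrib using tendsto_diff[OF 1 2] by simp
qed

definition primes_avoiding :: "nat set \<Rightarrow> nat \<Rightarrow> nat set" where
  "primes_avoiding S N = {q. prime q \<and> N div 2 < q \<and> q \<le> N \<and> (\<forall>p\<in>S. \<not> [q = 1] (mod p))}"

text \<open>Primes that are quadratic nonresidues modulo every \<open>p \<in> S\<close> avoid the class of 1 modulo
  every \<open>p \<in> S\<close>; only real characters are needed to produce them.\<close>

lemma sum_ln_primes_not_cong_1_ge:
  assumes "finite S" and S: "\<And>p. p \<in> S \<Longrightarrow> prime p \<and> 2 < p"
  shows "\<forall>\<^sub>F N in sequentially. real N / (40 * 2 ^ card S) \<le>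
    (\<Sum>q\<in>primes_avoiding S N. ln (real q))"
proof -
  \<comment> \<open>A nonnegative weight that vanishes as soon as n is a residue modulo some p in S,
    in particular at n = 1 modulo p. Its upper bound 2 ^ card S is the factor lost in the
    conclusion.\<close>
  define F where "F = (\<lambda>n. \<Prod>p\<in>S. 1 - real_of_int (Legendre (int n) (int p)))"
  have F_bounds: "0 \<le> F n" "F n \<le> 2 ^ card S" for n
  proof -
    have *: "0 \<le> 1 - real_of_int (Legendre (int n) (int p)) \<and> 1 - real_of_int (Legendre (int n) (int p)) \<le> 2" for p
      using Legendre_values[of "int n" "int p"] by auto
    show "0 \<le> F n" unfolding F_def by (intro prod_nonneg) (use * in auto)
    have "F n \<le> (\<Prod>p\<in>S. 2)" unfolding F_def by (intro prod_mono) (use * in auto)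
    then show "F n \<le> 2 ^ card S" by simp
  qed
  have F_zero: "F n = 0" if p: "p \<in> S" and n: "[n = 1] (mod p)" for n p
  proof -
    have "[int n = 1] (mod int p)" using n by (simp flip: cong_int_iff)
    then have "Legendre (int n) (int p) = 1"
      using Legendre_cong[of "int n" 1 "int p"] Legendre_1[of "int p"] S[OF p] by simp
    then show ?thesis unfolding F_def using assms(1) p by (auto intro!: prod_zero)
  qed
  have F_expand: "F n = (\<Sum>X\<in>Pow S. (-1) ^ card X * legendre_prod X n)" for n
  proof -
    have "F n = (\<Prod>p\<in>S. - real_of_int (Legendre (int n) (int p)) + 1)" by (simp add: F_def)
    also have "\<dots> = (\<Sum>X\<in>Pow S. (\<Prod>p\<in>X. - real_of_int (Legendre (int n) (int p))) * (\<Prod>p\<in>S - X. 1))"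
      by (rule prod_add[OF assms(1)])
    also have "\<dots> = (\<Sum>X\<in>Pow S. (-1) ^ card X * legendre_prod X n)"
      by (simp add: prod_uminus legendre_prod_def)
    finally show ?thesis .
  qed
  define I where "I = (\<lambda>N::nat. {N div 2<..N})"
  let ?T = "\<lambda>X N. \<Sum>n\<in>I N. legendre_prod X n * mangoldt n"
  \<comment> \<open>The contribution of the nontrivial characters, normalized by N; the empty X
    gives the main term.\<close>
  define R where "R = (\<lambda>N. \<Sum>X\<in>Pow S - {{}}. (-1) ^ card X * ?T X N / real N)"
  have decomp: "(\<Sum>n\<in>I N. F n * mangoldt n) = (chebyshev_psi N - chebyshev_psi (N div 2)) + real N * R N" for N
  proof (cases "N = 0")
    case True
    then show ?thesis by (simp add: I_def)
  next
    case False
    have "(\<Sum>n\<in>I N. F n * mangoldt n) = (\<Sum>n\<in>I N. \<Sum>X\<in>Pow S. (-1) ^ card X * (legendre_prod X n * mangoldt n))"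
      by (simp add: F_expand sum_distrib_right mult.assoc)
    also have "\<dots> = (\<Sum>X\<in>Pow S. (-1) ^ card X * ?T X N)"
      by (subst sum.swap) (simp add: sum_distrib_left)
    also have "\<dots> = (\<Sum>n\<in>I N. mangoldt n) + (\<Sum>X\<in>Pow S - {{}}. (-1) ^ card X * ?T X N)"
      using assms(1) by (subst sum.remove[of _ "{}"]) (auto simp: legendre_prod_def)
    also have "(\<Sum>n\<in>I N. mangoldt n) = chebyshev_psi N - chebyshev_psi (N div 2)"
      unfolding I_def by (rule chebyshev_psi_diff[symmetric]) simp
    also have "(\<Sum>X\<in>Pow S - {{}}. (-1) ^ card X * ?T X N) = real N * R N"
      unfolding R_def sum_distrib_left[of "real N"] using False by simp
    finally show ?thesis .
  qed
  have "R \<longlonglongrightarrow> (\<Sum>X\<in>Pow S - {{}}. (-1) ^ card X * 0)"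
    unfolding R_def times_divide_eq_right [symmetric]
  proof (intro tendsto_sum tendsto_mult tendsto_const)
    fix X assume X: "X \<in> Pow S - {{}}"
    then interpret real_char "legendre_prod X" "real (\<Prod>X)"
      using assms finite_subset by (intro real_char_legendre_prod) auto
    show "(\<lambda>N. ?T X N / real N) \<longlonglongrightarrow> 0"
      unfolding I_def by (rule psi_char_dyadic_small)
  qed
  then have "R \<longlonglongrightarrow> 0" by simp
  then have R_small: "\<forall>\<^sub>F N in sequentially. dist (R N) 0 < 1 / 40" by (rule tendstoD) simp
  have "(\<lambda>N. 2 * sqrt (real N) * (ln (real N))\<^sup>2 / real N) \<longlonglongrightarrow> 0" by real_asymp
  then have E_small: "\<forall>\<^sub>F N in sequentially. dist (2 * sqrt (real N) * (ln (real N))\<^sup>2 / real N) 0 < 1 / (40 * 2 ^ card S)"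
    by (rule tendstoD) simp
  show ?thesis
    using R_small E_small chebyshev_psi_dyadic_ge eventually_gt_at_top[of "0::nat"]
  proof eventually_elim
    case (elim N)
    define Q where "Q = primes_avoiding S N"
    define E where "E = (\<Sum>n | n \<in> {1..N} \<and> \<not> prime n. mangoldt n :: real)"
    have finQ: "finite Q" by (rule finite_subset[of _ "{..N}"]) (auto simp: Q_def primes_avoiding_def)
    \<comment> \<open>Bookkeeping in fortieths of N: the main term supplies 4, the characters cost
      at most 1, the proper prime powers at most 1, and the conclusion claims 1 of what
      remains.\<close>
    have "real N * R N \<ge> real N * (- (1 / 40))"
      using elim(1) by (intro mult_left_mono) (auto simp: dist_real_def abs_if split: if_splits)
    with decomp[of N] elim(3) have "real N * (3 / 40) \<le> (\<Sum>n\<in>I N. F n * mangoldt n)" by simp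
    also have "\<dots> = (\<Sum>n\<in>{n\<in>I N. prime n}. F n * mangoldt n) + (\<Sum>n\<in>{n\<in>I N. \<not> prime n}. F n * mangoldt n)"
      by (subst sum.union_disjoint[symmetric]) (auto simp: I_def intro!: sum.cong)
    also have "(\<Sum>n\<in>{n\<in>I N. prime n}. F n * mangoldt n) = (\<Sum>n\<in>Q. F n * mangoldt n)"
      by (rule sum.mono_neutral_right) (use F_zero in \<open>auto simp: I_def Q_def primes_avoiding_def\<close>)
    also have "\<dots> \<le> (\<Sum>n\<in>Q. 2 ^ card S * ln (real n))"
      using F_bounds by (intro sum_mono mult_mono) (auto simp: Q_def primes_avoiding_def mangoldt_nonneg)
    also have "(\<Sum>n\<in>{n\<in>I N. \<not> prime n}. F n * mangoldt n) \<le> (\<Sum>n\<in>{n\<in>I N. \<not> prime n}. 2 ^ card S * mangoldt n)"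
      using F_bounds by (intro sum_mono mult_right_mono mangoldt_nonneg) auto
    also have "\<dots> \<le> (\<Sum>n | n \<in> {1..N} \<and> \<not> prime n. 2 ^ card S * mangoldt n)"
      by (rule sum_mono2) (auto simp: I_def mangoldt_nonneg)
    also have "\<dots> = 2 ^ card S * E" by (simp add: E_def sum_distrib_left)
    finally have main: "real N * (3 / 40) \<le> 2 ^ card S * ((\<Sum>q\<in>Q. ln (real q)) + E)"
      by (simp add: sum_distrib_left distrib_left)
    have "E / real N \<le> 2 * sqrt (real N) * (ln (real N))\<^sup>2 / real N"
      using sum_mangoldt_nonprime_le[OF elim(4)] by (intro divide_right_mono) (auto simp: E_def)
    also have "\<dots> \<le> 1 / (40 * 2 ^ card S)" using elim(2) by (simp add: dist_real_def)
    finally have "2 ^ card S * E \<le> real N * (1 / 40)" using elim(4) by (simp add: field_simps)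
    with main have "real N * (1 / 40) \<le> 2 ^ card S * (\<Sum>q\<in>Q. ln (real q))" by (simp add: distrib_left)
    then show "real N / (40 * 2 ^ card S) \<le> (\<Sum>q\<in>primes_avoiding S N. ln (real q))"
      unfolding Q_def [symmetric] by (simp add: field_simps)
  qed
qed

section \<open>Choosing the prime\<close>

lemma sum_UNION_le:
  fixes f :: "'a \<Rightarrow> real"
  assumes "finite I" "\<And>i. i \<in> I \<Longrightarrow> finite (A i)" "\<And>x. f x \<ge> 0"
  shows "(\<Sum>x\<in>(\<Union>i\<in>I. A i). f x) \<le> (\<Sum>i\<in>I. \<Sum>x\<in>A i. f x)"
  using assms(1,2)
proof (induction I rule: finite_induct)
  case (insert i I)
  have "(\<Sum>x\<in>A i \<union> (\<Union>i\<in>I. A i). f x) + (\<Sum>x\<in>A i \<inter> (\<Union>i\<in>I. A i). f x) = (\<Sum>x\<in>A i. f x) + (\<Sum>x\<in>(\<Union>i\<in>I. A i). f x)"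
    using insert.hyps insert.prems by (intro sum.union_inter) auto
  moreover have "(\<Sum>x\<in>A i \<inter> (\<Union>i\<in>I. A i). f x) \<ge> 0" by (intro sum_nonneg assms(3))
  ultimately show ?case using insert.IH insert.prems insert.hyps by simp
qed simp

text \<open>The threshold depends on r alone because \<open>K\<close> does and because all possible
  sets of small prime factors of l lie in the finite set Pow \<open>small\<close>. What l may still
  contribute, large prime factors and primes q dividing l, is bounded by counting: there are at most
  r of each.\<close>

lemma exists_prime_coprime:
  fixes r :: nat
  shows "\<exists>N0::nat. \<forall>N l. N \<ge> N0 \<longrightarrow> odd l \<longrightarrow> card (prime_factors l) \<le> r \<longrightarrow>
    (\<exists>q. prime q \<and> 2 < q \<and> q \<le> N \<and> N < 2 * q \<and> coprime l (q - 1) \<and> \<not> q dvd l)"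
proof -
  \<comment> \<open>The density guaranteed for any S with at most r elements.\<close>
  define c where "c = 1 / (40 * 2 ^ r :: real)"
  have c: "c > 0" by (simp add: c_def)
  \<comment> \<open>The share of N that each large prime factor may spoil, so that r of them take at
    most c / 2; r + 1 allows for r = 0.\<close>
  define d where "d = c / (2 * (real r + 1))"
  have d: "d > 0" "real r * d \<le> c / 2" using c by (auto simp: d_def field_simps)
  have "(\<lambda>p::nat. 2 * (ln (real p + 1) / real p)) \<longlonglongrightarrow> 0" by real_asymp
  then have "\<forall>\<^sub>F p in sequentially. 2 * (ln (real p + 1) / real p) < d"
    using d(1) by (rule order_tendstoD(2))
  then obtain K where K: "\<And>p. p \<ge> K \<Longrightarrow> 2 * (ln (real p + 1) / real p) < d"
    unfolding eventually_sequentially by blast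
  define small where "small = {p. prime p \<and> 2 < p \<and> p < K}"
  have fin_small: "finite small" unfolding small_def by (rule finite_subset[of _ "{..<K}"]) auto
  have "\<forall>\<^sub>F N in sequentially. \<forall>S\<in>Pow small. real N / (40 * 2 ^ card S) \<le>
      (\<Sum>q\<in>primes_avoiding S N. ln (real q))"
    using fin_small
    by (intro eventually_ball_finite ballI sum_ln_primes_not_cong_1_ge)
       (auto intro: finite_subset simp: small_def)
  moreover have "\<forall>\<^sub>F N in sequentially. real r * ln (real N) < c / 2 * real N"
    using c by real_asymp
  ultimately have "\<forall>\<^sub>F N in sequentially. (\<forall>S\<in>Pow small. real N / (40 * 2 ^ card S) \<le>
      (\<Sum>q\<in>primes_avoiding S N. ln (real q))) \<and>
      real r * ln (real N) < c / 2 * real N \<and> N \<ge> 6"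
    using eventually_ge_at_top[of "6::nat"] by eventually_elim auto
  then obtain N0 where N0: "\<And>N S. N \<ge> N0 \<Longrightarrow> S \<subseteq> small \<Longrightarrow> real N / (40 * 2 ^ card S) \<le>
      (\<Sum>q\<in>primes_avoiding S N. ln (real q))"
    and N0': "\<And>N. N \<ge> N0 \<Longrightarrow> real r * ln (real N) < c / 2 * real N \<and> N \<ge> 6"
    unfolding eventually_sequentially by blast
  show ?thesis
  proof (rule exI[of _ N0], intro allI impI)
    fix N l :: nat
    assume N: "N \<ge> N0" and l: "odd l" "card (prime_factors l) \<le> r"
    have l0: "l \<noteq> 0" using l(1) by (intro notI) simp
    have pf: "prime p \<and> 2 < p" if "p \<in> prime_factors l" for p
    proof -
      have "prime p" "p dvd l" using that by auto
      then have "p \<noteq> 2" using l(1) by auto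
      with \<open>prime p\<close> prime_ge_2_nat[of p] show ?thesis by auto
    qed
    define S where "S = {p \<in> prime_factors l. p < K}"
    define S' where "S' = {p \<in> prime_factors l. \<not> p < K}"
    have S_sub: "S \<subseteq> small" using pf by (auto simp: S_def small_def)
    have card_S: "card S \<le> r" "card S' \<le> r"
      using l(2) card_mono[of "prime_factors l" S] card_mono[of "prime_factors l" S'] by (auto simp: S_def S'_def)
    define Q where "Q = primes_avoiding S N"
    define Bad where "Bad = (\<lambda>p. {q. prime q \<and> N div 2 < q \<and> q \<le> N \<and> p dvd q - 1})"
    define D where "D = {q \<in> prime_factors l. q \<le> N}"
    \<comment> \<open>Otherwise \<open>Q\<close> is covered by the sets \<open>Bad\<close> p and by
      \<open>D\<close>, whose weights are at most c N / 2 and less than c N / 2, while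
      \<open>Q\<close> weighs at least c N.\<close>
    have ex: "\<exists>q\<in>Q. (\<forall>p\<in>S'. \<not> p dvd q - 1) \<and> \<not> q dvd l"
    proof (rule ccontr)
      assume neg: "\<not> ?thesis"
      have sub: "Q \<subseteq> (\<Union>p\<in>S'. Bad p) \<union> D"
      proof
        fix q assume "q \<in> Q"
        then show "q \<in> (\<Union>p\<in>S'. Bad p) \<union> D"
          using neg l0 by (auto simp: Q_def primes_avoiding_def Bad_def D_def prime_factors_dvd)
      qed
      have fin: "finite (Bad p)" for p by (rule finite_subset[of _ "{..N}"]) (auto simp: Bad_def)
      have finS': "finite S'" by (simp add: S'_def)
      have finD: "finite D" by (simp add: D_def)
      have ln0: "ln (real q) \<ge> 0" for q :: nat by (cases "q = 0") auto
      have "c * real N \<le> real N / (40 * 2 ^ card S)"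
        unfolding c_def using card_S by (auto simp: field_simps intro!: mult_left_mono power_increasing)
      also have "\<dots> \<le> (\<Sum>q\<in>Q. ln (real q))" unfolding Q_def by (rule N0[OF N S_sub])
      also have "\<dots> \<le> (\<Sum>q\<in>(\<Union>p\<in>S'. Bad p) \<union> D. ln (real q))"
        using sub fin finS' finD ln0 by (intro sum_mono2) auto
      also have "\<dots> \<le> (\<Sum>q\<in>(\<Union>p\<in>S'. Bad p). ln (real q)) + (\<Sum>q\<in>D. ln (real q))"
        using fin finS' finD ln0 by (subst sum.union_inter[symmetric]) (auto intro!: sum_nonneg)
      also have "(\<Sum>q\<in>(\<Union>p\<in>S'. Bad p). ln (real q)) \<le> (\<Sum>p\<in>S'. \<Sum>q\<in>Bad p. ln (real q))"
        using fin finS' ln0 by (intro sum_UNION_le) auto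
      also have "(\<Sum>q\<in>D. ln (real q)) \<le> (\<Sum>q\<in>D. ln (real N))"
        using pf by (intro sum_mono ln_mono) (auto simp: D_def prime_gt_0_nat)
      also have "\<dots> \<le> real r * ln (real N)"
      proof -
        have "card D \<le> card (prime_factors l)" by (intro card_mono) (auto simp: D_def)
        then show ?thesis using l(2) ln0[of N] by (auto intro!: mult_right_mono)
      qed
      finally have "c * real N \<le> (\<Sum>p\<in>S'. \<Sum>q\<in>Bad p. ln (real q)) + real r * ln (real N)" by simp
      also have "(\<Sum>p\<in>S'. \<Sum>q\<in>Bad p. ln (real q)) \<le> (\<Sum>p\<in>S'. real N * d)"
      proof (rule sum_mono)
        fix p assume p: "p \<in> S'"
        then have p': "prime p" "p \<ge> 3" "p \<ge> K" using pf[of p] by (auto simp: S'_def)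
        have "(\<Sum>q\<in>Bad p. ln (real q)) \<le> 2 * real N * (ln (real p + 1) / real p)"
          unfolding Bad_def using p'(1,2) by (rule sum_ln_primes_cong_1_le)
        also have "\<dots> = real N * (2 * (ln (real p + 1) / real p))" by simp
        also have "\<dots> \<le> real N * d"
          using K[OF p'(3)] by (intro mult_left_mono) auto
        finally show "(\<Sum>q\<in>Bad p. ln (real q)) \<le> real N * d" .
      qed
      also have "\<dots> = real N * (real (card S') * d)" by simp
      also have "\<dots> \<le> real N * (c / 2)"
      proof (rule mult_left_mono)
        have "real (card S') * d \<le> real r * d" using card_S(2) d(1) by (intro mult_right_mono) auto
        then show "real (card S') * d \<le> c / 2" using d(2) by linarith
      qed simp
      finally have "c * real N \<le> c * real N / 2 + real r * ln (real N)" by (simp add: mult.commute)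
      moreover have "real r * ln (real N) < c * real N / 2" using N0'[OF N] by simp
      ultimately show False by linarith
    qed
    then obtain q where q: "q \<in> Q" "\<And>p. p \<in> S' \<Longrightarrow> \<not> p dvd q - 1" "\<not> q dvd l" by blast
    have q': "prime q" "N div 2 < q" "q \<le> N" "\<And>p. p \<in> S \<Longrightarrow> \<not> [q = 1] (mod p)"
      using q(1) by (auto simp: Q_def primes_avoiding_def)
    have "2 < q" using q'(2) N0'[OF N] by linarith
    moreover have "coprime l (q - 1)"
    proof (rule ccontr)
      assume "\<not> coprime l (q - 1)"
      then have "gcd l (q - 1) \<noteq> 1" by (simp only: coprime_iff_gcd_eq_1 not_False_eq_True)
      then obtain p where "prime p" "p dvd gcd l (q - 1)" using prime_factor_nat by blast
      then have p: "prime p" "p dvd l" "p dvd q - 1" by auto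
      then have "p \<in> prime_factors l" using l0 by (simp add: prime_factors_dvd)
      then have "p \<in> S \<or> p \<in> S'" by (auto simp: S_def S'_def)
      moreover have "[q = 1] (mod p)" using p(3) \<open>2 < q\<close> by (simp add: cong_altdef_nat)
      ultimately show False using q'(4) q(2) p(3) by blast
    qed
    moreover have "N < 2 * q" using q'(2) by linarith
    ultimately show "\<exists>q. prime q \<and> 2 < q \<and> q \<le> N \<and> N < 2 * q \<and> coprime l (q - 1) \<and> \<not> q dvd l"
      using q'(1,3) q(3) by blast
  qed
qed

section \<open>From the prime to the product\<close>

text \<open>Written with powers of 1 - q, the cofactor is visibly congruent to l modulo q; q^2
  dividing the left side would therefore force q to divide l.\<close>

lemma one_plus_power_odd_int:
  fixes q :: int
  assumes "odd l"
  shows "(q - 1) ^ l + 1 = q * (\<Sum>i<l. (1 - q) ^ i)"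
proof -
  have "1 - (1 - q) ^ l = (1 - (1 - q)) * (\<Sum>i<l. (1 - q) ^ i)" by (rule one_diff_power_eq)
  moreover have "(1 - q) ^ l = - ((q - 1) ^ l)" using assms by (metis minus_diff_eq power_minus_odd)
  ultimately show ?thesis by simp
qed

lemma not_powerful_Omega:
  assumes q: "prime q" "2 < q" "q \<le> n + 1" "n + 1 < 2 * q"
    and l: "odd l" "coprime l (q - 1)" "\<not> q dvd l"
  shows "\<not> powerful (Omega l n)"
proof
  assume pow: "powerful (Omega l n)"
  have int_q: "int (q - 1) = int q - 1" using q by (simp add: of_nat_diff)
  have fact_eq: "int ((q - 1) ^ l + 1) = int q * (\<Sum>i<l. (1 - int q) ^ i)"
    using one_plus_power_odd_int[OF l(1), of "int q"] by (simp only: int_q of_nat_add of_nat_power of_nat_1)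
  have dvd1: "q dvd (q - 1) ^ l + 1"
    unfolding int_dvd_int_iff [symmetric] fact_eq by simp
  have ndvd2: "\<not> q\<^sup>2 dvd (q - 1) ^ l + 1"
  proof
    assume "q\<^sup>2 dvd (q - 1) ^ l + 1"
    then have "int q * int q dvd int q * (\<Sum>i<l. (1 - int q) ^ i)"
      unfolding fact_eq [symmetric] by (metis int_dvd_int_iff of_nat_mult power2_eq_square)
    then have "int q dvd (\<Sum>i<l. (1 - int q) ^ i)" using q by simp
    moreover have "[(\<Sum>i<l. (1 - int q) ^ i) = (\<Sum>i<l. 1 ^ i)] (mod int q)"
      by (intro cong_sum cong_pow) (simp add: cong_iff_dvd_diff)
    ultimately have "int q dvd int l" by (simp add: cong_dvd_iff)
    then show False using l(3) by simp
  qed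
  have only: "a = q - 1" if a: "a \<in> {1..n}" and dvd: "q dvd a ^ l + 1" for a
  proof -
    \<comment> \<open>A natural number congruent to -a modulo q. As l is odd, b ^ l is congruent to
      1.\<close>
    define b where "b = (q - 1) * a"
    have l0: "l \<noteq> 0" using l(1) by (intro notI) simp
    have b: "[int b = - int a] (mod int q)"
    proof -
      have "int b - - int a = int q * int a"
        unfolding b_def of_nat_mult int_q by (simp add: algebra_simps)
      then show ?thesis by (simp add: cong_iff_dvd_diff)
    qed
    then have "[int b ^ l = (- int a) ^ l] (mod int q)" by (rule cong_pow)
    moreover have "[(- int a) ^ l = 1] (mod int q)"
    proof -
      have "(- int a) ^ l - 1 = - int (a ^ l + 1)" using l(1) by simp
      then show ?thesis using dvd unfolding cong_iff_dvd_diff by (simp only: dvd_minus_iff int_dvd_int_iff)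
    qed
    ultimately have "[int b ^ l = 1] (mod int q)" by (rule cong_trans)
    then have bl: "[b ^ l = 1] (mod q)" by (simp flip: cong_int_iff)
    have "\<not> q dvd b"
    proof
      assume "q dvd b"
      then have "q dvd b ^ l" using l0 by (simp add: dvd_power_iff_le dvd_trans[OF _ dvd_power])
      then have "q dvd 1" using bl cong_dvd_iff by blast
      then show False using q(2) by simp
    qed
    then have fermat: "[b ^ (q - 1) = 1] (mod q)" using q(1) by (intro fermat_theorem)
    \<comment> \<open>Bezout: b^(l x) is 1 because b^l is, and it is b by Fermat; so b, which is -a,
      is congruent to 1.\<close>
    obtain x y where xy: "l * x = (q - 1) * y + 1"
      using bezout_nat[OF l0, of "q - 1"] l(2) by auto
    have "[b ^ (l * x) = 1] (mod q)" using cong_pow[OF bl, of x] by (simp add: power_mult)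
    moreover have "[b ^ ((q - 1) * y + 1) = b] (mod q)"
    proof -
      have "b ^ ((q - 1) * y + 1) = (b ^ (q - 1)) ^ y * b" by (simp only: power_add power_one_right power_mult)
      then show ?thesis using cong_mult[OF cong_pow[OF fermat, of y] cong_refl[of b]]
        by (simp only: power_one mult_1)
    qed
    ultimately have "[b = 1] (mod q)" unfolding xy by (meson cong_sym cong_trans)
    then have "[int b = 1] (mod int q)" by (simp flip: cong_int_iff)
    then have "[- int a = 1] (mod int q)" using b by (meson cong_sym cong_trans)
    then have "int q dvd - (int a + 1)" by (simp add: cong_iff_dvd_diff)
    then have "int q dvd int (a + 1)" by (simp only: dvd_minus_iff of_nat_add of_nat_1)
    then have "q dvd a + 1" by (simp only: int_dvd_int_iff)
    then obtain k where k: "a + 1 = q * k" by (rule dvdE)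
    \<comment> \<open>a + 1 is a multiple of q of size at most n + 1 < 2q, so it is q
      itself.\<close>
    have "q * k < q * 2" unfolding k [symmetric] using a q(4) by simp
    then have "k < 2" by simp
    moreover have "k \<noteq> 0" using k by (intro notI) simp
    ultimately have "k = 1" by simp
    with k show ?thesis by simp
  qed
  define R where "R = (\<Prod>a\<in>{1..n} - {q - 1}. a ^ l + 1)"
  have Omega_eq: "Omega l n = ((q - 1) ^ l + 1) * R"
    unfolding Omega_def R_def using q by (intro prod.remove) auto
  have "q\<^sup>2 dvd Omega l n"
    using pow q(1) dvd1 unfolding powerful_def Omega_eq by (meson dvd_mult2)
  moreover have "coprime (q\<^sup>2) R"
    unfolding R_def
  proof (rule prod_coprime_right)
    fix a assume "a \<in> {1..n} - {q - 1}"
    then have "\<not> q dvd a ^ l + 1" using only by blast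
    then have "coprime q (a ^ l + 1)" using q(1) by (intro prime_imp_coprime)
    then show "coprime (q\<^sup>2) (a ^ l + 1)" by simp
  qed
  ultimately have "q\<^sup>2 dvd (q - 1) ^ l + 1"
    unfolding Omega_eq by (simp only: coprime_dvd_mult_left_iff)
  with ndvd2 show False by contradiction
qed

theorem theorem2:
  fixes r :: nat
  assumes "r \<ge> 1"
  shows "\<exists>T::nat. T > 0 \<and>
    (\<forall>l n. l > 0 \<longrightarrow> odd l \<longrightarrow> card (prime_factors l) \<le> r \<longrightarrow> n \<ge> T
       \<longrightarrow> \<not> powerful (Omega l n))"
proof -
  obtain N0 where N0: "\<And>N l. N \<ge> N0 \<Longrightarrow> odd l \<Longrightarrow> card (prime_factors l) \<le> r \<Longrightarrow>
      \<exists>q::nat. prime q \<and> 2 < q \<and> q \<le> N \<and> N < 2 * q \<and> coprime l (q - 1) \<and> \<not> q dvd l"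
    using exists_prime_coprime[of r] by blast
  show ?thesis
  proof (rule exI[of _ "Suc N0"], intro conjI allI impI)
    fix l n :: nat
    assume l: "odd l" "card (prime_factors l) \<le> r" and n: "n \<ge> Suc N0"
    have "n + 1 \<ge> N0" using n by simp
    from N0[OF this l] obtain q where "prime q" "2 < q" "q \<le> n + 1" "n + 1 < 2 * q" "coprime l (q - 1)" "\<not> q dvd l"
      by blast
    with l show "\<not> powerful (Omega l n)" by (intro not_powerful_Omega)
  qed simp
qed

end
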